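(* Let $q\in(0,1)$, $s\in(-1,0)$, $u_y\in[0,1)$, $\theta_x\in[-s,-s^{-1}]$ for $x,y\in\mathbb{Z}_{\ge1}$, and $\alpha,\beta\in[0,-s^{-1}]$ with $\alpha\beta<1$ and $\alpha\theta_x<1$ for all $x$. Let $\boldsymbol\lambda=\{\lambda^{(x,y)}\}_{x,y\ge0}$ be the sHL/sqW Yang-Baxter field with $(\alpha,\beta)$-scaled geometric boundary conditions. Let $\mathcal{H}^{\mathrm{HS}}$ be the centered height function of the stochastic higher spin six vertex model with $(\alpha,\beta)$-stationary boundary conditions, and let $\mathcal{M}$ be a $q$-Poisson random variable with parameter $\alpha\beta$, i.e. $\mathrm{Prob}(\mathcal{M}=k)=\frac{(\alpha\beta)^k}{(q;q)_k}(\alpha\beta;q)_\infty$, $k\ge0$, independent of the vertex model. Then the two random fields $\{y-\ell(\lambda^{(x,y)}):x,y\in\mathbb{Z}_{\ge0}\}$ and $\{\mathcal{H}^{\mathrm{HS}}(x,y)-\mathcal{M}:x,y\in\mathbb{Z}_{\ge0}\}$ are equal in distribution.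
   Context: **Notation.** $(a;q)_n=\prod_{i=1}^{n}(1-aq^{i-1})$ for $n\ge0$, $(a;q)_n=\prod_{i=n}^{-1}(1-aq^i)^{-1}$ for $n<0$, $(a;q)_\infty=\prod_{i\ge1}(1-aq^{i-1})$; ${}_{4}\overline\phi_3\bigl(q^{-n};a_1,a_2,a_3;\,b_1,b_2,b_3\,|\,q,z\bigr)=\sum_{j=0}^nz^j\frac{(q^{-n};q)_j}{(q;q)_j}\prod_{i=1}^3(a_i;q)_j(q^jb_i;q)_{n-j}$. A Young diagram $\lambda=1^{l_1}2^{l_2}\cdots$ has $l_i$ parts equal to $i$; $\ell(\lambda)=\sum_il_i$. **Fused weights** (rational in $q^J,q^I$, which are treated as independent parameters): $$w^{(J)}_{u}(i_1,j_1;i_2,j_2)=\mathbf{1}_{i_1+j_1=i_2+j_2}\frac{(-1)^{i_1+j_2}q^{\frac12i_1(i_1-1+2j_1)}s^{j_2-i_1}u^{i_1}(u/s;q)_{j_1-i_2}(q;q)_{j_1}}{(q;q)_{i_1}(q;q)_{j_2}(su;q)_{j_1+i_1}}\,{}_4\overline\phi_3\bigl(q^{-i_1};q^{-i_2},suq^J,qs/u;\,s^2,q^{1+j_2-i_1},q^{1-i_2-j_2+J}\,|\,q,q\bigr),$$ $$w^{*,(I)}_{v}(i_1,j_1;i_2,j_2)=\frac{(s^2;q)_{i_1}(q;q)_{i_2}}{(q;q)_{i_1}(s^2;q)_{i_2}}w^{(I)}_{v}(i_2,j_1;i_1,j_2),\qquad b^{(J)}_u(k)=(-uq^J)^k\frac{(q^{-J};q)_k}{(q;q)_k},$$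 $$R^{(I,J)}_z(i_1,j_1;i_2,j_2)=\mathbf{1}_{i_2+j_1=i_1+j_2}\frac{q^{i_1i_2+\frac12j_2(j_2-1)+j_2J}(-z)^{j_2}(q;q)_{j_1}}{(z;q)_{j_1+i_2}(q;q)_{j_2}(q;q)_{i_2}(q^{1-J}/z;q)_{i_1-j_1}}\,{}_4\overline\phi_3\bigl(q^{-i_2};q^{-i_1},zq^I,q^{1-J}/z;\,q^{-J},q^{1+j_2-i_2},q^{1-i_1-j_2+I}\,|\,q,q\bigr),$$ $$\Pi=\frac{(uvq^I;q)_\infty(uvq^J;q)_\infty}{(uv;q)_\infty(uvq^{I+J};q)_\infty}.$$ **Specializations.** A row specialization $\rho$ means a choice of $(u,q^J)$, and a column specialization $\rho^*$ a choice of $(v,q^I)$. Rows: $\mathrm{sHL}(u)$ is $(u,q)$ (i.e. $J=1$); $\mathrm{sg}(\alpha)$ is $(-\epsilon\alpha,1/\epsilon)$ with the limit $\epsilon\to0$ taken in all formulas. Columns: $\mathrm{sqW}(\theta)$ is $(v,q^I)=(s,-\theta/s)$; $\mathrm{sg}(\beta)$ is $(-\epsilon\beta,1/\epsilon)$, $\epsilon\to0$. Denote the specialized weights by $w^\rho$, $w^{*,\rho^*}$, $b_\rho$, $b_{\rho^*}$ (the latter is $b^{(I)}_v$), $R^{\rho,\rho^*}$ (which is $R^{(I,J)}_{uv}$) and $\Pi_{\rho,\rho^*}$ (values at special parameter points are understood by continuity). Horizontal occupation numbers belonging to an sHL specialization are in $\{0,1\}$; those belonging to sqW and sg specializations are in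 $\mathbb{Z}_{\ge0}$. In the stated parameter range all these weights are nonnegative and satisfy, for all boundary data $c=(a,a',m;b,b',l)$, the Yang-Baxter equation $$\sum_{k,p,p'}R(a,a';p',p)w^*(m,p;k,b)w(k,p';l,b')=\sum_{n,t,t'}w^*(n,a';l,t')w(m,a;n,t)R(t,t';b',b).\quad(\mathrm{YB}_c)$$ **Bijectivization.** For each pair $(\rho,\rho^* )$ and each $c$ with positive sums, fix a coupling of the two probability measures on triples $(k,p,p')$ and $(n,t,t')$ proportional to the summands on the two sides of $(\mathrm{YB}_c)$, and let $\mathbf{p}_c((k,p,p')\to(n,t,t'))$ be the conditional probability of $(n,t,t')$ given $(k,p,p')$. **Forward transition $\varkappa\to\nu$ given $\lambda,\mu$ with specializations $\rho,\rho^*$.** Let $\varkappa=1^{k_1}2^{k_2}\cdots$, $\mu=1^{m_1}2^{m_2}\cdots$, $\lambda=1^{l_1}2^{l_2}\cdots$, $i_h=\sum_{r>h}(m_r-k_r)$, $i'_h=\sum_{r>h}(l_r-k_r)$. Choose $(j_0,j_0')$ with probability $$\frac{b_{\rho^*}(j_0')\,b_\rho(j_0)\,R^{\rho,\rho^*}(j_0,j_0';i_0',i_0)}{\Pi_{\rho,\rho^*}\,b_{\rho^*}(i_0)\,b_\rho(i_0')}.$$ Then for $h=1,2,\dots$ choose $(n_h,j_h,j_h')$ with probability $\mathbf{p}_c((k_h,i_{h-1},i'_{h-1})\to(n_h,j_h,j'_h))$, $c=(j_{h-1},j'_{h-1},m_h;i_h,i'_h,l_h)$. Output $\nu=1^{n_1}2^{n_2}\cdots$.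 Couplings are chosen so that almost surely $j_h=j_h'=0$ for large $h$ (such couplings exist). **The field.** Put $\rho_0=\mathrm{sg}(\alpha)$, $\rho_y=\mathrm{sHL}(u_y)$ for $y\ge1$; $\rho^*_0=\mathrm{sg}(\beta)$, $\rho^*_x=\mathrm{sqW}(\theta_x)$ for $x\ge1$. Define $\eta^{(x,y)}$ for $x,y\ge-1$ by $\eta^{(x,-1)}=\eta^{(-1,y)}=\varnothing$ and, inductively in $x+y$ with independent randomness, $\eta^{(x,y)}$ ($x,y\ge0$) is the output of the forward transition with $\varkappa=\eta^{(x-1,y-1)}$, $\mu=\eta^{(x,y-1)}$, $\lambda=\eta^{(x-1,y)}$ and specializations $\rho_y,\rho^*_x$. Then $\boldsymbol\lambda$ is the restriction of $\boldsymbol\eta$ to $x,y\ge0$. "The" Yang-Baxter field means any field so obtained, for any choice (for each pair $(\rho,\rho^* )$ and each $c$ with positive sums) of couplings of the two probability measures proportional to the summands on the two sides of $(\mathrm{YB}_c)$ such that almost surely $j_h=j_h'=0$ for large $h$. **Stochastic higher spin six vertex model.** A random configuration of up-right directed paths on $\mathbb{Z}_{\ge0}^2$, any number of paths per vertical edge, at most one per horizontal edge. Vertex $(x,y)$, $x,y\ge1$, has configuration $(i_1,j_1;i_2,j_2)$ ($i_1$: enter from below, $j_1$: enter from the left, $i_2$: exit up, $j_2$: exit right). Sequentially in $x+y$ and independently given the inputs, $(i_2,j_2)$ is chosen given $(i_1,j_1)$ with probability $\mathcal{L}_{u_y,\theta_x}(i_1,j_1;i_2,j_2)$, where for $g\in\mathbb{Z}_{\ge0}$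 $$\mathcal{L}_{u,\theta}(g,0;g,0)=\frac{q^g+u\theta}{1+u\theta},\quad \mathcal{L}_{u,\theta}(g,0;g-1,1)=\frac{1-q^g}{1+u\theta},\quad \mathcal{L}_{u,\theta}(g,1;g,1)=\frac{1-usq^g}{1+u\theta},\quad \mathcal{L}_{u,\theta}(g,1;g+1,0)=\frac{u(\theta+sq^g)}{1+u\theta},$$ all others $0$. The $(\alpha,\beta)$-stationary boundary conditions: independent random variables $b^{\mathrm h}_x\in\mathbb{Z}_{\ge0}$ with $\mathrm{Prob}(b^{\mathrm h}_x=k)=(\alpha\theta_x)^k\frac{(-s/\theta_x;q)_k}{(q;q)_k}\frac{(\alpha\theta_x;q)_\infty}{(-s\alpha;q)_\infty}$ (number of paths entering $(x,1)$ from below) and $b^{\mathrm v}_y\in\{0,1\}$ with $\mathrm{Prob}(b^{\mathrm v}_y=1)=\frac1{1+u_y\beta}$ (number of paths entering $(1,y)$ from the left). The centered height function is $$\mathcal{H}^{\mathrm{HS}}(x,y)=\#\{1\le k\le y:\text{ the horizontal edge }(x,k)\to(x+1,k)\text{ is occupied}\}-\sum_{k=1}^xb^{\mathrm h}_k.$$ *)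

theory Defs
  imports "HOL-Probability.Probability" "HOL-Library.Multiset"
begin

definition qpoch :: "real \<Rightarrow> real \<Rightarrow> int \<Rightarrow> real" where
  "qpoch q a n =
     (if 0 \<le> n then (\<Prod>i=1..nat n. 1 - a * q ^ (i - 1))
      else (\<Prod>i=n..-1. inverse (1 - a * q powi i)))"

definition qpoch_inf :: "real \<Rightarrow> real \<Rightarrow> real" where
  "qpoch_inf q a = (\<Prod>i. 1 - a * q ^ i)"

definition phi43 ::
  "real \<Rightarrow> nat \<Rightarrow> real \<times> real \<times> real \<Rightarrow> real \<times> real \<times> real \<Rightarrow> real \<Rightarrow> real" where
  "phi43 q n = (\<lambda>(a1, a2, a3) (b1, b2, b3) z.
     (\<Sum>j=0..n. z ^ j * (qpoch q (q powi (- int n)) (int j) / qpoch q q (int j)) *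
        (qpoch q a1 (int j) * qpoch q (q ^ j * b1) (int (n - j))) *
        (qpoch q a2 (int j) * qpoch q (q ^ j * b2) (int (n - j))) *
        (qpoch q a3 (int j) * qpoch q (q ^ j * b3) (int (n - j)))))"

text \<open>A specialization is a pair \<open>(u, X)\<close> or \<open>(v, Y)\<close>, where \<open>X\<close> stands for \<open>q^J\<close> and
  \<open>Y\<close> for \<open>q^I\<close>, both being independent parameters. The following formulas are meaningful where
  no denominator vanishes; the other values are recovered by limits below.\<close>

definition w_gen ::
  "real \<Rightarrow> real \<Rightarrow> real \<times> real \<Rightarrow> nat \<Rightarrow> nat \<Rightarrow> nat \<Rightarrow> nat \<Rightarrow> real" where
  "w_gen q s = (\<lambda>(u, X) i1 j1 i2 j2.
     (if i1 + j1 = i2 + j2 then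
        (-1) ^ (i1 + j2) * q ^ (i1 * (i1 - 1 + 2 * j1) div 2) * s powi (int j2 - int i1) * u ^ i1 *
        qpoch q (u / s) (int j1 - int i2) * qpoch q q (int j1) /
        (qpoch q q (int i1) * qpoch q q (int j2) * qpoch q (s * u) (int (j1 + i1))) *
        phi43 q i1 (q powi (- int i2), s * u * X, q * s / u)
          (s\<^sup>2, q powi (1 + int j2 - int i1), q powi (1 - int i2 - int j2) * X) q
      else 0))"

definition wstar_gen ::
  "real \<Rightarrow> real \<Rightarrow> real \<times> real \<Rightarrow> nat \<Rightarrow> nat \<Rightarrow> nat \<Rightarrow> nat \<Rightarrow> real" where
  "wstar_gen q s = (\<lambda>vY i1 j1 i2 j2.
     qpoch q (s\<^sup>2) (int i1) * qpoch q q (int i2) / (qpoch q q (int i1) * qpoch q (s\<^sup>2) (int i2)) *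
     w_gen q s vY i2 j1 i1 j2)"

definition b_gen :: "real \<Rightarrow> real \<times> real \<Rightarrow> nat \<Rightarrow> real" where
  "b_gen q = (\<lambda>(u, X) k. (- u * X) ^ k * qpoch q (inverse X) (int k) / qpoch q q (int k))"

definition R_gen ::
  "real \<Rightarrow> real \<times> real \<Rightarrow> real \<times> real \<Rightarrow> nat \<Rightarrow> nat \<Rightarrow> nat \<Rightarrow> nat \<Rightarrow> real" where
  "R_gen q = (\<lambda>(u, X) (v, Y) i1 j1 i2 j2. let z = u * v in
     (if i2 + j1 = i1 + j2 then
        q ^ (i1 * i2 + j2 * (j2 - 1) div 2) * X ^ j2 * (- z) ^ j2 * qpoch q q (int j1) /
        (qpoch q z (int (j1 + i2)) * qpoch q q (int j2) * qpoch q q (int i2) *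
         qpoch q (q / X / z) (int i1 - int j1)) *
        phi43 q i2 (q powi (- int i1), z * Y, q / X / z)
          (inverse X, q powi (1 + int j2 - int i2), q powi (1 - int i1 - int j2) * Y) q
      else 0))"

definition Pi_gen :: "real \<Rightarrow> real \<times> real \<Rightarrow> real \<times> real \<Rightarrow> real" where
  "Pi_gen q = (\<lambda>(u, X) (v, Y).
     qpoch_inf q (u * v * Y) * qpoch_inf q (u * v * X) /
     (qpoch_inf q (u * v) * qpoch_inf q (u * v * X * Y)))"

datatype row_spec = sHL real | sg_row real
datatype col_spec = sqW real | sg_col real

text \<open>A specialization is encoded by the filter along which its generic parameters are sent to
  their special values. For \<open>sg\<close> this is the limit \<open>\<epsilon> \<rightarrow> 0\<close> of \<open>(- \<epsilon> a, 1 / \<epsilon>)\<close>.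
  The punctured limits \<open>u' \<rightarrow> u\<close> and \<open>a \<rightarrow> \<alpha>\<close> supply by continuity the values at points where the
  explicit formulas have removable singularities, for instance \<open>u = 0\<close>, \<open>\<alpha> = 0\<close>, or
  \<open>- \<alpha> s = q ^ k\<close> in the weight \<open>R\<close> for the pair \<open>sg(\<alpha>)\<close>, \<open>sqW(\<theta>)\<close>.
  At \<open>(s, - \<theta> / s)\<close> no limit is required, and the point has to be kept fixed: moving both
  \<open>a\<close> and \<open>v\<close> would make the singular curves of the formula for \<open>R\<close> accumulate.\<close>

definition sg_filter :: "real \<Rightarrow> (real \<times> real) filter" where
  "sg_filter \<alpha> = filtermap (\<lambda>(\<epsilon>, a). (- \<epsilon> * a, 1 / \<epsilon>)) (at 0 \<times>\<^sub>F at \<alpha>)"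

fun row_filter :: "real \<Rightarrow> row_spec \<Rightarrow> (real \<times> real) filter" where
  "row_filter q (sHL u) = filtermap (\<lambda>u'. (u', q)) (at u)"
| "row_filter q (sg_row \<alpha>) = sg_filter \<alpha>"

fun col_filter :: "real \<Rightarrow> col_spec \<Rightarrow> (real \<times> real) filter" where
  "col_filter s (sqW \<theta>) = principal {(s, - \<theta> / s)}"
| "col_filter s (sg_col \<beta>) = sg_filter \<beta>"

fun row_occ :: "row_spec \<Rightarrow> nat set" where
  "row_occ (sHL u) = {0, 1}"
| "row_occ (sg_row \<alpha>) = UNIV"

definition w_spec ::
  "real \<Rightarrow> real \<Rightarrow> row_spec \<Rightarrow> nat \<Rightarrow> nat \<Rightarrow> nat \<Rightarrow> nat \<Rightarrow> real" where
  "w_spec q s \<rho> i1 j1 i2 j2 = Lim (row_filter q \<rho>) (\<lambda>uX. w_gen q s uX i1 j1 i2 j2)"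

definition wstar_spec ::
  "real \<Rightarrow> real \<Rightarrow> col_spec \<Rightarrow> nat \<Rightarrow> nat \<Rightarrow> nat \<Rightarrow> nat \<Rightarrow> real" where
  "wstar_spec q s \<rho>' i1 j1 i2 j2 = Lim (col_filter s \<rho>') (\<lambda>vY. wstar_gen q s vY i1 j1 i2 j2)"

definition b_row :: "real \<Rightarrow> row_spec \<Rightarrow> nat \<Rightarrow> real" where
  "b_row q \<rho> k = Lim (row_filter q \<rho>) (\<lambda>uX. b_gen q uX k)"

definition b_col :: "real \<Rightarrow> real \<Rightarrow> col_spec \<Rightarrow> nat \<Rightarrow> real" where
  "b_col q s \<rho>' k = Lim (col_filter s \<rho>') (\<lambda>vY. b_gen q vY k)"

definition R_spec ::
  "real \<Rightarrow> real \<Rightarrow> row_spec \<Rightarrow> col_spec \<Rightarrow> nat \<Rightarrow> nat \<Rightarrow> nat \<Rightarrow> nat \<Rightarrow> real" where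
  "R_spec q s \<rho> \<rho>' i1 j1 i2 j2 =
     Lim (row_filter q \<rho> \<times>\<^sub>F col_filter s \<rho>') (\<lambda>(uX, vY). R_gen q uX vY i1 j1 i2 j2)"

definition Pi_spec :: "real \<Rightarrow> real \<Rightarrow> row_spec \<Rightarrow> col_spec \<Rightarrow> real" where
  "Pi_spec q s \<rho> \<rho>' = Lim (row_filter q \<rho> \<times>\<^sub>F col_filter s \<rho>') (\<lambda>(uX, vY). Pi_gen q uX vY)"

type_synonym triple = "nat \<times> nat \<times> nat"

text \<open>Boundary data \<open>(a, a', m, b, b', l)\<close>.\<close>

type_synonym ybdata = "nat \<times> nat \<times> nat \<times> nat \<times> nat \<times> nat"

definition yb_left :: "real \<Rightarrow> real \<Rightarrow> row_spec \<Rightarrow> col_spec \<Rightarrow> ybdata \<Rightarrow> triple \<Rightarrow> real" where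
  "yb_left q s \<rho> \<rho>' = (\<lambda>(a, a', m, b, b', l) (k, p, p').
     (if p' \<in> row_occ \<rho> then
        R_spec q s \<rho> \<rho>' a a' p' p * wstar_spec q s \<rho>' m p k b * w_spec q s \<rho> k p' l b'
      else 0))"

definition yb_right :: "real \<Rightarrow> real \<Rightarrow> row_spec \<Rightarrow> col_spec \<Rightarrow> ybdata \<Rightarrow> triple \<Rightarrow> real" where
  "yb_right q s \<rho> \<rho>' = (\<lambda>(a, a', m, b, b', l) (n, t, t').
     (if t \<in> row_occ \<rho> then
        wstar_spec q s \<rho>' n a' l t' * w_spec q s \<rho> m a n t * R_spec q s \<rho> \<rho>' t t' b' b
      else 0))"

text \<open>By the conservation laws only finitely many triples contribute to the sums below.\<close>

definition yb_coupling ::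
  "real \<Rightarrow> real \<Rightarrow> row_spec \<Rightarrow> col_spec \<Rightarrow> (ybdata \<Rightarrow> (triple \<times> triple) pmf) \<Rightarrow> bool" where
  "yb_coupling q s \<rho> \<rho>' C \<longleftrightarrow>
     (\<forall>a a' m b b' l. let c = (a, a', m, b, b', l);
          SL = infsum (yb_left q s \<rho> \<rho>' c) UNIV; SR = infsum (yb_right q s \<rho> \<rho>' c) UNIV in
        a \<in> row_occ \<rho> \<longrightarrow> b' \<in> row_occ \<rho> \<longrightarrow> 0 < SL \<longrightarrow> 0 < SR \<longrightarrow>
          (\<forall>\<tau>. pmf (map_pmf fst (C c)) \<tau> = yb_left q s \<rho> \<rho>' c \<tau> / SL) \<and>
          (\<forall>\<tau>. pmf (map_pmf snd (C c)) \<tau> = yb_right q s \<rho> \<rho>' c \<tau> / SR))"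

definition yb_forward :: "(ybdata \<Rightarrow> (triple \<times> triple) pmf) \<Rightarrow> ybdata \<Rightarrow> triple \<Rightarrow> triple \<Rightarrow> real" where
  "yb_forward C c \<tau> \<tau>' = pmf (C c) (\<tau>, \<tau>') / pmf (map_pmf fst (C c)) \<tau>"

text \<open>The \<open>\<sigma>\<close>-algebra generated by discrete random variables.\<close>

definition gen_by :: "'a measure \<Rightarrow> ('a \<Rightarrow> 'b) set \<Rightarrow> 'a set set" where
  "gen_by M Xs = sigma_sets (space M) {X -` B \<inter> space M | X B. X \<in> Xs}"

text \<open>Conditionally on the past \<open>\<G>\<close>, to which the discrete input belongs, the output is sampled
  from \<open>p input\<close>.\<close>

definition sampled ::
  "'a measure \<Rightarrow> 'a set set \<Rightarrow> ('a \<Rightarrow> 'i) \<Rightarrow> ('a \<Rightarrow> 'o) \<Rightarrow> ('i \<Rightarrow> 'o \<Rightarrow> real) \<Rightarrow> bool" where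
  "sampled M \<G> In Out p \<longleftrightarrow>
     (\<forall>A\<in>\<G>. \<forall>i r. measure M (A \<inter> {\<omega> \<in> space M. In \<omega> = i \<and> Out \<omega> = r}) =
                  measure M (A \<inter> {\<omega> \<in> space M. In \<omega> = i}) * p i r)"

text \<open>Young diagrams are multisets of positive integers: \<open>count \<mu> r\<close> is the number of
  parts equal to \<open>r\<close>, and \<open>size \<mu>\<close> is the number of parts. In the definitions below \<open>\<Lambda>\<close>
  is the diagram usually called lambda.\<close>

definition tail :: "nat multiset \<Rightarrow> nat \<Rightarrow> nat" where
  "tail \<mu> h = size {#r \<in># \<mu>. h < r#}"

text \<open>For triples \<open>(\<kappa>, \<mu>, \<Lambda>)\<close> of positive probability the truncated differences
  below are true differences.\<close>

definition initial_prob ::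
  "real \<Rightarrow> real \<Rightarrow> row_spec \<Rightarrow> col_spec \<Rightarrow> nat multiset \<times> nat multiset \<times> nat multiset \<Rightarrow>
     nat \<times> nat \<Rightarrow> real" where
  "initial_prob q s \<rho> \<rho>' = (\<lambda>(\<kappa>, \<mu>, \<Lambda>) (j, j').
     let i = tail \<mu> 0 - tail \<kappa> 0; i' = tail \<Lambda> 0 - tail \<kappa> 0 in
       b_col q s \<rho>' j' * b_row q \<rho> j * R_spec q s \<rho> \<rho>' j j' i' i /
       (Pi_spec q s \<rho> \<rho>' * b_col q s \<rho>' i * b_row q \<rho> i'))"

definition step_prob ::
  "(ybdata \<Rightarrow> (triple \<times> triple) pmf) \<Rightarrow> nat \<Rightarrow>
     (nat multiset \<times> nat multiset \<times> nat multiset) \<times> (nat \<times> nat) \<Rightarrow> triple \<Rightarrow> real" where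
  "step_prob C h = (\<lambda>((\<kappa>, \<mu>, \<Lambda>), (j, j')).
     yb_forward C
       (j, j', count \<mu> h, tail \<mu> h - tail \<kappa> h, tail \<Lambda> h - tail \<kappa> h, count \<Lambda> h)
       (count \<kappa> h, tail \<mu> (h - 1) - tail \<kappa> (h - 1), tail \<Lambda> (h - 1) - tail \<kappa> (h - 1)))"

text \<open>Diagrams of the field with an index \<open>-1\<close> are empty.\<close>

definition field_input ::
  "(nat \<Rightarrow> nat \<Rightarrow> 'a \<Rightarrow> nat multiset) \<Rightarrow> nat \<Rightarrow> nat \<Rightarrow> 'a \<Rightarrow>
     nat multiset \<times> nat multiset \<times> nat multiset" where
  "field_input \<eta> x y \<omega> =
     (if x = 0 \<or> y = 0 then {#} else \<eta> (x - 1) (y - 1) \<omega>,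
      if y = 0 then {#} else \<eta> x (y - 1) \<omega>,
      if x = 0 then {#} else \<eta> (x - 1) y \<omega>)"

text \<open>The random variables \<open>J x y h\<close>, \<open>J' x y h\<close> are the \<open>j\<^sub>h\<close>, \<open>j'\<^sub>h\<close> sampled at the vertex
  \<open>(x, y)\<close>, while \<open>n\<^sub>h\<close> is \<open>count (\<eta> x y \<omega>) h\<close>. The past of step \<open>h\<close> at \<open>(x, y)\<close> consists of everything
  sampled at the other vertices on the same and on the previous antidiagonals, together with the
  previous steps at \<open>(x, y)\<close>. Step \<open>h\<close> using only the diagrams and \<open>(j, j')\<close> of step \<open>h - 1\<close> expresses
  the independence of the randomness.\<close>

definition field_data ::
  "(nat \<Rightarrow> nat \<Rightarrow> 'a \<Rightarrow> nat multiset) \<Rightarrow>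
   (nat \<Rightarrow> nat \<Rightarrow> nat \<Rightarrow> 'a \<Rightarrow> nat) \<Rightarrow> (nat \<Rightarrow> nat \<Rightarrow> nat \<Rightarrow> 'a \<Rightarrow> nat) \<Rightarrow>
   nat \<Rightarrow> nat \<Rightarrow> nat \<Rightarrow> 'a \<Rightarrow> triple" where
  "field_data \<eta> J J' x y h \<omega> = (count (\<eta> x y \<omega>) h, J x y h \<omega>, J' x y h \<omega>)"

definition field_past ::
  "'a measure \<Rightarrow> (nat \<Rightarrow> nat \<Rightarrow> nat \<Rightarrow> 'a \<Rightarrow> triple) \<Rightarrow> nat \<Rightarrow> nat \<Rightarrow> nat \<Rightarrow> 'a set set" where
  "field_past M Z x y h = gen_by M
     ({Z x' y' g | x' y' g. x' + y' \<le> x + y \<and> (x', y') \<noteq> (x, y)} \<union> {Z x y g | g. g < h})"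

definition yang_baxter_field ::
  "'a measure \<Rightarrow> real \<Rightarrow> real \<Rightarrow> (nat \<Rightarrow> row_spec) \<Rightarrow> (nat \<Rightarrow> col_spec) \<Rightarrow>
   (row_spec \<Rightarrow> col_spec \<Rightarrow> ybdata \<Rightarrow> (triple \<times> triple) pmf) \<Rightarrow>
   (nat \<Rightarrow> nat \<Rightarrow> 'a \<Rightarrow> nat multiset) \<Rightarrow> bool" where
  "yang_baxter_field M q s \<rho> \<rho>' C \<eta> \<longleftrightarrow>
     prob_space M \<and>
     (\<forall>x y. yb_coupling q s (\<rho> y) (\<rho>' x) (C (\<rho> y) (\<rho>' x))) \<and>
     (\<forall>x y. \<eta> x y \<in> M \<rightarrow>\<^sub>M count_space UNIV) \<and>
     (\<forall>x y. \<forall>\<omega>\<in>space M. 0 \<notin># \<eta> x y \<omega>) \<and>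
     (\<exists>J J'.
        (\<forall>x y h. J x y h \<in> M \<rightarrow>\<^sub>M count_space UNIV \<and> J' x y h \<in> M \<rightarrow>\<^sub>M count_space UNIV) \<and>
        (\<forall>x y. sampled M (field_past M (field_data \<eta> J J') x y 0)
           (field_input \<eta> x y) (\<lambda>\<omega>. (J x y 0 \<omega>, J' x y 0 \<omega>))
           (initial_prob q s (\<rho> y) (\<rho>' x))) \<and>
        (\<forall>x y. \<forall>h\<ge>1. sampled M (field_past M (field_data \<eta> J J') x y h)
           (\<lambda>\<omega>. (field_input \<eta> x y \<omega>, (J x y (h - 1) \<omega>, J' x y (h - 1) \<omega>)))
           (field_data \<eta> J J' x y h)
           (step_prob (C (\<rho> y) (\<rho>' x)) h)) \<and>
        (AE \<omega> in M. \<forall>x y. eventually (\<lambda>h. J x y h \<omega> = 0 \<and> J' x y h \<omega> = 0) sequentially))"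

definition sHL_rows :: "real \<Rightarrow> (nat \<Rightarrow> real) \<Rightarrow> nat \<Rightarrow> row_spec" where
  "sHL_rows \<alpha> u y = (if y = 0 then sg_row \<alpha> else sHL (u y))"

definition sqW_cols :: "real \<Rightarrow> (nat \<Rightarrow> real) \<Rightarrow> nat \<Rightarrow> col_spec" where
  "sqW_cols \<beta> \<theta> x = (if x = 0 then sg_col \<beta> else sqW (\<theta> x))"

definition hs_weight ::
  "real \<Rightarrow> real \<Rightarrow> real \<Rightarrow> real \<Rightarrow> nat \<times> nat \<Rightarrow> nat \<times> nat \<Rightarrow> real" where
  "hs_weight q s u \<theta> = (\<lambda>(i1, j1) (i2, j2).
     (if j1 = 0 \<and> j2 = 0 \<and> i2 = i1 then (q ^ i1 + u * \<theta>) / (1 + u * \<theta>)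
      else if j1 = 0 \<and> j2 = 1 \<and> i2 + 1 = i1 then (1 - q ^ i1) / (1 + u * \<theta>)
      else if j1 = 1 \<and> j2 = 1 \<and> i2 = i1 then (1 - u * s * q ^ i1) / (1 + u * \<theta>)
      else if j1 = 1 \<and> j2 = 0 \<and> i2 = i1 + 1 then u * (\<theta> + s * q ^ i1) / (1 + u * \<theta>)
      else 0))"

text \<open>\<open>V x y\<close> is the number of paths on the edge \<open>(x, y) \<rightarrow> (x, y + 1)\<close> and \<open>H x y\<close> the number
  on the edge \<open>(x, y) \<rightarrow> (x + 1, y)\<close>, so that \<open>V x 0\<close> and \<open>H 0 y\<close>, with \<open>x, y \<ge> 1\<close>, are the
  boundary conditions.\<close>

definition hs_past ::
  "'a measure \<Rightarrow> (nat \<Rightarrow> nat \<Rightarrow> 'a \<Rightarrow> nat) \<Rightarrow> (nat \<Rightarrow> nat \<Rightarrow> 'a \<Rightarrow> nat) \<Rightarrow> nat \<Rightarrow> nat \<Rightarrow> 'a set set" where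
  "hs_past N V H x y = gen_by N
     ({V x' 0 | x'. 1 \<le> x'} \<union> {H 0 y' | y'. 1 \<le> y'} \<union>
      (\<Union>(x', y') \<in> {(x', y'). 1 \<le> x' \<and> 1 \<le> y' \<and> x' + y' \<le> x + y \<and> (x', y') \<noteq> (x, y)}.
         {V x' y', H x' y'}))"

definition hs_model ::
  "'a measure \<Rightarrow> real \<Rightarrow> real \<Rightarrow> (nat \<Rightarrow> real) \<Rightarrow> (nat \<Rightarrow> real) \<Rightarrow> real \<Rightarrow> real \<Rightarrow>
   (nat \<Rightarrow> nat \<Rightarrow> 'a \<Rightarrow> nat) \<Rightarrow> (nat \<Rightarrow> nat \<Rightarrow> 'a \<Rightarrow> nat) \<Rightarrow> bool" where
  "hs_model N q s u \<theta> \<alpha> \<beta> V H \<longleftrightarrow>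
     prob_space N \<and>
     (\<forall>x\<ge>1. \<forall>y. V x y \<in> N \<rightarrow>\<^sub>M count_space UNIV) \<and>
     (\<forall>x. \<forall>y\<ge>1. H x y \<in> N \<rightarrow>\<^sub>M count_space UNIV) \<and>
     (\<forall>x. \<forall>y\<ge>1. \<forall>\<omega>\<in>space N. H x y \<omega> \<in> {0, 1}) \<and>
     prob_space.indep_vars N (\<lambda>_. count_space UNIV)
       (\<lambda>e. case e of Inl x \<Rightarrow> V x 0 | Inr y \<Rightarrow> H 0 y) (Inl ` {1..} \<union> Inr ` {1..}) \<and>
     (\<forall>x\<ge>1. \<forall>k. measure N {\<omega> \<in> space N. V x 0 \<omega> = k} =
        (\<alpha> * \<theta> x) ^ k * qpoch q (- s / \<theta> x) (int k) / qpoch q q (int k) *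
        (qpoch_inf q (\<alpha> * \<theta> x) / qpoch_inf q (- s * \<alpha>))) \<and>
     (\<forall>y\<ge>1. measure N {\<omega> \<in> space N. H 0 y \<omega> = 1} = 1 / (1 + u y * \<beta>)) \<and>
     (\<forall>x\<ge>1. \<forall>y\<ge>1. sampled N (hs_past N V H x y)
        (\<lambda>\<omega>. (V x (y - 1) \<omega>, H (x - 1) y \<omega>)) (\<lambda>\<omega>. (V x y \<omega>, H x y \<omega>))
        (hs_weight q s (u y) (\<theta> x)))"

definition hs_height ::
  "(nat \<Rightarrow> nat \<Rightarrow> 'a \<Rightarrow> nat) \<Rightarrow> (nat \<Rightarrow> nat \<Rightarrow> 'a \<Rightarrow> nat) \<Rightarrow> nat \<Rightarrow> nat \<Rightarrow> 'a \<Rightarrow> int" where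
  "hs_height V H x y \<omega> = int (card {k \<in> {1..y}. H x k \<omega> = 1}) - int (\<Sum>k=1..x. V k 0 \<omega>)"

definition q_poisson :: "'a measure \<Rightarrow> real \<Rightarrow> real \<Rightarrow> ('a \<Rightarrow> nat) \<Rightarrow> bool" where
  "q_poisson N q z X \<longleftrightarrow>
     X \<in> N \<rightarrow>\<^sub>M count_space UNIV \<and>
     (\<forall>k. measure N {\<omega> \<in> space N. X \<omega> = k} = z ^ k / qpoch q q (int k) * qpoch_inf q z)"

definition indep_of_model ::
  "'a measure \<Rightarrow> ('a \<Rightarrow> nat) \<Rightarrow> (nat \<Rightarrow> nat \<Rightarrow> 'a \<Rightarrow> nat) \<Rightarrow> (nat \<Rightarrow> nat \<Rightarrow> 'a \<Rightarrow> nat) \<Rightarrow> bool" where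
  "indep_of_model N X V H \<longleftrightarrow>
     prob_space.indep_set N (gen_by N {X})
       (gen_by N ({V x y | x y. 1 \<le> x} \<union> {H x y | x y. 1 \<le> y}))"

end

theory Submission
  imports Defs
begin

text \<open>Only the numbers of parts \<open>\<ell>(\<lambda>)\<close> matter. The weights on the right-hand side of the Yang--Baxter
  equation conserve \<open>n\<^sub>h + j\<^sub>h = m\<^sub>h + j\<^sub>h\<^sub>-\<^sub>1\<close>, so almost surely \<open>j\<^sub>0 = \<ell>(\<nu>) - \<ell>(\<mu>)\<close> and
  \<open>j\<^sub>0' = \<ell>(\<nu>) - \<ell>(\<lambda>)\<close>, whatever the couplings are. Hence \<open>\<ell>\<close> is itself a Markov field whose transition
  probability is that of the initial choice \<open>(j\<^sub>0, j\<^sub>0')\<close>. At the corner this is the \<open>q\<close>-Poisson law, along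
  the axes it gives the stationary boundary conditions, and in the bulk it is the vertex weight at
  \<open>i\<^sub>1 = i\<^sub>0\<close>, \<open>j\<^sub>1 = 1 - i\<^sub>0'\<close>, \<open>i\<^sub>2 = j\<^sub>0'\<close>, \<open>j\<^sub>2 = 1 - j\<^sub>0\<close>.

  A coupling is prescribed only where both sides of the Yang--Baxter equation are positive. The data reached
  with positive probability are of this kind: all the specialized weights that occur are
  nonnegative, and a positive term on the left forces a positive term on the right. The
  weights are explicit; for the column weights of type sqW this is a \<open>q\<close>-Pfaff--Saalschuetz summation.\<close>

section \<open>\<open>q\<close>-products and the \<open>q\<close>-Pfaff--Saalschuetz sum\<close>

text \<open>An arbitrary coupling is known only through its marginals, so all that one step reveals
  is that the sampled triple lies in the support of the right-hand side. That support has to be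
  known exactly, and at the ends of the parameter range (\<open>u = 0\<close>,
  \<open>\<theta> = - s\<close>, \<open>s * \<theta> = - 1\<close>) it is smaller than path
  conservation allows. Positivity is passed on from step to step because the factor \<open>R\<close>
  on the right at step h is the factor \<open>R\<close> on the left at step h + 1.

  The weights stay explicit because the sg specializations occur only on the axes, where diagrams
  are empty: an index is then 0 and the series has one term. In sHL rows occupation numbers are at
  most 1, which leaves at most two terms. Only the sqW column weights require a genuine summation,
  and for them only sign and zeros matter.

  The two laws are compared along the enumeration of the quadrant by antidiagonals: in both models
  the probability of prescribed values at the first n cells is the same product of one-cell factors
  \<open>kern\<close>, and this determines all finite-dimensional distributions of the
  height.\<close>

definition qp :: "real \<Rightarrow> real \<Rightarrow> nat \<Rightarrow> real" where
  "qp q a n = (\<Prod>i<n. 1 - a * q ^ i)"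

lemma qp_0 [simp]: "qp q a 0 = 1"
  by (simp add: qp_def)

lemma qp_Suc: "qp q a (Suc n) = qp q a n * (1 - a * q ^ n)"
  by (simp add: qp_def)

lemma qp_1 [simp]: "qp q a (Suc 0) = 1 - a"
  by (simp add: qp_def)

lemma qp_zero_arg [simp]: "qp q 0 n = 1"
  by (simp add: qp_def)

lemma qp_add: "qp q a (m + n) = qp q a m * qp q (a * q ^ m) n"
  by (induction n) (simp_all add: qp_Suc power_add mult_ac)

lemma qp_Suc_left: "qp q a (Suc n) = (1 - a) * qp q (a * q) n"
  using qp_add[of q a 1 n] by simp

lemma qpoch_nat: "qpoch q a (int n) = qp q a n"
proof -
  have "(\<Prod>i = 1..n. 1 - a * q ^ (i - 1)) = (\<Prod>i<n. 1 - a * q ^ i)"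
    by (rule prod.reindex_bij_witness[of _ Suc "\<lambda>i. i - 1"]) auto
  then show ?thesis by (simp add: qpoch_def qp_def)
qed

lemma qpoch_neg: "qpoch q a (- int n) = inverse (\<Prod>i<n. 1 - a / q ^ Suc i)"
proof (cases "n = 0")
  case False
  have "(\<Prod>i = - int n..-1. inverse (1 - a * q powi i)) =
        (\<Prod>i<n. inverse (1 - a / q ^ Suc i))"
  proof (rule prod.reindex_bij_witness[of _ "\<lambda>i. - int (Suc i)" "\<lambda>i. nat (- i - 1)"])
    fix i assume i: "i \<in> {- int n..-1}"
    define m where "m = nat (- i - 1)"
    have im: "i = - int (Suc m)" using i by (auto simp: m_def)
    show "inverse (1 - a / q ^ Suc (nat (- i - 1))) = inverse (1 - a * q powi i)"
      unfolding im by (simp add: power_int_def field_simps power_inverse nat_add_distrib)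
  qed auto
  then show ?thesis using False by (simp add: qpoch_def prod_inversef[symmetric] o_def)
qed (simp add: qpoch_def)

lemma qp_pos: "0 < q \<Longrightarrow> q < 1 \<Longrightarrow> a < 1 \<Longrightarrow> 0 < qp q a n"
proof -
  assume q: "0 < q" "q < 1" "a < 1"
  have "a * q ^ i < 1" for i
  proof (cases "a \<le> 0")
    case True
    then have "a * q ^ i \<le> 0" using q by (simp add: mult_nonpos_nonneg)
    then show ?thesis by linarith
  next
    case False
    have "a * q ^ i \<le> a * 1" using q False by (intro mult_left_mono power_le_one) auto
    then show ?thesis using q by linarith
  qed
  then show ?thesis by (auto simp: qp_def intro!: prod_pos)
qed

lemma qp_one_arg: "qp q 1 n = (if n = 0 then 1 else 0)"
  by (cases n) (simp_all add: qp_Suc_left)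

lemma qp_nonneg: "0 < q \<Longrightarrow> q < 1 \<Longrightarrow> a \<le> 1 \<Longrightarrow> 0 \<le> qp q a n"
  using qp_pos[of q a n] by (cases "a = 1") (auto simp: qp_one_arg)

lemma qp_neq_0: "0 < q \<Longrightarrow> q < 1 \<Longrightarrow> a < 1 \<Longrightarrow> qp q a n \<noteq> 0"
  by (metis qp_pos less_irrefl)

lemma tendsto_qp [tendsto_intros]: "(f \<longlongrightarrow> a) F \<Longrightarrow> ((\<lambda>x. qp q (f x) n) \<longlongrightarrow> qp q a n) F"
  unfolding qp_def by (intro tendsto_intros)

text \<open>The power with exponent n(n-1)/2, kept as a product so that inductions need no
  arithmetic with \<open>div\<close>.\<close>

definition qt :: "real \<Rightarrow> nat \<Rightarrow> real" where
  "qt q n = (\<Prod>i<n. q ^ i)"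

lemma qt_0 [simp]: "qt q 0 = 1" by (simp add: qt_def)
lemma qt_Suc: "qt q (Suc n) = qt q n * q ^ n" by (simp add: qt_def)
lemma qt_pos: "0 < q \<Longrightarrow> 0 < qt q n" by (simp add: qt_def prod_pos)

lemma qt_eq: "q ^ (n * (n - 1) div 2) = qt q n"
proof (induction n)
  case (Suc n)
  have "Suc n * (Suc n - 1) div 2 = n * (n - 1) div 2 + n"
    by (cases n) auto
  with Suc show ?case by (simp add: qt_Suc power_add)
qed simp

lemma qt_eq': "q ^ (n * (n - 1 + 2 * j) div 2) = qt q n * q ^ (n * j)"
proof -
  have "n * (n - 1 + 2 * j) = n * (n - 1) + 2 * (n * j)"
    by (simp add: distrib_left)
  then have "n * (n - 1 + 2 * j) div 2 = n * (n - 1) div 2 + n * j"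
    by simp
  then show ?thesis by (simp only: qt_eq power_add)
qed

text \<open>The factor with index n is \<open>1 - q ^ n / q ^ n\<close>. This is what terminates the
  series.\<close>

lemma qp_inv_pow_eq_0: "0 < q \<Longrightarrow> n < k \<Longrightarrow> qp q (1 / q ^ n) k = 0"
  by (auto simp: qp_def intro!: bexI[of _ n])

text \<open>Reversal of the product for q^(-n) with n = k + r. Writing n this way keeps r fixed
  while k grows, since the step from k to k + 1 only prepends the factor for q^(-n-1).\<close>

lemma qp_inv_pow:
  assumes "0 < q"
  shows "qp q (1 / q ^ (k + r)) k * qp q q r * q ^ ((k + r) * k) = (- 1) ^ k * qt q k * qp q q (k + r)"
proof (induction k)
  case (Suc k)
  have "qp q (1 / q ^ (Suc k + r)) (Suc k) = (1 - 1 / q ^ Suc (k + r)) * qp q (1 / q ^ (k + r)) k"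
  proof -
    have "1 / q ^ (Suc k + r) * q = 1 / q ^ (k + r)" using assms by simp
    then show ?thesis by (simp only: qp_Suc_left) simp
  qed
  moreover have "(Suc k + r) * Suc k = Suc (k + r) + (k + (k + r) * k)" by simp
  then have "q ^ ((Suc k + r) * Suc k) = q ^ Suc (k + r) * (q ^ k * q ^ ((k + r) * k))"
    by (simp only: power_add)
  ultimately have "qp q (1 / q ^ (Suc k + r)) (Suc k) * qp q q r * q ^ ((Suc k + r) * Suc k)
     = (1 - 1 / q ^ Suc (k + r)) * q ^ Suc (k + r) * q ^ k * (qp q (1 / q ^ (k + r)) k * qp q q r * q ^ ((k + r) * k))"
    by (simp only: mult_ac)
  also have "(1 - 1 / q ^ Suc (k + r)) * q ^ Suc (k + r) = - (1 - q * q ^ (k + r))"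
    using assms by (simp add: field_simps)
  finally have *: "qp q (1 / q ^ (Suc k + r)) (Suc k) * qp q q r * q ^ ((Suc k + r) * Suc k)
     = - (1 - q * q ^ (k + r)) * q ^ k * ((- 1) ^ k * qt q k * qp q q (k + r))"
    unfolding Suc .
  show ?case
    by (rule trans[OF *], simp only: add_Suc qp_Suc qt_Suc power_Suc)
      (simp only: mult_ac mult_minus_left mult_minus_right mult_1_left)
qed simp

lemma qp_inv_pow':
  assumes "0 < q" "q < 1" "k \<le> n"
  shows "qp q (1 / q ^ n) k = (- 1) ^ k * qt q k * qp q q n / (qp q q (n - k) * q ^ (n * k))"
proof -
  have "qp q q (n - k) \<noteq> 0" "q ^ (n * k) \<noteq> 0" using assms by (auto simp: qp_neq_0)
  then show ?thesis using qp_inv_pow[OF assms(1), of k "n - k"] assms(3) by (simp add: field_simps)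
qed

text \<open>The product vanishes exactly when the factor \<open>1 - q ^ 0\<close> occurs in it.\<close>

lemma qpoch_shifted:
  assumes q: "0 < q" "q < 1" and j: "j \<le> n"
  shows "qpoch q (q ^ j * q powi (1 + int m - int n)) (int (n - j)) =
    (if n \<le> j + m then qp q q m / qp q q (j + m - n) else 0)"
proof (cases "n \<le> j + m")
  case True
  define e where "e = j + m - n"
  have "q ^ j * q powi (1 + int m - int n) = q powi (int j + (1 + int m - int n))"
    using q by (simp add: power_int_add)
  also have "int j + (1 + int m - int n) = int (Suc e)" using True by (simp add: e_def)
  finally have *: "q ^ j * q powi (1 + int m - int n) = q * q ^ e"
    by (simp add: power_int_def nat_add_distrib)
  have "qp q q (e + (n - j)) = qp q q e * qp q (q * q ^ e) (n - j)" by (rule qp_add)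
  moreover have "e + (n - j) = m" using True j by (simp add: e_def)
  ultimately have "qp q (q * q ^ e) (n - j) = qp q q m / qp q q e"
    using qp_neq_0[of q q e] q by (simp add: field_simps)
  then show ?thesis using True * by (simp add: qpoch_nat e_def)
next
  case False
  have "q ^ j * q powi (1 + int m - int n) * q ^ (n - 1 - m - j) =
      q powi (int j + (1 + int m - int n) + int (n - 1 - m - j))"
    using q by (simp add: power_int_add)
  also have "int j + (1 + int m - int n) + int (n - 1 - m - j) = 0" using False by simp
  finally have "q ^ j * q powi (1 + int m - int n) * q ^ (n - 1 - m - j) = 1" by simp
  moreover have "n - 1 - m - j \<in> {..<n - j}" using False j by auto
  ultimately have "qp q (q ^ j * q powi (1 + int m - int n)) (n - j) = 0"
    unfolding qp_def by (intro prod_zero bexI[of _ "n - 1 - m - j"]) auto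
  then show ?thesis using False by (simp only: qpoch_nat if_False)
qed

text \<open>The lower parameter \<open>q powi (1 + int m - int n)\<close> annihilates all terms with
  \<open>j < n - m\<close>. At most m + 1 terms remain: one for \<open>m = 0\<close> and at most two
  for \<open>m = 1\<close>, which makes the weights with small horizontal occupation
  elementary.\<close>

lemma phi43_eq:
  assumes q: "0 < q" "q < 1"
  shows "phi43 q n (q powi (- int i), a2, a3) (b1, q powi (1 + int m - int n), b3) z =
    (\<Sum>j\<in>{n - m..n}. z ^ j * qp q (1 / q ^ n) j / qp q q j * qp q (1 / q ^ i) j * qp q (q ^ j * b1) (n - j)
       * qp q a2 j * (qp q q m / qp q q (j + m - n)) * qp q a3 j * qp q (q ^ j * b3) (n - j))"
proof -
  have pw: "q powi (- int k) = 1 / q ^ k" for k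
    using q by (simp add: power_int_minus field_simps)
  have restrict: "(\<Sum>j\<in>{0..n}. if n \<le> j + m then F j else 0) = (\<Sum>j\<in>{n - m..n}. F j)" for F :: "nat \<Rightarrow> real"
    by (rule sum.mono_neutral_cong_right) auto
  have "phi43 q n (q powi (- int i), a2, a3) (b1, q powi (1 + int m - int n), b3) z =
    (\<Sum>j\<in>{0..n}. if n \<le> j + m then z ^ j * qp q (1 / q ^ n) j / qp q q j * qp q (1 / q ^ i) j * qp q (q ^ j * b1) (n - j)
       * qp q a2 j * (qp q q m / qp q q (j + m - n)) * qp q a3 j * qp q (q ^ j * b3) (n - j) else 0)"
    unfolding phi43_def prod.case
  proof (rule sum.cong)
    fix j assume "j \<in> {0..n}"
    then have j: "j \<le> n" by simp
    show "z ^ j * (qpoch q (q powi (- int n)) (int j) / qpoch q q (int j)) *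
        (qpoch q (q powi (- int i)) (int j) * qpoch q (q ^ j * b1) (int (n - j))) *
        (qpoch q a2 (int j) * qpoch q (q ^ j * q powi (1 + int m - int n)) (int (n - j))) *
        (qpoch q a3 (int j) * qpoch q (q ^ j * b3) (int (n - j))) =
      (if n \<le> j + m then z ^ j * qp q (1 / q ^ n) j / qp q q j * qp q (1 / q ^ i) j * qp q (q ^ j * b1) (n - j)
       * qp q a2 j * (qp q q m / qp q q (j + m - n)) * qp q a3 j * qp q (q ^ j * b3) (n - j) else 0)"
    proof -
      have gen: "z' * (a / b) * (c * d) * (e * X) * (f * g) = z' * a / b * c * d * e * X * f * g"
        for z' a b c d e X f g :: real by simp
      show ?thesis
        unfolding qpoch_shifted[OF q j] unfolding qpoch_nat pw gen
        by (cases "n \<le> j + m") (simp_all only: if_True if_False mult_zero_left mult_zero_right)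
    qed
  qed simp
  also have "\<dots> = (\<Sum>j\<in>{n - m..n}. z ^ j * qp q (1 / q ^ n) j / qp q q j * qp q (1 / q ^ i) j * qp q (q ^ j * b1) (n - j)
       * qp q a2 j * (qp q q m / qp q q (j + m - n)) * qp q a3 j * qp q (q ^ j * b3) (n - j))"
    by (rule restrict)
  finally show ?thesis .
qed

text \<open>Each factor obeys (1 - q^(i+1)/a) a = - q^(i+1) (1 - a/q^(i+1)). With a = u/s it relates
  the parameter \<open>q * s / u\<close> of the series to the product of negative index in the
  prefactor of \<open>w_gen\<close>.\<close>

lemma prod_reflect:
  assumes "0 < q" "a \<noteq> 0"
  shows "qp q (q / a) n * a ^ n = (- 1) ^ n * qt q n * q ^ n * (\<Prod>i<n. 1 - a / q ^ Suc i)"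
proof (induction n)
  case (Suc n)
  have "(1 - q / a * q ^ n) * a = - (q ^ Suc n) * (1 - a / q ^ Suc n)"
    using assms by (simp add: field_simps)
  have "qp q (q / a) (Suc n) * a ^ Suc n = qp q (q / a) n * a ^ n * ((1 - q / a * q ^ n) * a)"
    by (simp add: qp_Suc)
  also have "\<dots> = (- 1) ^ Suc n * qt q (Suc n) * q ^ Suc n * (\<Prod>i<Suc n. 1 - a / q ^ Suc i)"
    unfolding Suc \<open>(1 - q / a * q ^ n) * a = _\<close> by (simp add: qt_Suc)
  finally show ?case .
qed simp

text \<open>Turns the negative-index product in the denominator of \<open>R_gen\<close> into an
  ordinary one in the numerator; it is applied with X z in place of z.\<close>

lemma qpoch_neg_reflect:
  assumes "0 < q" "z \<noteq> 0"
  shows "inverse (qpoch q (q / z) (- int n)) * z ^ n * qt q n = (- 1) ^ n * qp q z n"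
proof (induction n)
  case (Suc n)
  have "(1 - (q / z) / q ^ Suc n) * z * q ^ n = - (1 - z * q ^ n)"
    using assms by (simp add: field_simps)
  moreover have "inverse (qpoch q (q / z) (- int (Suc n))) = inverse (qpoch q (q / z) (- int n)) * (1 - (q / z) / q ^ Suc n)"
    unfolding qpoch_neg by simp
  ultimately have "inverse (qpoch q (q / z) (- int (Suc n))) * z ^ Suc n * qt q (Suc n) =
     (inverse (qpoch q (q / z) (- int n)) * z ^ n * qt q n) * - (1 - z * q ^ n)"
    by (simp add: qt_Suc mult_ac)
  then show ?case unfolding Suc by (simp add: qp_Suc algebra_simps)
qed (simp add: qpoch_def)

section \<open>Infinite products and their continuity\<close>

lemma abs_convergent_qinf:
  assumes "0 < q" "q < 1"
  shows "convergent_prod (\<lambda>i. 1 - a * q ^ i :: real)"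
proof (rule abs_convergent_prod_imp_convergent_prod, subst abs_convergent_prod_conv_summable)
  have "summable (\<lambda>i. \<bar>a\<bar> * q ^ i)" using assms by (intro summable_mult summable_geometric) auto
  then show "summable (\<lambda>i. norm (1 - a * q ^ i - 1))" using assms by (simp add: abs_mult)
qed

lemma qpoch_inf_0 [simp]: "qpoch_inf q 0 = 1"
  by (simp add: qpoch_inf_def)

lemma qpoch_inf_pos:
  assumes "0 < q" "q < 1" "a < 1"
  shows "0 < qpoch_inf q a"
  unfolding qpoch_inf_def
proof (rule has_prod_pos)
  show "(\<lambda>i. 1 - a * q ^ i) has_prod (\<Prod>i. 1 - a * q ^ i)"
    using abs_convergent_qinf[OF assms(1,2)] by (rule convergent_prod_has_prod)
  show "0 < 1 - a * q ^ n" for n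
    using qp_pos[OF assms, of "Suc n"] qp_pos[OF assms, of n] by (simp add: qp_Suc zero_less_mult_iff)
qed

lemma qpoch_inf_Suc:
  assumes "0 < q" "q < 1" "a < 1"
  shows "qpoch_inf q a = (1 - a) * qpoch_inf q (a * q)"
  using prodinf_split_head[OF abs_convergent_qinf[OF assms(1,2), of a]] assms(3)
  by (simp add: qpoch_inf_def field_simps)

text \<open>Lets the limit defining \<open>Pi_spec\<close> pass through the infinite products. On
  the compact interval of radius 1 around a the partial products converge uniformly, by the M-test
  with bounds (|a| + 1) q^n.\<close>

lemma isCont_qpoch_inf:
  assumes q: "0 < q" "q < 1"
  shows "isCont (qpoch_inf q) a"
proof -
  define S where "S = {a - 1..a + 1}"
  have bd: "\<bar>x\<bar> \<le> \<bar>a\<bar> + 1" if "x \<in> S" for x using that by (auto simp: S_def)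
  have "uniformly_convergent_on S (\<lambda>N x. \<Prod>n<N. 1 + - (x * q ^ n))"
  proof (rule uniformly_convergent_on_prod)
    show "compact S" by (simp add: S_def)
    show "continuous_on S (\<lambda>x. - (x * q ^ n))" for n by (intro continuous_intros)
    show "uniformly_convergent_on S (\<lambda>N x. \<Sum>n<N. norm (- (x * q ^ n)))"
    proof (rule Weierstrass_m_test')
      show "norm (norm (- (x * q ^ n))) \<le> (\<bar>a\<bar> + 1) * q ^ n" if "x \<in> S" for n x
        using bd[OF that] q by (auto simp: abs_mult intro!: mult_right_mono)
      show "summable (\<lambda>n. (\<bar>a\<bar> + 1) * q ^ n)" using q by (intro summable_mult summable_geometric) auto
    qed
  qed
  then obtain l where l: "uniform_limit S (\<lambda>N x. \<Prod>n<N. 1 + - (x * q ^ n)) l sequentially"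
    by (auto simp: uniformly_convergent_on_def)
  have eq: "qpoch_inf q x = l x" if "x \<in> S" for x
  proof -
    have "(\<lambda>N. \<Prod>n<N. 1 + - (x * q ^ n)) \<longlonglongrightarrow> l x" using tendsto_uniform_limitI[OF l that] .
    moreover have "(\<lambda>N. \<Prod>n\<le>N. 1 - x * q ^ n) \<longlonglongrightarrow> qpoch_inf q x"
      unfolding qpoch_inf_def by (rule convergent_prod_LIMSEQ[OF abs_convergent_qinf[OF q]])
    then have "(\<lambda>N. \<Prod>n<N. 1 + - (x * q ^ n)) \<longlonglongrightarrow> qpoch_inf q x"
      by (simp add: LIMSEQ_lessThan_iff_atMost)
    ultimately show ?thesis using LIMSEQ_unique by blast
  qed
  have "continuous_on S l"
    by (rule uniform_limit_theorem[OF always_eventually l]) (auto intro!: continuous_intros)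
  then have "continuous_on S (qpoch_inf q)" using eq by (simp cong: continuous_on_cong)
  then have "continuous_on {a - 1<..<a + 1} (qpoch_inf q)"
    by (rule continuous_on_subset) (auto simp: S_def)
  then show ?thesis by (simp add: continuous_on_eq_continuous_at)
qed

lemmas tendsto_qpoch_inf = isCont_tendsto_compose[OF isCont_qpoch_inf]

text \<open>The \<open>q\<close>-Pfaff--Saalschuetz sum is stated without denominators, so that it also covers the values of
  \<open>\<theta>\<close> at which a factor vanishes. It telescopes:
  \<open>t (N + 1) r = P N * t N r + H r - H (r - 1)\<close> with
  \<open>H r = q ^ (N - r) * (1 - A * q ^ r) * (1 - B * q ^ r) * t N r\<close>.\<close>

definition saal_term :: "real \<Rightarrow> real \<Rightarrow> real \<Rightarrow> real \<Rightarrow> real \<Rightarrow> nat \<Rightarrow> nat \<Rightarrow> real" where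
  "saal_term q A B C E N r = qp q q N / (qp q q r * qp q q (N - r)) * (- 1) ^ r * qp q A r * qp q B r *
     qp q (C * q ^ r) (N - r) * (\<Prod>i<N - r. q ^ i - E)"

text \<open>The difference of the two sides is a multiple of \<open>E * C - A * B\<close>, so the
  balance condition is exactly what makes it vanish. Here x and y stand for q^r and q^(N-r-1), and K
  is the factor common to all terms of the telescoping relation.\<close>

lemma saal_poly:
  fixes q x y A B C E K :: real
  assumes AB: "E * C = A * B"
  shows "- K * (1 - q * (q * x * y)) * (1 - C * (q * x * y)) * (y - E) =
     ((A + B) * (q * x * y) - E - C * (q * x * y)\<^sup>2) * (- K * (1 - q * y))
     + y * (1 - A * q * x) * (1 - B * q * x) * (- K * (1 - q * y))
     - q * y * (K * (1 - q * x) * (1 - C * x) * (y - E))"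
proof -
  have "- (1 - q * (q * x * y)) * (1 - C * (q * x * y)) * (y - E)
      - (- ((A + B) * (q * x * y) - E - C * (q * x * y)\<^sup>2) * (1 - q * y)
     - y * (1 - A * q * x) * (1 - B * q * x) * (1 - q * y) - q * y * (1 - q * x) * (1 - C * x) * (y - E))
    = (E * C - A * B) * (- (q * q * x * x * y) * (1 - q * y))"
    by (simp add: algebra_simps power2_eq_square)
  then have eq: "- (1 - q * (q * x * y)) * (1 - C * (q * x * y)) * (y - E) =
     - ((A + B) * (q * x * y) - E - C * (q * x * y)\<^sup>2) * (1 - q * y)
     - y * (1 - A * q * x) * (1 - B * q * x) * (1 - q * y) - q * y * (1 - q * x) * (1 - C * x) * (y - E)"
    using AB by simp
  have gen: "- K * (- P1) * P2 * P3 = P4 * (- K * P5) + y * P6 * P7 * (- K * P5) - q * y * (K * P8 * P9 * P3)"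
    if "P1 * P2 * P3 = - P4 * P5 - y * P6 * P7 * P5 - q * y * P8 * P9 * P3" for P1 P2 P3 P4 P5 P6 P7 P8 P9
    using arg_cong[OF that, of "\<lambda>t. K * t"] by (simp add: algebra_simps)
  show ?thesis using gen[OF eq] by simp
qed

text \<open>The telescoping relation at the inner indices 1, ..., N. After the common factor K is
  taken out it becomes the polynomial identity \<open>saal_poly\<close>.\<close>

lemma saal_step:
  assumes q: "0 < q" "q < 1" and AB: "E * C = A * B" and r: "Suc r \<le> N"
  defines "H \<equiv> \<lambda>r. q ^ (N - r) * (1 - A * q ^ r) * (1 - B * q ^ r) * saal_term q A B C E N r"
  shows "saal_term q A B C E (Suc N) (Suc r) =
     ((A + B) * q ^ N - E - C * q ^ (2 * N)) * saal_term q A B C E N (Suc r) + H (Suc r) - H r"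
proof -
  obtain m where N: "N = Suc (r + m)" using r less_iff_Suc_add[of r N] by auto
  define x y where "x = q ^ r" and "y = q ^ m"
  have qN: "q ^ N = q * x * y" by (simp add: N x_def y_def power_add)
  define F where "F = qp q q N / (qp q q (Suc r) * qp q q (Suc m))"
  define D where "D = (- 1) ^ r * (\<Prod>i<m. q ^ i - E) * qp q (C * q ^ Suc r) m"
  define K where "K = F * D * (qp q A (Suc r) * qp q B (Suc r))"
  have nz: "qp q q (Suc m) \<noteq> 0" "qp q q m \<noteq> 0" "qp q q r \<noteq> 0" "qp q q (Suc r) \<noteq> 0"
    using qp_neq_0[OF q q(2)] by simp_all
  have nz': "1 - q * q ^ m \<noteq> 0" "1 - q * q ^ r \<noteq> 0"
    using nz by (simp_all add: qp_Suc)
  have a: "saal_term q A B C E (Suc N) (Suc r) = - K * (1 - q * q ^ N) * (1 - C * q ^ N) * (y - E)"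
  proof -
    have "qp q q (Suc N) / (qp q q (Suc r) * qp q q (Suc m)) = F * (1 - q * q ^ N)"
      by (simp add: F_def qp_Suc[of q q N])
    moreover have "Suc N - Suc r = Suc m" by (simp add: N)
    moreover have "qp q (C * q ^ Suc r) (Suc m) = qp q (C * q ^ Suc r) m * (1 - C * q ^ N)"
      by (simp add: qp_Suc N power_add mult_ac)
    ultimately show ?thesis unfolding saal_term_def K_def D_def
      by (simp only: prod.lessThan_Suc power_Suc y_def) (simp only: mult_ac mult_minus_left mult_minus_right mult_1_left)
  qed
  have b: "saal_term q A B C E N (Suc r) = - K * (1 - q * y)"
  proof -
    have "qp q q N / (qp q q (Suc r) * qp q q m) = F * (1 - q * y)"
      using nz nz' by (simp add: F_def y_def qp_Suc[of q q m])
    moreover have "N - Suc r = m" by (simp add: N)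
    ultimately show ?thesis unfolding saal_term_def K_def D_def
      by (simp only: prod.lessThan_Suc power_Suc) (simp only: mult_ac mult_minus_left mult_minus_right mult_1_left)
  qed
  have "(1 - A * q ^ r) * (1 - B * q ^ r) * saal_term q A B C E N r =
      K * (1 - q * x) * (1 - C * x) * (y - E)"
  proof -
    have "qp q q N / (qp q q r * qp q q (Suc m)) = F * (1 - q * x)"
      using nz nz' by (simp add: F_def x_def qp_Suc[of q q r])
    moreover have "N - r = Suc m" by (simp add: N)
    moreover have "qp q (C * q ^ r) (Suc m) = (1 - C * q ^ r) * qp q (C * q ^ Suc r) m"
      by (simp add: qp_Suc_left mult_ac)
    ultimately show ?thesis unfolding saal_term_def K_def D_def
      by (simp only: prod.lessThan_Suc y_def x_def qp_Suc[of q A r] qp_Suc[of q B r]) (simp only: mult_ac)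
  qed
  then have c: "H r = q * y * (K * (1 - q * x) * (1 - C * x) * (y - E))"
    by (simp add: H_def N y_def mult.assoc)
  have d: "H (Suc r) = y * (1 - A * q * x) * (1 - B * q * x) * (- K * (1 - q * y))"
  proof -
    have "N - Suc r = m" by (simp add: N)
    then show ?thesis unfolding H_def b by (simp only: y_def x_def power_Suc mult.assoc)
  qed
  have pw: "q ^ (2 * N) = (q * x * y)^2" by (simp only: mult.commute[of 2 N] power_mult qN)
  show ?thesis unfolding a b c d pw qN by (rule saal_poly[OF AB])
qed

text \<open>Telescoping gives the sum a first-order recursion in N with multiplier
  \<open>?P\<close>, and the right-hand side is the product of these multipliers.\<close>

lemma q_saalschuetz:
  assumes q: "0 < q" "q < 1" and AB: "E * C = A * B"
  shows "(\<Sum>r\<le>N. saal_term q A B C E N r) = (\<Prod>i<N. (A + B) * q ^ i - E - C * q ^ (2 * i))"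
proof (induction N)
  case 0
  then show ?case by (simp add: saal_term_def)
next
  case (Suc N)
  let ?t = "saal_term q A B C E"
  let ?P = "(A + B) * q ^ N - E - C * q ^ (2 * N)"
  define H where "H = (\<lambda>r. q ^ (N - r) * (1 - A * q ^ r) * (1 - B * q ^ r) * ?t N r)"
  have nz: "qp q q n \<noteq> 0" for n using q by (simp add: qp_neq_0)
  \<comment> \<open>Lower end of the telescoping: there is no preceding H, and the balance condition
    is used once more.\<close>
  have t0: "?t (Suc N) 0 = ?P * ?t N 0 + H 0"
  proof -
    have *: "?t n 0 = qp q C n * (\<Prod>i<n. q ^ i - E)" for n using nz by (simp add: saal_term_def)
    have "(1 - C * q ^ N) * (q ^ N - E) = ?P + q ^ N * (1 - A) * (1 - B)"
    proof -
      define Q where "Q = q ^ N"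
      have "(1 - C * Q) * (Q - E) = ((A + B) * Q - E - C * Q^2) + Q * (1 - A) * (1 - B)"
        using AB by algebra
      then show ?thesis by (simp add: Q_def power_mult mult.commute[of 2])
    qed
    then have "?t (Suc N) 0 = (?P + q ^ N * (1 - A) * (1 - B)) * ?t N 0" by (simp add: * qp_Suc)
    then show ?thesis by (simp add: H_def distrib_right)
  qed
  \<comment> \<open>Upper end r = N + 1: this term cancels the \<open>H N\<close> left over by the
    partial sums up to N.\<close>
  have tN: "?t (Suc N) (Suc N) = - H N"
    using nz nz[of "Suc N"] by (simp add: saal_term_def H_def qp_Suc)
  have "(\<Sum>r\<le>M. ?t (Suc N) r) = ?P * (\<Sum>r\<le>M. ?t N r) + H M" if "M \<le> N" for M
    using that
  proof (induction M)
    case 0 then show ?case using t0 by simp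
  next
    case (Suc M)
    then show ?case using saal_step[OF q AB, of M N] unfolding H_def by (simp add: algebra_simps)
  qed
  from this[of N] have "(\<Sum>r\<le>Suc N. ?t (Suc N) r) = ?P * (\<Sum>r\<le>N. ?t N r)" using tN by simp
  then show ?case using Suc by simp
qed

lemma qt_sq: "qt q n * qt q n * q ^ n = q ^ (n * n)"
  by (induction n) (simp_all add: qt_Suc power_add mult_ac)

lemma qt_add: "qt q (m + r) = qt q m * qt q r * q ^ (m * r)"
  by (induction r) (simp_all add: qt_Suc power_add mult_ac)

section \<open>Specialized weights\<close>

lemma phi43_0 [simp]: "phi43 q 0 a b z = 1"
  by (simp add: phi43_def qpoch_def split: prod.split)

lemma eventually_at_neq: "\<forall>\<^sub>F x in at (a::real). x \<noteq> c"
proof (cases "c = a")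
  case True
  then show ?thesis by (simp add: eventually_at_filter)
next
  case False
  then show ?thesis using tendsto_imp_eventually_ne[OF tendsto_ident_at[of a UNIV], of c] by auto
qed

lemma eventually_fst_prod: "eventually P F \<Longrightarrow> \<forall>\<^sub>F x in F \<times>\<^sub>F G. P (fst x)"
  using filterlim_fst[of F G] by (simp add: filterlim_iff)

lemma eventually_snd_prod: "eventually P G \<Longrightarrow> \<forall>\<^sub>F x in F \<times>\<^sub>F G. P (snd x)"
  using filterlim_snd[of G F] by (simp add: filterlim_iff)

text \<open>Along the sg filter the parameter X diverges while u and u X converge. The evaluated
  forms of \<open>R_gen\<close> and \<open>Pi_gen\<close> contain the parameters only through u, u
  X, v and v Y, so these four limits are recorded instead of those of X and Y.\<close>

fun row_u :: "row_spec \<Rightarrow> real" where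
  "row_u (sHL u) = u"
| "row_u (sg_row \<alpha>) = 0"

fun row_uX :: "real \<Rightarrow> row_spec \<Rightarrow> real" where
  "row_uX q (sHL u) = u * q"
| "row_uX q (sg_row \<alpha>) = - \<alpha>"

fun col_v :: "real \<Rightarrow> col_spec \<Rightarrow> real" where
  "col_v s (sqW \<theta>) = s"
| "col_v s (sg_col \<beta>) = 0"

fun col_vY :: "col_spec \<Rightarrow> real" where
  "col_vY (sqW \<theta>) = - \<theta>"
| "col_vY (sg_col \<beta>) = - \<beta>"

lemma sg_filter_neq_bot: "sg_filter \<alpha> \<noteq> bot"
  by (simp add: sg_filter_def filtermap_bot_iff prod_filter_eq_bot)

text \<open>The product of the two coordinates is -a, and a tends to \<alpha> through a punctured
  neighbourhood. It therefore avoids any prescribed value c, even \<open>c = - \<alpha>\<close>;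
  this is how removable singularities are bypassed.\<close>

lemma sg_filter_eventually:
  "\<forall>\<^sub>F p in sg_filter \<alpha>. fst p \<noteq> 0 \<and> snd p \<noteq> 0 \<and> fst p * snd p \<noteq> c"
proof -
  have 1: "\<forall>\<^sub>F x in at 0 \<times>\<^sub>F at \<alpha>. fst x \<noteq> (0::real)"
    by (rule eventually_fst_prod[OF eventually_at_neq])
  have 2: "\<forall>\<^sub>F x in at 0 \<times>\<^sub>F at \<alpha>. snd x \<noteq> (0::real)" for \<alpha>
    by (rule eventually_snd_prod[OF eventually_at_neq])
  have 3: "\<forall>\<^sub>F x in at (0::real) \<times>\<^sub>F at \<alpha>. snd x \<noteq> - c"
    by (rule eventually_snd_prod[OF eventually_at_neq])
  show ?thesis unfolding sg_filter_def eventually_filtermap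
    using 1 2 3 by eventually_elim auto
qed

lemma sg_filter_lim:
  "(fst \<longlongrightarrow> 0) (sg_filter \<alpha>)" "((\<lambda>p. fst p * snd p) \<longlongrightarrow> - \<alpha>) (sg_filter \<alpha>)"
  "((\<lambda>p. inverse (snd p)) \<longlongrightarrow> 0) (sg_filter \<alpha>)"
proof -
  have e: "(fst \<longlongrightarrow> (0::real)) (at 0 \<times>\<^sub>F at \<alpha>)" and a: "(snd \<longlongrightarrow> \<alpha>) (at (0::real) \<times>\<^sub>F at \<alpha>)"
    using filterlim_fst[of "at (0::real)" "at \<alpha>"] filterlim_snd[of "at \<alpha>" "at (0::real)"]
    by (auto simp: filterlim_at)
  have ne: "\<forall>\<^sub>F x in at 0 \<times>\<^sub>F at \<alpha>. fst x \<noteq> (0::real)"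
    by (rule eventually_fst_prod[OF eventually_at_neq])
  have "((\<lambda>x. - fst x * snd x) \<longlongrightarrow> - 0 * \<alpha>) (at (0::real) \<times>\<^sub>F at \<alpha>)"
    by (intro tendsto_intros e a)
  then show "(fst \<longlongrightarrow> 0) (sg_filter \<alpha>)"
    by (simp add: sg_filter_def filterlim_filtermap case_prod_beta)
  have "((\<lambda>x. - snd x) \<longlongrightarrow> - \<alpha>) (at (0::real) \<times>\<^sub>F at \<alpha>)"
    by (intro tendsto_intros a)
  then have "((\<lambda>x. - fst x * snd x * (1 / fst x)) \<longlongrightarrow> - \<alpha>) (at (0::real) \<times>\<^sub>F at \<alpha>)"
    by (rule Lim_transform_eventually) (use ne in eventually_elim, simp)
  then show "((\<lambda>p. fst p * snd p) \<longlongrightarrow> - \<alpha>) (sg_filter \<alpha>)"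
    by (simp add: sg_filter_def filterlim_filtermap case_prod_beta)
  show "((\<lambda>p. inverse (snd p)) \<longlongrightarrow> 0) (sg_filter \<alpha>)"
    using e by (simp add: sg_filter_def filterlim_filtermap case_prod_beta)
qed

locale higher_spin =
  fixes q s :: real
  assumes q0: "0 < q" and q1: "q < 1" and s1: "-1 < s" and s0: "s < 0"
begin

lemmas q01 = q0 q1

lemma qq_pos [simp]: "0 < qp q q n" "qp q q n \<noteq> 0"
  using qp_pos[OF q0 q1 q1, of n] by auto

lemma qt_neq_0 [simp]: "qt q n \<noteq> 0" "0 < qt q n"
  using qt_pos[OF q0, of n] by auto

lemma q_neq_0 [simp]: "q \<noteq> 0" "0 < q ^ n"
  using q0 by auto

lemma s_sq: "s\<^sup>2 < 1" "0 < s\<^sup>2"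
  using s1 s0 by (auto simp: abs_square_less_1)

fun good_row :: "row_spec \<Rightarrow> bool" where
  "good_row (sHL u) \<longleftrightarrow> 0 \<le> u \<and> u < 1"
| "good_row (sg_row \<alpha>) \<longleftrightarrow> True"

fun good_col :: "col_spec \<Rightarrow> bool" where
  "good_col (sqW \<theta>) \<longleftrightarrow> - s \<le> \<theta> \<and> \<theta> \<le> - inverse s"
| "good_col (sg_col \<beta>) \<longleftrightarrow> True"

lemma row_filter_neq_bot: "row_filter q \<rho> \<noteq> bot"
  by (cases \<rho>) (simp_all add: sg_filter_neq_bot filtermap_bot_iff)

lemma col_filter_neq_bot: "col_filter s \<rho>' \<noteq> bot"
  by (cases \<rho>') (simp_all add: sg_filter_neq_bot principal_eq_bot_iff)

lemma prod_neq_bot: "row_filter q \<rho> \<times>\<^sub>F col_filter s \<rho>' \<noteq> bot"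
  by (simp add: prod_filter_eq_bot row_filter_neq_bot col_filter_neq_bot)

lemma row_lim:
  "(fst \<longlongrightarrow> row_u \<rho>) (row_filter q \<rho>)"
  "((\<lambda>p. fst p * snd p) \<longlongrightarrow> row_uX q \<rho>) (row_filter q \<rho>)"
  "\<forall>\<^sub>F p in row_filter q \<rho>. fst p \<noteq> 0 \<and> snd p \<noteq> 0"
proof -
  have "((\<lambda>u'. u' * q) \<longlongrightarrow> u * q) (at u)" for u by (intro tendsto_intros)
  then show "(fst \<longlongrightarrow> row_u \<rho>) (row_filter q \<rho>)"
    "((\<lambda>p. fst p * snd p) \<longlongrightarrow> row_uX q \<rho>) (row_filter q \<rho>)"
    using sg_filter_lim by (cases \<rho>; simp add: filterlim_filtermap)+
  show "\<forall>\<^sub>F p in row_filter q \<rho>. fst p \<noteq> 0 \<and> snd p \<noteq> 0"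
  proof (cases \<rho>)
    case (sHL u)
    have "\<forall>\<^sub>F u' in at u. u' \<noteq> 0" by (rule eventually_at_neq)
    then show ?thesis using sHL q0 by (simp add: eventually_filtermap)
  next
    case (sg_row \<alpha>)
    have "\<forall>\<^sub>F p in sg_filter \<alpha>. fst p \<noteq> 0 \<and> snd p \<noteq> 0"
      by (rule eventually_mono[OF sg_filter_eventually[where c = 0]]) auto
    then show ?thesis by (simp add: sg_row)
  qed
qed

lemma col_lim:
  "(fst \<longlongrightarrow> col_v s \<rho>') (col_filter s \<rho>')"
  "((\<lambda>p. fst p * snd p) \<longlongrightarrow> col_vY \<rho>') (col_filter s \<rho>')"
  using sg_filter_lim s0
  by (cases \<rho>'; simp add: tendsto_def eventually_principal)+

lemma col_nz: "good_col \<rho>' \<Longrightarrow> \<forall>\<^sub>F p in col_filter s \<rho>'. fst p \<noteq> 0 \<and> snd p \<noteq> 0"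
proof (cases \<rho>')
  case (sg_col \<beta>)
  have "\<forall>\<^sub>F p in sg_filter \<beta>. fst p \<noteq> 0 \<and> snd p \<noteq> 0"
    by (rule eventually_mono[OF sg_filter_eventually[where c = 0]]) auto
  then show ?thesis by (simp add: sg_col)
qed (use s0 in \<open>auto simp: eventually_principal\<close>)

lemma prod_lim:
  fixes \<rho> \<rho>'
  defines "F \<equiv> row_filter q \<rho> \<times>\<^sub>F col_filter s \<rho>'"
  shows "((\<lambda>x. fst (fst x)) \<longlongrightarrow> row_u \<rho>) F" "((\<lambda>x. fst (fst x) * snd (fst x)) \<longlongrightarrow> row_uX q \<rho>) F"
    "((\<lambda>x. fst (snd x)) \<longlongrightarrow> col_v s \<rho>') F" "((\<lambda>x. fst (snd x) * snd (snd x)) \<longlongrightarrow> col_vY \<rho>') F"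
  unfolding F_def
  by (rule filterlim_compose[OF row_lim(1) filterlim_fst] filterlim_compose[OF row_lim(2) filterlim_fst]
    filterlim_compose[OF col_lim(1) filterlim_snd] filterlim_compose[OF col_lim(2) filterlim_snd])+

lemma prod_nz:
  assumes "good_col \<rho>'"
  shows "\<forall>\<^sub>F x in row_filter q \<rho> \<times>\<^sub>F col_filter s \<rho>'.
    fst (fst x) \<noteq> 0 \<and> snd (fst x) \<noteq> 0 \<and> fst (snd x) \<noteq> 0 \<and> snd (snd x) \<noteq> 0"
  using eventually_fst_prod[OF row_lim(3)] eventually_snd_prod[OF col_nz[OF assms]]
  by eventually_elim auto

lemma Pi_spec_eq:
  assumes "row_u \<rho> * col_v s \<rho>' < 1" "row_uX q \<rho> * col_vY \<rho>' < 1"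
  shows "Pi_spec q s \<rho> \<rho>' =
    qpoch_inf q (row_u \<rho> * col_vY \<rho>') * qpoch_inf q (row_uX q \<rho> * col_v s \<rho>') /
    (qpoch_inf q (row_u \<rho> * col_v s \<rho>') * qpoch_inf q (row_uX q \<rho> * col_vY \<rho>'))" (is "_ = ?L")
proof -
  let ?F = "row_filter q \<rho> \<times>\<^sub>F col_filter s \<rho>'"
  let ?u = "\<lambda>x :: (real \<times> real) \<times> (real \<times> real). fst (fst x)" and ?X = "\<lambda>x :: (real \<times> real) \<times> (real \<times> real). snd (fst x)"
  let ?v = "\<lambda>x :: (real \<times> real) \<times> (real \<times> real). fst (snd x)" and ?Y = "\<lambda>x :: (real \<times> real) \<times> (real \<times> real). snd (snd x)"
  have "((\<lambda>x. qpoch_inf q (?u x * (?v x * ?Y x)) * qpoch_inf q ((?u x * ?X x) * ?v x) /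
    (qpoch_inf q (?u x * ?v x) * qpoch_inf q ((?u x * ?X x) * (?v x * ?Y x)))) \<longlongrightarrow> ?L) ?F"
    using qpoch_inf_pos[OF q01 assms(1)] qpoch_inf_pos[OF q01 assms(2)]
    by (intro tendsto_divide tendsto_mult tendsto_qpoch_inf[OF q01] prod_lim) auto
  moreover have "(\<lambda>(uX, vY). Pi_gen q uX vY) = (\<lambda>x. qpoch_inf q (?u x * (?v x * ?Y x)) *
    qpoch_inf q ((?u x * ?X x) * ?v x) / (qpoch_inf q (?u x * ?v x) * qpoch_inf q ((?u x * ?X x) * (?v x * ?Y x))))"
    by (auto simp: Pi_gen_def fun_eq_iff mult_ac)
  ultimately have "((\<lambda>(uX, vY). Pi_gen q uX vY) \<longlongrightarrow> ?L) ?F"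
    by simp
  then show ?thesis unfolding Pi_spec_def by (rule tendsto_Lim[OF prod_neq_bot])
qed

lemma b_gen_eq: "b_gen q (u, X) k = (- (u * X)) ^ k * qp q (inverse X) k / qp q q k"
  by (simp add: b_gen_def qpoch_nat)

text \<open>For J = 1 the product starts at 1/q and vanishes from its second factor on, which
  confines sHL rows to occupation numbers 0 and 1.\<close>

lemma b_row_sHL: "b_row q (sHL u) k = (if k = 0 then 1 else if k = 1 then u else 0)"
proof -
  have "((\<lambda>u'. (- (u' * q)) ^ k * qp q (inverse q) k / qp q q k) \<longlongrightarrow> (- (u * q)) ^ k * qp q (inverse q) k / qp q q k) (at u)"
    by (intro tendsto_intros) simp
  then have "b_row q (sHL u) k = (- (u * q)) ^ k * qp q (inverse q) k / qp q q k"
    unfolding b_row_def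
    by (intro tendsto_Lim row_filter_neq_bot) (simp add: filterlim_filtermap b_gen_eq)
  moreover have "qp q (inverse q) k = 0" if "1 < k"
    using qp_inv_pow_eq_0[OF q0, of 1 k] that by (simp add: inverse_eq_divide)
  moreover have "k = 1 \<Longrightarrow> - (u * q) * (1 - inverse q) / (1 - q) = u"
    using q01 by (simp add: field_simps)
  ultimately show ?thesis by (cases "k = 0"; cases "k = 1") auto
qed

lemma sg_b_lim: "((\<lambda>p. b_gen q p k) \<longlongrightarrow> \<alpha> ^ k / qp q q k) (sg_filter \<alpha>)"
proof -
  have "((\<lambda>p. (- (fst p * snd p)) ^ k * qp q (inverse (snd p)) k / qp q q k)
      \<longlongrightarrow> (- (- \<alpha>)) ^ k * qp q 0 k / qp q q k) (sg_filter \<alpha>)"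
    by (intro tendsto_intros sg_filter_lim) simp
  then show ?thesis by (simp add: b_gen_eq split_beta cong: if_cong) (simp add: b_gen_eq[symmetric])
qed

lemma b_row_sg: "b_row q (sg_row \<alpha>) k = \<alpha> ^ k / qp q q k"
  unfolding b_row_def using sg_b_lim by (intro tendsto_Lim row_filter_neq_bot) simp

lemma b_col_sg: "b_col q s (sg_col \<beta>) k = \<beta> ^ k / qp q q k"
  unfolding b_col_def using sg_b_lim by (intro tendsto_Lim col_filter_neq_bot) simp

lemma b_col_sqW: "b_col q s (sqW \<theta>) k = \<theta> ^ k * qp q (- s / \<theta>) k / qp q q k"
proof -
  have "b_col q s (sqW \<theta>) k = b_gen q (s, - \<theta> / s) k"
    unfolding b_col_def by (intro tendsto_Lim col_filter_neq_bot) (simp add: tendsto_def eventually_principal)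
  then show ?thesis using s0 by (simp add: b_gen_eq)
qed

section \<open>Evaluation of the cross weights R\<close>

lemma R_gen_nonconserving: "i2 + j1 \<noteq> i1 + j2 \<Longrightarrow> R_gen q uX vY i1 j1 i2 j2 = 0"
  by (cases uX; cases vY) (simp add: R_gen_def Let_def)

lemma R_spec_nonconserving: "i2 + j1 \<noteq> i1 + j2 \<Longrightarrow> R_spec q s \<rho> \<rho>' i1 j1 i2 j2 = 0"
proof -
  assume "i2 + j1 \<noteq> i1 + j2"
  then have "(\<lambda>(uX, vY). R_gen q uX vY i1 j1 i2 j2) = (\<lambda>_. 0)"
    by (auto simp: R_gen_nonconserving)
  then show ?thesis unfolding R_spec_def by (simp add: tendsto_Lim prod_neq_bot)
qed

text \<open>With \<open>i2 = 0\<close> the series is 1 and only the reflected prefactor remains.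
  This covers all pairs with an sg column, and in the bulk the inputs without a part added by the
  row on the left.\<close>

lemma R_gen_0:
  assumes "u \<noteq> 0" "X \<noteq> 0" "v \<noteq> 0"
  shows "R_gen q (u, X) (v, Y) i1 (i1 + j2) 0 j2 =
    qp q (u * X * v) j2 * qp q q (i1 + j2) / (qp q (u * v) (i1 + j2) * qp q q j2)"
proof -
  let ?z = "u * v"
  have z: "X * ?z \<noteq> 0" using assms by simp
  have 1: "inverse (qpoch q (q / X / ?z) (- int j2)) * (X * ?z) ^ j2 * qt q j2 = (- 1) ^ j2 * qp q (X * ?z) j2"
    using qpoch_neg_reflect[OF q0 z, of j2] by (simp add: divide_divide_eq_left)
  have "R_gen q (u, X) (v, Y) i1 (i1 + j2) 0 j2 =
     (qt q j2 * (X * ?z) ^ j2 * inverse (qpoch q (q / X / ?z) (- int j2))) * (- 1) ^ j2 *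
      qp q q (i1 + j2) / (qp q ?z (i1 + j2) * qp q q j2)"
    unfolding R_gen_def prod.case Let_def
  proof -
    have "int i1 - int (i1 + j2) = - int j2" by simp
    then show "(if 0 + (i1 + j2) = i1 + j2
     then q ^ (i1 * 0 + j2 * (j2 - 1) div 2) * X ^ j2 * (- ?z) ^ j2 * qpoch q q (int (i1 + j2)) /
          (qpoch q ?z (int (i1 + j2 + 0)) * qpoch q q (int j2) * qpoch q q (int 0) * qpoch q (q / X / ?z) (int i1 - int (i1 + j2))) *
          phi43 q 0 (q powi - int i1, ?z * Y, q / X / ?z) (inverse X, q powi (1 + int j2 - int 0), q powi (1 - int i1 - int j2) * Y) q
     else 0) = (qt q j2 * (X * ?z) ^ j2 * inverse (qpoch q (q / X / ?z) (- int j2))) * (- 1) ^ j2 *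
      qp q q (i1 + j2) / (qp q ?z (i1 + j2) * qp q q j2)"
      by (simp only: qpoch_nat phi43_0 mult_0_right add_0_left add_0_right qt_eq power_mult_distrib power_minus[of ?z] simp_thms if_True qp_0)
        (simp only: divide_inverse inverse_mult_distrib mult_ac mult_1_left mult_1_right inverse_1)
  qed
  also have "qt q j2 * (X * ?z) ^ j2 * inverse (qpoch q (q / X / ?z) (- int j2)) = (- 1) ^ j2 * qp q (X * ?z) j2"
    using 1 by (simp add: mult_ac)
  finally show ?thesis by (simp add: mult_ac)
qed

lemma R_spec_0:
  assumes "good_col \<rho>'" "row_u \<rho> * col_v s \<rho>' < 1"
  shows "R_spec q s \<rho> \<rho>' i1 (i1 + j2) 0 j2 =
    qp q (row_uX q \<rho> * col_v s \<rho>') j2 * qp q q (i1 + j2) / (qp q (row_u \<rho> * col_v s \<rho>') (i1 + j2) * qp q q j2)"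
     (is "_ = ?L")
proof -
  let ?F = "row_filter q \<rho> \<times>\<^sub>F col_filter s \<rho>'"
  have "((\<lambda>x. qp q ((fst (fst x) * snd (fst x)) * fst (snd x)) j2 * qp q q (i1 + j2) /
     (qp q (fst (fst x) * fst (snd x)) (i1 + j2) * qp q q j2)) \<longlongrightarrow> ?L) ?F"
    using qp_pos[OF q01 assms(2)] by (intro tendsto_intros prod_lim) (auto simp: less_imp_neq[symmetric])
  then have "((\<lambda>(uX, vY). R_gen q uX vY i1 (i1 + j2) 0 j2) \<longlongrightarrow> ?L) ?F"
  proof (rule Lim_transform_eventually)
    show "\<forall>\<^sub>F x in ?F. qp q ((fst (fst x) * snd (fst x)) * fst (snd x)) j2 * qp q q (i1 + j2) /
       (qp q (fst (fst x) * fst (snd x)) (i1 + j2) * qp q q j2) = (case x of (uX, vY) \<Rightarrow> R_gen q uX vY i1 (i1 + j2) 0 j2)"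
      using prod_nz[OF assms(1)] by eventually_elim (auto simp: R_gen_0)
  qed
  then show ?thesis unfolding R_spec_def by (rule tendsto_Lim[OF prod_neq_bot])
qed

lemma qp_inv_diag: "q ^ n * qp q (1 / q ^ n) n / qp q q n = (- 1) ^ n / qt q n"
proof -
  have "qp q (1 / q ^ n) n * q ^ (n * n) = (- 1) ^ n * qt q n * qp q q n"
    using qp_inv_pow[OF q0, of n 0] by simp
  then have "q ^ n * qp q (1 / q ^ n) n * (qt q n * qt q n) = (- 1) ^ n * qt q n * qp q q n"
    by (simp add: qt_sq[symmetric] mult_ac)
  then have "q ^ n * qp q (1 / q ^ n) n * qt q n = (- 1) ^ n * qp q q n" by simp
  then show ?thesis by (simp add: field_simps)
qed

lemma qp_inv_shift:
  "qp q (1 / q ^ (n + r)) n = (- 1) ^ n * qp q q (n + r) / (qp q q r * (qt q n * q ^ n) * q ^ (r * n))"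
proof -
  have "qp q (1 / q ^ (n + r)) n * qp q q r * (q ^ (n * n) * q ^ (r * n)) = (- 1) ^ n * qt q n * qp q q (n + r)"
    using qp_inv_pow[OF q0, of n r] by (simp add: distrib_right power_add)
  then have "qp q (1 / q ^ (n + r)) n * qp q q r * (qt q n * q ^ n * q ^ (r * n)) = (- 1) ^ n * qp q q (n + r)"
    unfolding qt_sq[symmetric] by (simp add: mult_ac)
  then show ?thesis by (simp add: nonzero_eq_divide_eq mult_ac)
qed

text \<open>With \<open>j2 = 0\<close> only the last term of the series survives. Its factor
  \<open>qp q (q / X / (u * v)) i2\<close> cancels against the denominator, and the hypothesis
  excludes the form 0/0 there.\<close>

lemma R_gen_j2_0:
  assumes "qp q (q / X / (u * v)) i2 \<noteq> 0"
  shows "R_gen q (u, X) (v, Y) (i2 + j1) j1 i2 0 =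
    qp q q (i2 + j1) * qp q (u * v * Y) i2 / (qp q (u * v) (i2 + j1) * qp q q i2)"
proof -
  have phi: "phi43 q i2 (q powi - int (i2 + j1), u * v * Y, q / X / (u * v)) (inverse X, q powi (1 + int 0 - int i2), b) q =
     q ^ i2 * qp q (1 / q ^ i2) i2 / qp q q i2 * qp q (1 / q ^ (i2 + j1)) i2 * qp q (u * v * Y) i2 * qp q (q / X / (u * v)) i2" for b
    by (subst phi43_eq[OF q01]) simp
  have "R_gen q (u, X) (v, Y) (i2 + j1) j1 i2 0 =
     q ^ ((i2 + j1) * i2) * qp q q j1 / (qp q (u * v) (j1 + i2) * qp q q i2 * qp q (q / X / (u * v)) i2) *
     (q ^ i2 * qp q (1 / q ^ i2) i2 / qp q q i2 * qp q (1 / q ^ (i2 + j1)) i2 * qp q (u * v * Y) i2 * qp q (q / X / (u * v)) i2)"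
  proof -
    have "int (i2 + j1) - int j1 = int i2" by simp
    then show ?thesis unfolding R_gen_def prod.case Let_def phi
      by (simp only: qpoch_nat) simp
  qed
  also have "\<dots> = qp q q (i2 + j1) * qp q (u * v * Y) i2 / (qp q (u * v) (i2 + j1) * qp q q i2)"
    unfolding qp_inv_diag qp_inv_shift using assms
    by (simp add: field_simps power_add qt_sq[symmetric])
  finally show ?thesis .
qed

lemma R_spec_j2_0:
  assumes "good_col (sqW \<theta>)"
  shows "R_spec q s (sg_row \<alpha>) (sqW \<theta>) (i2 + j1) j1 i2 0 = qp q q (i2 + j1) / qp q q i2"
proof -
  let ?F = "row_filter q (sg_row \<alpha>) \<times>\<^sub>F col_filter s (sqW \<theta>)"
  have "((\<lambda>x. qp q q (i2 + j1) * qp q (fst (fst x) * (fst (snd x) * snd (snd x))) i2 /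
     (qp q (fst (fst x) * fst (snd x)) (i2 + j1) * qp q q i2)) \<longlongrightarrow>
     qp q q (i2 + j1) * qp q (row_u (sg_row \<alpha>) * col_vY (sqW \<theta>)) i2 /
     (qp q (row_u (sg_row \<alpha>) * col_v s (sqW \<theta>)) (i2 + j1) * qp q q i2)) ?F"
    by (intro tendsto_intros prod_lim) auto
  then have "((\<lambda>(uX, vY). R_gen q uX vY (i2 + j1) j1 i2 0) \<longlongrightarrow> qp q q (i2 + j1) * qp q (row_u (sg_row \<alpha>) * col_vY (sqW \<theta>)) i2 /
     (qp q (row_u (sg_row \<alpha>) * col_v s (sqW \<theta>)) (i2 + j1) * qp q q i2)) ?F"
  proof (rule Lim_transform_eventually)
    \<comment> \<open>The excluded values of u X are the zeros of
      \<open>qp q (q / X / (u * v)) i2\<close> at v = s; they are finitely many.\<close>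
    have "\<forall>\<^sub>F p in sg_filter \<alpha>. \<forall>k\<in>{..<i2}. fst p * snd p \<noteq> q ^ Suc k / s"
      by (rule eventually_ball_finite) (auto intro: eventually_mono[OF sg_filter_eventually])
    then have "\<forall>\<^sub>F x in ?F. \<forall>k\<in>{..<i2}. fst (fst x) * snd (fst x) \<noteq> q ^ Suc k / s"
      by (intro eventually_fst_prod) simp
    moreover have "\<forall>\<^sub>F x in ?F. fst (snd x) = s"
      by (intro eventually_snd_prod) (simp add: eventually_principal)
    ultimately show "\<forall>\<^sub>F x in ?F. qp q q (i2 + j1) * qp q (fst (fst x) * (fst (snd x) * snd (snd x))) i2 /
     (qp q (fst (fst x) * fst (snd x)) (i2 + j1) * qp q q i2) = (case x of (uX, vY) \<Rightarrow> R_gen q uX vY (i2 + j1) j1 i2 0)"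
      using prod_nz[OF assms(1)]
    proof eventually_elim
      case (elim x)
      obtain u X v Y where x: "x = ((u, X), (v, Y))" by (metis surj_pair)
      have "1 - q / X / (u * v) * q ^ k \<noteq> 0" if "k < i2" for k
      proof
        assume "1 - q / X / (u * v) * q ^ k = 0"
        then have "u * X = q ^ Suc k / s" using elim s0 by (simp add: x field_simps)
        then show False using elim(1) that by (auto simp: x)
      qed
      then have "qp q (q / X / (u * v)) i2 \<noteq> 0"
        unfolding qp_def prod_zero_iff[OF finite_lessThan] by blast
      from R_gen_j2_0[OF this] show ?case by (simp add: x mult_ac)
    qed
  qed
  from tendsto_Lim[OF prod_neq_bot this] show ?thesis unfolding R_spec_def by simp
qed

text \<open>Since \<open>i1 = 0\<close>, the parameter q^(-i1) is 1 and kills the second term of the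
  series. What remains involves neither of the other two upper parameters.\<close>

lemma R_gen_01:
  assumes "u * v \<noteq> 0" "u * v < 1"
  shows "R_gen q (u, q) (v, Y) 0 j 1 (Suc j) = u * v * (q ^ j - Y) / (1 - u * v)"
proof -
  define z where "z = u * v"
  have z: "z \<noteq> 0" "z < 1" using assms by (auto simp: z_def)
  have phi: "phi43 q 1 (q powi - int 0, a, b) (inverse q, q powi (1 + int (Suc j) - int 1), q powi (1 - int 0 - int (Suc j)) * Y) q =
     (1 - 1 / q) * (1 - q * q ^ j) * (1 - Y / q ^ j)" for a b
    by (subst phi43_eq[OF q01]) (simp add: qp_Suc power_int_minus field_simps)
  have "q / q / z = q / (q * z)" by simp
  then have refl: "inverse (qpoch q (q / q / z) (- int j)) * (q * z) ^ j * qt q j = (- 1) ^ j * qp q (q * z) j"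
    using qpoch_neg_reflect[OF q0, of "q * z" j] z by simp
  have "int 0 - int j = - int j" by simp
  then have "R_gen q (u, q) (v, Y) 0 j 1 (Suc j) =
    qt q (Suc j) * q ^ Suc j * (- z) ^ Suc j * qp q q j * inverse (qpoch q (q / q / z) (- int j)) /
      (qp q z (Suc j) * qp q q (Suc j) * (1 - q)) * ((1 - 1 / q) * (1 - q * q ^ j) * (1 - Y / q ^ j))"
    unfolding R_gen_def prod.case Let_def phi z_def[symmetric]
    by (simp only: qpoch_nat qt_eq power_add) (simp add: divide_inverse mult_ac)
  also have "qt q (Suc j) * q ^ Suc j * (- z) ^ Suc j * qp q q j * inverse (qpoch q (q / q / z) (- int j)) =
     - (q * q ^ j * z) * qp q q j * ((- 1) ^ j * (inverse (qpoch q (q / q / z) (- int j)) * (q * z) ^ j * qt q j))"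
    by (simp add: qt_Suc power_minus[of z] power_mult_distrib)
  also have "\<dots> = - (q * q ^ j * z) * qp q q j * qp q (q * z) j"
    unfolding refl by simp
  finally have "R_gen q (u, q) (v, Y) 0 j 1 (Suc j) = - (q * q ^ j * z) * qp q q j * qp q (q * z) j /
      (qp q z (Suc j) * qp q q (Suc j) * (1 - q)) * ((1 - 1 / q) * (1 - q * q ^ j) * (1 - Y / q ^ j))" .
  then have R0: "R_gen q (u, q) (v, Y) 0 j 1 (Suc j) = - (q * q ^ j * z) * qp q q j * qp q (z * q) j /
      ((1 - z) * qp q (z * q) j * (qp q q j * (1 - q * q ^ j)) * (1 - q)) * ((1 - 1 / q) * (1 - q * q ^ j) * (1 - Y / q ^ j))"
    by (simp only: qp_Suc[of q q j] qp_Suc_left[of q z j] mult.commute[of q z])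
  have "q * z < 1" using z q01 by (smt (verit) mult_less_cancel_right2 mult_pos_neg)
  then have nz: "qp q (z * q) j \<noteq> 0" by (intro qp_neq_0 q01) (simp add: mult.commute)
  have nz': "1 - q * q ^ j \<noteq> 0" using qq_pos(2)[of "Suc j"] by (simp add: qp_Suc)
  have gen: "n * a * b / (c * b * (a * d) * e) * (f * d * g) = n * (f * g / (c * e))"
    if "a \<noteq> 0" "b \<noteq> 0" "d \<noteq> 0" for a b c d e f g n :: real
    using that by (simp add: divide_simps)
  have "R_gen q (u, q) (v, Y) 0 j 1 (Suc j) =
      - (q * q ^ j * z) * ((1 - 1 / q) * (1 - Y / q ^ j) / ((1 - z) * (1 - q)))"
    unfolding R0 by (rule gen[OF qq_pos(2) nz nz'])
  also have "\<dots> = - ((q * (1 - 1 / q)) * (q ^ j * (1 - Y / q ^ j))) * z / ((1 - z) * (1 - q))"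
    by (simp only: divide_inverse mult_ac mult_minus_left mult_minus_right)
  also have "q * (1 - 1 / q) = - (1 - q)" by (simp add: right_diff_distrib)
  also have "q ^ j * (1 - Y / q ^ j) = q ^ j - Y" by (simp add: right_diff_distrib)
  also have "- (- (1 - q) * (q ^ j - Y)) * z / ((1 - z) * (1 - q)) = z * (q ^ j - Y) / (1 - z)"
  proof -
    have "- (- (1 - q) * (q ^ j - Y)) * z / ((1 - z) * (1 - q)) = ((1 - q) * (z * (q ^ j - Y))) / ((1 - q) * (1 - z))"
      by (simp only: mult_minus_left minus_minus mult_ac)
    also have "\<dots> = z * (q ^ j - Y) / (1 - z)"
      by (rule nonzero_mult_divide_mult_cancel_left) (use q1 in simp)
    finally show ?thesis .
  qed
  finally show ?thesis unfolding z_def[symmetric] .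
qed

text \<open>Here both terms of the series contribute. The case \<open>j = 0\<close> is separate: the
  index 1 - j of the reflected product is then positive.\<close>

lemma R_gen_11:
  assumes "u * v \<noteq> 0" "u * v < 1"
  shows "R_gen q (u, q) (v, Y) 1 j 1 j = (q ^ j - u * v * Y) / (1 - u * v)"
proof (cases j)
  case 0
  then show ?thesis using R_gen_j2_0[of q u v 1 Y 0] assms q1 by simp
next
  case (Suc h)
  define z where "z = u * v"
  have z: "z \<noteq> 0" "z < 1" using assms by (auto simp: z_def)
  have phi: "phi43 q 1 (q powi - int 1, z * Y, q / q / z) (inverse q, q powi (1 + int (Suc h) - int 1), q powi (1 - int 1 - int (Suc h)) * Y) q =
     (1 - 1 / q) * ((1 - q * q ^ h) * (1 - Y / (q * q ^ h)) - (1 - z * Y) * (1 - 1 / z))"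
  proof -
    have *: "q powi (1 - int 1 - int (Suc h)) = 1 / (q * q ^ h)"
    proof -
      have "1 - int 1 - int (Suc h) = - int (Suc h)" by simp
      then show ?thesis by (simp only: power_int_minus power_int_of_nat power_Suc inverse_eq_divide)
    qed
    have I: "{1 - Suc h..1} = {0, 1}" by auto
    define F where "F k = q ^ k * qp q (1 / q ^ 1) k / qp q q k * qp q (1 / q ^ 1) k * qp q (q ^ k * inverse q) (1 - k) *
      qp q (z * Y) k * (qp q q (Suc h) / qp q q (k + Suc h - 1)) * qp q (q / q / z) k * qp q (q ^ k * (1 / (q * q ^ h) * Y)) (1 - k)" for k
    have "phi43 q 1 (q powi - int 1, z * Y, q / q / z) (inverse q, q powi (1 + int (Suc h) - int 1), q powi (1 - int 1 - int (Suc h)) * Y) q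
      = (\<Sum>k\<in>{0, 1}. F k)"
      unfolding * phi43_eq[OF q01] I F_def ..
    also have "\<dots> = F 0 + F 1" by simp
    also have "F 0 = (1 - 1 / q) * ((1 - q * q ^ h) * (1 - Y / (q * q ^ h)))"
      by (simp add: F_def qp_Suc inverse_eq_divide)
    also have "F 1 = (q * (1 - 1 / q) / (1 - q)) * ((1 - 1 / q) * ((1 - z * Y) * (1 - 1 / z)))"
      by (simp add: F_def)
    also have "q * (1 - 1 / q) / (1 - q) = -1" using q1 by (simp add: field_simps)
    also have "e * a + - 1 * (e * b) = e * (a - b)" for e a b :: real
      by (simp add: right_diff_distrib)
    finally show ?thesis .
  qed
  have "q / q / z = q / (q * z)" by simp
  then have refl: "inverse (qpoch q (q / q / z) (- int h)) * (q * z) ^ h * qt q h = (- 1) ^ h * qp q (q * z) h"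
    using qpoch_neg_reflect[OF q0, of "q * z" h] z by simp
  define P where "P = (1 - 1 / q) * ((1 - q * q ^ h) * (1 - Y / (q * q ^ h)) - (1 - z * Y) * (1 - 1 / z))"
  have "int 1 - int (Suc h) = - int h" by simp
  then have "R_gen q (u, q) (v, Y) 1 (Suc h) 1 (Suc h) =
    q * qt q (Suc h) * q ^ Suc h * (- z) ^ Suc h * inverse (qpoch q (q / q / z) (- int h)) /
      (qp q z (Suc (Suc h)) * (1 - q)) * P"
    unfolding R_gen_def prod.case Let_def z_def[symmetric] phi P_def[symmetric]
    by (simp only: qpoch_nat qt_eq power_add) (simp add: divide_inverse mult_ac)
  also have "q * qt q (Suc h) * q ^ Suc h * (- z) ^ Suc h * inverse (qpoch q (q / q / z) (- int h)) =
     - (q * q * q ^ h * z) * ((- 1) ^ h * (inverse (qpoch q (q / q / z) (- int h)) * (q * z) ^ h * qt q h))"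
    by (simp add: qt_Suc power_minus[of z] power_mult_distrib)
  also have "\<dots> = - (q * q * q ^ h * z) * qp q (q * z) h"
    unfolding refl by simp
  finally have R: "R_gen q (u, q) (v, Y) 1 (Suc h) 1 (Suc h) = - (q * q * q ^ h * z) * qp q (q * z) h /
      (qp q z (Suc (Suc h)) * (1 - q)) * P" .
  have qz: "z * q < 1" using z q01 by (smt (verit) mult_less_cancel_right2 mult_neg_pos mult.commute)
  have nz: "qp q (z * q) h \<noteq> 0" "qp q (z * q) (Suc h) \<noteq> 0" by (intro qp_neq_0 q01 qz)+
  then have nz': "1 - z * q * q ^ h \<noteq> 0" by (simp add: qp_Suc)
  have "qp q z (Suc (Suc h)) = (1 - z) * qp q (z * q) h * (1 - z * q * q ^ h)"
    by (simp only: qp_Suc_left[of q z] qp_Suc[of q "z * q"] mult.assoc)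
  then have "R_gen q (u, q) (v, Y) 1 (Suc h) 1 (Suc h) = - (q * q * q ^ h * z) * P / ((1 - z) * (1 - z * q * q ^ h) * (1 - q))"
    unfolding R using nz by (simp add: mult.commute[of q z])
  \<comment> \<open>The combination of the two terms contains the factor 1 - z q^(h+1), which
    cancels the last factor of \<open>qp q z (Suc (Suc h))\<close>.\<close>
  also have "q * q * q ^ h * z * P = - (1 - q) * (q * q ^ h - z * Y) * (1 - z * q * q ^ h)"
  proof -
    have "q * q * q ^ h * z * P = ((1 - 1 / q) * q) * ((1 - q * q ^ h) * ((1 - Y / (q * q ^ h)) * (q * q ^ h)) * z
      - (1 - z * Y) * ((1 - 1 / z) * z) * (q * q ^ h))"
    proof -
      have "q * q * Q * z * (e * (a * b - c * d)) = e * q * (a * (b * (q * Q)) * z - c * (d * z) * (q * Q))"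
        for Q e a b c d :: real by (simp add: algebra_simps)
      then show ?thesis unfolding P_def .
    qed
    also have "(1 - 1 / q) * q = q - 1" by (simp add: left_diff_distrib)
    also have "(1 - Y / (q * q ^ h)) * (q * q ^ h) = q * q ^ h - Y" by (simp add: left_diff_distrib)
    also have "(1 - 1 / z) * z = z - 1" using z by (simp add: left_diff_distrib)
    finally show ?thesis by (simp add: algebra_simps)
  qed
  then have "- (q * q * q ^ h * z) * P = (1 - q) * (q * q ^ h - z * Y) * (1 - z * q * q ^ h)"
    by (simp only: mult_minus_left minus_minus)
  also have "e * a * c / (b * c * e) = a / b" if "e \<noteq> 0" "c \<noteq> 0" for a b c e :: real
    using that by simp
  finally have "R_gen q (u, q) (v, Y) 1 (Suc h) 1 (Suc h) = (q * q ^ h - z * Y) / (1 - z)"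
    using nz' q1 by auto
  then show ?thesis by (simp only: Suc z_def power_Suc)
qed

text \<open>The explicit formula has a removable singularity at u = 0. The evaluated expression is
  continuous there, so its value at u is the punctured limit; v and Y stay at their fixed
  point.\<close>

lemma R_spec_sHL_sqW:
  assumes u: "0 \<le> u" "u < 1" and R: "\<And>u'. u' * s \<noteq> 0 \<Longrightarrow> u' * s < 1 \<Longrightarrow> R_gen q (u', q) (s, - \<theta> / s) i1 j1 i2 j2 = f u' / (1 - u' * s)"
    and f: "isCont f u"
  shows "R_spec q s (sHL u) (sqW \<theta>) i1 j1 i2 j2 = f u / (1 - u * s)"
proof -
  let ?F = "row_filter q (sHL u) \<times>\<^sub>F col_filter s (sqW \<theta>)"
  have us: "u * s < 1" using u s0 by (smt (verit) mult_nonneg_nonpos)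
  have "((\<lambda>u'. f u' / (1 - u' * s)) \<longlongrightarrow> f u / (1 - u * s)) (at u)"
    using f us by (intro tendsto_intros) (auto simp: isCont_def)
  then have 1: "((\<lambda>p. f (fst p) / (1 - fst p * s)) \<longlongrightarrow> f u / (1 - u * s)) (row_filter q (sHL u))"
    by (simp add: filterlim_filtermap)
  have "((\<lambda>x. f (fst (fst x)) / (1 - fst (fst x) * s)) \<longlongrightarrow> f u / (1 - u * s)) ?F"
    by (rule filterlim_compose[OF 1 filterlim_fst])
  then have "((\<lambda>(uX, vY). R_gen q uX vY i1 j1 i2 j2) \<longlongrightarrow> f u / (1 - u * s)) ?F"
  proof (rule Lim_transform_eventually)
    have "((\<lambda>u'. u' * s) \<longlongrightarrow> u * s) (at u)" by (intro tendsto_intros)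
    then have "\<forall>\<^sub>F u' in at u. u' * s < 1" using us by (rule order_tendstoD)
    then have "\<forall>\<^sub>F p in row_filter q (sHL u). fst p * s < 1 \<and> snd p = q"
      by (simp add: eventually_filtermap)
    then have "\<forall>\<^sub>F x in ?F. fst (fst x) * s < 1 \<and> snd (fst x) = q" by (rule eventually_fst_prod)
    moreover have "\<forall>\<^sub>F x in ?F. fst (fst x) \<noteq> 0"
      by (rule eventually_fst_prod) (rule eventually_mono[OF row_lim(3)], simp)
    moreover have "\<forall>\<^sub>F x in ?F. snd x = (s, - \<theta> / s)"
      by (intro eventually_snd_prod) (simp add: eventually_principal)
    ultimately show "\<forall>\<^sub>F x in ?F. f (fst (fst x)) / (1 - fst (fst x) * s) = (case x of (uX, vY) \<Rightarrow> R_gen q uX vY i1 j1 i2 j2)"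
    proof eventually_elim
      case (elim x)
      obtain u' X vY where x: "x = ((u', X), vY)" by (metis surj_pair)
      show ?case using elim R[of u'] s0 by (simp add: x)
    qed
  qed
  from tendsto_Lim[OF prod_neq_bot this] show ?thesis unfolding R_spec_def .
qed

lemma R_spec_01:
  assumes "0 \<le> u" "u < 1"
  shows "R_spec q s (sHL u) (sqW \<theta>) 0 j 1 (Suc j) = u * (s * q ^ j + \<theta>) / (1 - u * s)"
proof (rule R_spec_sHL_sqW[OF assms])
  fix u' assume "u' * s \<noteq> 0" "u' * s < 1"
  then show "R_gen q (u', q) (s, - \<theta> / s) 0 j 1 (Suc j) = u' * (s * q ^ j + \<theta>) / (1 - u' * s)"
    using s0 by (subst R_gen_01) (auto simp: field_simps)
qed (intro continuous_intros)

lemma R_spec_11: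
  assumes "0 \<le> u" "u < 1"
  shows "R_spec q s (sHL u) (sqW \<theta>) 1 j 1 j = (q ^ j + u * \<theta>) / (1 - u * s)"
proof (rule R_spec_sHL_sqW[OF assms])
  fix u' assume "u' * s \<noteq> 0" "u' * s < 1"
  then show "R_gen q (u', q) (s, - \<theta> / s) 1 j 1 j = (q ^ j + u' * \<theta>) / (1 - u' * s)"
    using s0 by (subst R_gen_11) auto
qed (intro continuous_intros)

section \<open>Evaluation of the row weights w, and of w* for sg columns\<close>

lemma w_gen_nonconserving: "i1 + j1 \<noteq> i2 + j2 \<Longrightarrow> w_gen q s uX i1 j1 i2 j2 = 0"
  by (cases uX) (simp add: w_gen_def)

lemma w_spec_nonconserving: "i1 + j1 \<noteq> i2 + j2 \<Longrightarrow> w_spec q s \<rho> i1 j1 i2 j2 = 0"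
  unfolding w_spec_def
  by (intro tendsto_Lim row_filter_neq_bot) (simp add: w_gen_nonconserving)

lemma wstar_spec_nonconserving: "i2 + j1 \<noteq> i1 + j2 \<Longrightarrow> wstar_spec q s \<rho>' i1 j1 i2 j2 = 0"
  unfolding wstar_spec_def
  by (intro tendsto_Lim col_filter_neq_bot) (simp add: wstar_gen_def w_gen_nonconserving)

text \<open>In an sg row the lower diagram is empty, so \<open>i1 = 0\<close> and the series is
  trivial. As w* exchanges \<open>i1\<close> and \<open>i2\<close>, the same evaluation serves sg
  columns, where \<open>i2 = 0\<close>.\<close>

lemma w_gen_0:
  "w_gen q s (u, X) 0 (i2 + j2) i2 j2 = (- s) ^ j2 * qp q (u / s) j2 * qp q q (i2 + j2) / (qp q q j2 * qp q (s * u) (i2 + j2))"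
proof -
  have "int (i2 + j2) - int i2 = int j2" "int j2 - int 0 = int j2" by simp_all
  then show ?thesis unfolding w_gen_def prod.case phi43_0
    by (simp only: qpoch_nat) (simp add: power_minus[of s])
qed

lemma w_lim_sg:
  "((\<lambda>p. w_gen q s p 0 (i2 + j2) i2 j2) \<longlongrightarrow> (- s) ^ j2 * qp q q (i2 + j2) / qp q q j2) (sg_filter \<alpha>)"
proof -
  have "((\<lambda>p. (- s) ^ j2 * qp q (fst p / s) j2 * qp q q (i2 + j2) / (qp q q j2 * qp q (s * fst p) (i2 + j2)))
    \<longlongrightarrow> (- s) ^ j2 * qp q (0 / s) j2 * qp q q (i2 + j2) / (qp q q j2 * qp q (s * 0) (i2 + j2))) (sg_filter \<alpha>)"
    using s0 by (intro tendsto_intros sg_filter_lim) auto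
  moreover have "(\<lambda>p. w_gen q s p 0 (i2 + j2) i2 j2) = (\<lambda>p. (- s) ^ j2 * qp q (fst p / s) j2 * qp q q (i2 + j2) / (qp q q j2 * qp q (s * fst p) (i2 + j2)))"
    by (rule ext) (metis w_gen_0 prod.collapse)
  ultimately show ?thesis by simp
qed

lemma w_spec_sg: "w_spec q s (sg_row \<alpha>) 0 (i2 + j2) i2 j2 = (- s) ^ j2 * qp q q (i2 + j2) / qp q q j2"
  unfolding w_spec_def using w_lim_sg by (intro tendsto_Lim row_filter_neq_bot) simp

lemma wstar_spec_sg:
  "wstar_spec q s (sg_col \<beta>) i1 (i1 + j2) 0 j2 =
    qp q (s\<^sup>2) i1 / qp q q i1 * ((- s) ^ j2 * qp q q (i1 + j2) / qp q q j2)"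
proof -
  have "((\<lambda>p. wstar_gen q s p i1 (i1 + j2) 0 j2) \<longlongrightarrow>
     qp q (s\<^sup>2) i1 / qp q q i1 * ((- s) ^ j2 * qp q q (i1 + j2) / qp q q j2)) (sg_filter \<beta>)"
    unfolding wstar_gen_def using tendsto_mult[OF tendsto_const w_lim_sg[of i1 j2 \<beta>], of "qp q (s\<^sup>2) i1 / qp q q i1"]
    by (simp only: qpoch_nat) simp
  then show ?thesis unfolding wstar_spec_def by (intro tendsto_Lim col_filter_neq_bot) simp
qed

text \<open>All dependence on u cancels between the prefactor and the parameter
  \<open>q * s / u\<close> of the series; what is left is a sign times q^(n(n+1)/2).\<close>

lemma reflect_core:
  assumes "u \<noteq> 0" and P: "(\<Prod>i<n. 1 - (u / s) / q ^ Suc i) \<noteq> 0"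
  shows "s powi (- int n) * u ^ n * qpoch q (u / s) (- int n) * qp q (q * s / u) n = (- 1) ^ n * (qt q n * q ^ n)"
proof -
  have "u / s \<noteq> 0" using assms s0 by auto
  from prod_reflect[OF q0 this, of n]
  have "qp q (q * s / u) n * (u / s) ^ n = (- 1) ^ n * qt q n * q ^ n * (\<Prod>i<n. 1 - (u / s) / q ^ Suc i)" by simp
  moreover have "s powi (- int n) * u ^ n = (u / s) ^ n"
    by (simp add: power_int_minus divide_inverse power_mult_distrib power_inverse)
  moreover have "t * inverse D * w = (w * t) * inverse D" and "D \<noteq> 0 \<Longrightarrow> a * b * c * D * inverse D = a * (b * c)" for a b c t w D :: real
    by simp_all
  ultimately show ?thesis using P unfolding qpoch_neg by metis
qed

lemma sign_sq: "(- 1 :: real) ^ n * ((- 1) ^ n * x) = x"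
  by (simp flip: mult.assoc power_mult_distrib)

lemma qp_ratio:
  assumes "a < 1"
  shows "qp q (a * q) n / qp q a (Suc n) = 1 / (1 - a)"
  using qp_neq_0[OF q01 assms, of "Suc n"] assms unfolding qp_Suc_left[of q a n] by simp

text \<open>For \<open>j2 = 0\<close> the series consists of its last term alone. The hypothesis on
  the product excludes u = s q^(i+1), where the negative-index product in the prefactor has a zero
  denominator.\<close>

lemma w_sHL_00:
  assumes "u \<noteq> 0" "s * u < 1" "(\<Prod>i<g. 1 - (u / s) / q ^ Suc i) \<noteq> 0"
  shows "w_gen q s (u, q) g 0 g 0 = (1 - s * u * q ^ g) / (1 - s * u)"
proof -
  have phi: "phi43 q g (q powi - int g, s * u * q, q * s / u) (s\<^sup>2, q powi (1 + int 0 - int g), b) q =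
    (q ^ g * qp q (1 / q ^ g) g / qp q q g) * qp q (1 / q ^ (g + 0)) g * qp q (s * u * q) g * qp q (q * s / u) g" for b
    by (subst phi43_eq[OF q01]) simp
  have i: "int 0 - int g = - int g" by simp
  have "w_gen q s (u, q) g 0 g 0 = (- 1) ^ g * qt q g * (s powi (- int g) * u ^ g * qpoch q (u / s) (- int g) * qp q (q * s / u) g)
     / (qp q q g * qp q (s * u) g) *
     ((q ^ g * qp q (1 / q ^ g) g / qp q q g) * qp q (1 / q ^ (g + 0)) g * qp q (s * u * q) g)"
    unfolding w_gen_def prod.case phi i
    by (simp only: qpoch_nat qt_eq') (simp add: divide_inverse mult_ac)
  also have "\<dots> = qp q (s * u * q) g / qp q (s * u) g"
    unfolding reflect_core[OF assms(1,3)] qp_inv_diag qp_inv_shift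
    by (simp add: field_simps flip: power_mult_distrib)
  also have "\<dots> = (1 - s * u * q ^ g) / (1 - s * u)"
    using qp_neq_0[OF q01 assms(2), of g] qp_Suc_left[of q "s * u" g] qp_Suc[of q "s * u" g] assms(2)
    by (simp add: field_simps)
  finally show ?thesis .
qed

lemma w_sHL_10:
  assumes "u \<noteq> 0" "s * u < 1" "(\<Prod>i<g. 1 - (u / s) / q ^ Suc i) \<noteq> 0"
  shows "w_gen q s (u, q) g 1 (Suc g) 0 = (1 - q * q ^ g) / (1 - s * u)"
proof -
  have phi: "phi43 q g (q powi - int (Suc g), s * u * q, q * s / u) (s\<^sup>2, q powi (1 + int 0 - int g), b) q =
    (q ^ g * qp q (1 / q ^ g) g / qp q q g) * qp q (1 / q ^ (g + 1)) g * qp q (s * u * q) g * qp q (q * s / u) g" for b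
    by (subst phi43_eq[OF q01]) simp
  have i: "int 0 - int g = - int g" "int 1 - int (Suc g) = - int g" by simp_all
  have "w_gen q s (u, q) g 1 (Suc g) 0 = (- 1) ^ g * (qt q g * q ^ (g * 1)) * (s powi (- int g) * u ^ g * qpoch q (u / s) (- int g) * qp q (q * s / u) g)
     * (1 - q) / (qp q q g * qp q (s * u) (Suc g)) *
     ((q ^ g * qp q (1 / q ^ g) g / qp q q g) * qp q (1 / q ^ (g + 1)) g * qp q (s * u * q) g)"
    unfolding w_gen_def prod.case phi i
    by (simp only: qpoch_nat qt_eq') (simp add: divide_inverse mult_ac)
  also have "\<dots> = (1 - q * q ^ g) * (qp q (s * u * q) g / qp q (s * u) (Suc g))"
    unfolding reflect_core[OF assms(1,3)] qp_inv_diag qp_inv_shift using q1 qp_neq_0[OF q01 assms(2), of "Suc g"]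
    by (simp add: qp_Suc[of q q] divide_simps sign_sq mult_ac)
  also have "\<dots> = (1 - q * q ^ g) / (1 - s * u)"
    unfolding qp_ratio[OF assms(2)] by simp
  finally show ?thesis .
qed

lemma w_sHL_01:
  assumes "u \<noteq> 0" "s * u < 1" "(\<Prod>i<h. 1 - (u / s) / q ^ Suc i) \<noteq> 0"
  shows "w_gen q s (u, q) (Suc h) 0 h 1 = u * (1 - s\<^sup>2 * q ^ h) / (1 - s * u)"
proof -
  have I: "{Suc h - 1..Suc h} = {h, Suc h}" by auto
  \<comment> \<open>Of the two terms left for \<open>j2 = 1\<close> the upper one vanishes, because
    \<open>i2\<close> is smaller than its index.\<close>
  have z: "qp q (1 / q ^ h) (Suc h) = 0" by (rule qp_inv_pow_eq_0[OF q0]) simp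
  have pw: "q ^ h * (q powi (1 - int h - int 1) * q) = q"
    by (simp add: power_int_minus power_int_diff)
  have phi: "phi43 q (Suc h) (q powi - int h, s * u * q, q * s / u) (s\<^sup>2, q powi (1 + int 1 - int (Suc h)), q powi (1 - int h - int 1) * q) q =
    q ^ h * qp q (1 / q ^ (h + 1)) h / qp q q h * qp q (1 / q ^ (h + 0)) h * (1 - q ^ h * s\<^sup>2) * qp q (s * u * q) h * (1 - q) * qp q (q * s / u) h * (1 - q)"
    by (subst phi43_eq[OF q01], subst I) (simp add: z, simp add: pw[simplified])
  have i: "int 1 - int (Suc h) = - int h" "int 0 - int h = - int h" by simp_all
  have "w_gen q s (u, q) (Suc h) 0 h 1 = (- 1) ^ h * qt q (Suc h) * u * (s powi (- int h) * u ^ h * qpoch q (u / s) (- int h) * qp q (q * s / u) h)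
     / (qp q q (Suc h) * (1 - q) * qp q (s * u) (Suc h)) *
     (q ^ h * qp q (1 / q ^ (h + 1)) h / qp q q h * qp q (1 / q ^ (h + 0)) h * (1 - q ^ h * s\<^sup>2) * qp q (s * u * q) h * (1 - q) * (1 - q))"
    unfolding w_gen_def prod.case phi i
    by (simp only: qpoch_nat qt_eq') (simp add: divide_inverse mult_ac)
  also have "\<dots> = u * (1 - s\<^sup>2 * q ^ h) * (qp q (s * u * q) h / qp q (s * u) (Suc h))"
    unfolding reflect_core[OF assms(1,3)] qp_inv_shift using q1 qp_neq_0[OF q01 assms(2), of "Suc h"]
    by (simp add: qt_Suc divide_simps sign_sq mult_ac)
  also have "\<dots> = u * (1 - s\<^sup>2 * q ^ h) / (1 - s * u)"
    unfolding qp_ratio[OF assms(2)] by simp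
  finally show ?thesis .
qed

lemma w_sHL_11:
  assumes "u \<noteq> 0" "s * u < 1" "(\<Prod>i<g. 1 - (u / s) / q ^ Suc i) \<noteq> 0"
  shows "w_gen q s (u, q) g 1 g 1 = (u - s * q ^ g) / (1 - s * u)"
proof (cases g)
  case 0
  have "w_gen q s (u, q) 0 1 0 1 = (- s * (1 - u / s)) / (1 - s * u)"
    using w_gen_0[of u q 0 1] q1 by simp
  also have "- s * (1 - u / s) = u - s" using s0 by (simp add: right_diff_distrib)
  finally show ?thesis using 0 by simp
next
  case (Suc h)
  have P: "(\<Prod>i<h. 1 - (u / s) / q ^ Suc i) \<noteq> 0" using assms(3) Suc by simp
  have I: "{Suc h - 1..Suc h} = {h, Suc h}" by auto
  have pw: "q ^ h * (q powi (1 - int (Suc h) - int 1) * q) = 1"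
    by (simp add: power_int_minus power_int_diff)
  have phi: "phi43 q (Suc h) (q powi - int (Suc h), s * u * q, q * s / u) (s\<^sup>2, q powi (1 + int 1 - int (Suc h)), q powi (1 - int (Suc h) - int 1) * q) q =
    (q ^ Suc h * qp q (1 / q ^ Suc h) (Suc h) / qp q q (Suc h)) * qp q (1 / q ^ (Suc h + 0)) (Suc h) * qp q (s * u * q) (Suc h) * qp q (q * s / u) (Suc h)"
  proof -
    \<comment> \<open>Here it is the lower term that vanishes: X = q makes the argument of its last
      product equal to 1.\<close>
    have "qp q (q ^ h * (q powi (1 - int (Suc h) - int 1) * q)) (Suc h - h) = 0"
      unfolding pw by (simp add: qp_one_arg)
    then show ?thesis
      by (subst phi43_eq[OF q01], subst I) (use q1 in simp)
  qed
  have i: "int 1 - int (Suc h) = - int h" by simp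
  have "w_gen q s (u, q) (Suc h) 1 (Suc h) 1 = (- 1) ^ Suc (Suc h) * (qt q (Suc h) * q ^ Suc h) * u * (s powi (- int h) * u ^ h * qpoch q (u / s) (- int h) * qp q (q * s / u) h)
     / (qp q q (Suc h) * qp q (s * u) (Suc (Suc h))) *
     ((q ^ Suc h * qp q (1 / q ^ Suc h) (Suc h) / qp q q (Suc h)) * qp q (1 / q ^ (Suc h + 0)) (Suc h) * qp q (s * u * q) (Suc h) * (1 - q * s / u * q ^ h))"
    unfolding w_gen_def prod.case phi i qp_Suc[of q "q * s / u" h] using q1
    by (simp only: qpoch_nat qt_eq') (simp add: divide_inverse mult_ac)
  also have "\<dots> = (u * (1 - q * s / u * q ^ h)) * (qp q (s * u * q) (Suc h) / qp q (s * u) (Suc (Suc h)))"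
    unfolding reflect_core[OF assms(1) P] qp_inv_diag qp_inv_shift using qp_neq_0[OF q01 assms(2), of "Suc (Suc h)"]
    by (simp add: qt_Suc divide_simps sign_sq mult_ac)
  also have "\<dots> = (u * (1 - q * s / u * q ^ h)) / (1 - s * u)"
    unfolding qp_ratio[OF assms(2)] by simp
  also have "u * (1 - q * s / u * q ^ h) = u - s * q ^ g"
    using assms(1) by (simp add: Suc field_simps)
  finally show ?thesis by (simp add: Suc)
qed

text \<open>The evaluated formula holds off u' = 0 and the finitely many points s q^(k+1), all
  avoided near u in the punctured sense; continuity then gives the value at u.\<close>

lemma w_spec_sHL:
  assumes u: "0 \<le> u" "u < 1"
    and w: "\<And>u'. u' \<noteq> 0 \<Longrightarrow> s * u' < 1 \<Longrightarrow> (\<Prod>i<n. 1 - (u' / s) / q ^ Suc i) \<noteq> 0 \<Longrightarrow>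
      w_gen q s (u', q) i1 j1 i2 j2 = f u' / (1 - s * u')"
    and f: "isCont f u"
  shows "w_spec q s (sHL u) i1 j1 i2 j2 = f u / (1 - s * u)"
proof -
  have us: "s * u < 1" using u s0 by (smt (verit) mult_nonneg_nonpos mult.commute)
  have "((\<lambda>u'. f u' / (1 - s * u')) \<longlongrightarrow> f u / (1 - s * u)) (at u)"
    using f us by (intro tendsto_intros) (auto simp: isCont_def)
  then have "((\<lambda>u'. w_gen q s (u', q) i1 j1 i2 j2) \<longlongrightarrow> f u / (1 - s * u)) (at u)"
  proof (rule Lim_transform_eventually)
    have "((\<lambda>u'. s * u') \<longlongrightarrow> s * u) (at u)" by (intro tendsto_intros)
    then have "\<forall>\<^sub>F u' in at u. s * u' < 1" using us by (rule order_tendstoD)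
    moreover have "\<forall>\<^sub>F u' in at u. u' \<noteq> 0" by (rule eventually_at_neq)
    moreover have "\<forall>\<^sub>F u' in at u. \<forall>k\<in>{..<n}. u' \<noteq> s * q ^ Suc k"
      by (rule eventually_ball_finite) (auto intro: eventually_at_neq)
    ultimately show "\<forall>\<^sub>F u' in at u. f u' / (1 - s * u') = w_gen q s (u', q) i1 j1 i2 j2"
    proof eventually_elim
      case (elim u')
      have "1 - (u' / s) / q ^ Suc k \<noteq> 0" if "k < n" for k
      proof
        assume "1 - (u' / s) / q ^ Suc k = 0"
        then have "u' = s * q ^ Suc k" using s0 by (simp add: field_simps)
        then show False using elim that by auto
      qed
      then have "(\<Prod>i<n. 1 - (u' / s) / q ^ Suc i) \<noteq> 0"
        unfolding prod_zero_iff[OF finite_lessThan] by blast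
      then show ?case using w elim by simp
    qed
  qed
  then show ?thesis unfolding w_spec_def
    by (intro tendsto_Lim row_filter_neq_bot) (simp add: filterlim_filtermap)
qed

lemma w_spec_sHL_eqs:
  assumes u: "0 \<le> u" "u < 1"
  shows "w_spec q s (sHL u) g 0 g 0 = (1 - s * u * q ^ g) / (1 - s * u)"
    and "w_spec q s (sHL u) g 1 (Suc g) 0 = (1 - q * q ^ g) / (1 - s * u)"
    and "w_spec q s (sHL u) (Suc g) 0 g 1 = u * (1 - s\<^sup>2 * q ^ g) / (1 - s * u)"
    and "w_spec q s (sHL u) g 1 g 1 = (u - s * q ^ g) / (1 - s * u)"
  by (rule w_spec_sHL[OF u, where n = g], erule (2) w_sHL_00 w_sHL_10 w_sHL_01 w_sHL_11, intro continuous_intros)+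

section \<open>The column weights of type sqW\<close>

lemma prod_one_minus_inv: "(\<Prod>i<d. 1 - 1 / q ^ Suc i) * (qt q d * q ^ d) = (- 1) ^ d * qp q q d"
proof (induction d)
  case (Suc d)
  have "(\<Prod>i<Suc d. 1 - 1 / q ^ Suc i) * (qt q (Suc d) * q ^ Suc d) =
     (\<Prod>i<d. 1 - 1 / q ^ Suc i) * (qt q d * q ^ d) * ((1 - 1 / q ^ Suc d) * q ^ Suc d)"
    by (simp add: qt_Suc)
  also have "(1 - 1 / q ^ Suc d) * q ^ Suc d = - (1 - q * q ^ d)" by (simp add: left_diff_distrib)
  finally show ?case unfolding Suc
    by (rule trans) (simp only: qp_Suc power_Suc mult_ac mult_minus_left mult_minus_right mult_1_left)
qed simp

lemma qt_reverse: "qt q r * q ^ r * qt q (m + r) = q ^ ((m + r) * r) * qt q m"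
proof -
  have "qt q r * q ^ r * qt q (m + r) = (qt q r * qt q r * q ^ r) * q ^ (m * r) * qt q m"
    unfolding qt_add by (simp only: mult_ac)
  then show ?thesis unfolding qt_sq by (simp add: distrib_right power_add)
qed

text \<open>Reading the product backwards, from i to m - 1 - i, brings the third lower parameter of
  the series into the form of the last factor of \<open>saal_term\<close>.\<close>

lemma prod_reverse:
  assumes "E = Y / q ^ j"
  shows "qp q (q powi (1 - int j - int m) * Y) m * qt q m = (\<Prod>i<m. q ^ i - E)"
proof -
  have "(\<Prod>i<m. q ^ i - E) = (\<Prod>i<m. q ^ (m - Suc i) - E)"
    by (subst prod.nat_diff_reindex[symmetric]) simp
  moreover have "qt q m = (\<Prod>i<m. q ^ (m - Suc i))"
    unfolding qt_def by (subst prod.nat_diff_reindex[symmetric]) simp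
  moreover have "(1 - q powi (1 - int j - int m) * Y * q ^ i) * q ^ (m - Suc i) = q ^ (m - Suc i) - E" if "i < m" for i
  proof -
    have "q powi (1 - int j - int m) * q ^ i * q ^ (m - Suc i) = q powi (1 - int j - int m + int i + int (m - Suc i))"
      by (simp only: power_int_add q_neq_0 power_int_of_nat simp_thms)
    also have "1 - int j - int m + int i + int (m - Suc i) = - int j" using that by simp
    finally have "q powi (1 - int j - int m) * q ^ i * q ^ (m - Suc i) = 1 / q ^ j"
      by (simp add: power_int_minus inverse_eq_divide)
    moreover have "(1 - p * Y * a) * b = b - Y * (p * a * b)" for p a b :: real
      by (simp add: algebra_simps)
    ultimately show ?thesis using assms by simp
  qed
  ultimately show ?thesis
    unfolding qp_def by (simp only: prod.distrib[symmetric]) (rule prod.cong, simp_all)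
qed

text \<open>This is the balanced sum with A = q^(-j), B = c Y, C = c and E = Y q^(-j), for which E C
  = A B. Reversing the two terminating products supplies the factor 1/\<open>qt q N\<close>.\<close>

lemma saal_weight:
  fixes Y :: real
  assumes c: "c < 1"
  shows "(\<Sum>r\<le>N. q ^ r * qp q (1 / q ^ N) r * qp q (1 / q ^ j) r * qp q (c * q ^ r) (N - r) * qp q (c * Y) r *
      qp q (q powi (1 - int j - int (N - r)) * Y) (N - r) / qp q q r) =
    (\<Prod>i<N. (q ^ i - Y) * (1 / q ^ j - c * q ^ i)) / qt q N"
proof -
  define E where "E = Y / q ^ j"
  have AB: "E * c = (1 / q ^ j) * (c * Y)"
    by (simp only: E_def divide_inverse mult_ac mult_1_left)
  have "q ^ r * qp q (1 / q ^ N) r * qp q (1 / q ^ j) r * qp q (c * q ^ r) (N - r) * qp q (c * Y) r *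
      qp q (q powi (1 - int j - int (N - r)) * Y) (N - r) / qp q q r =
      saal_term q (1 / q ^ j) (c * Y) c E N r / qt q N" if "r \<le> N" for r
  proof -
    define m where "m = N - r"
    have N: "N = m + r" using that by (simp add: m_def)
    have p1: "qp q (1 / q ^ (m + r)) r = (- 1) ^ r * qt q r * qp q q (m + r) / (qp q q m * q ^ ((m + r) * r))"
      using qp_inv_pow'[OF q01 le_add2[of r m]] unfolding add_diff_cancel_right' .
    have p2: "qp q (q powi (1 - int j - int m) * Y) m = (\<Prod>i<m. q ^ i - E) / qt q m"
      by (rule nonzero_eq_divide_eq[THEN iffD2, OF qt_neq_0(1) prod_reverse[OF E_def]])
    have p3: "q ^ r * qt q r / (q ^ ((m + r) * r) * qt q m) = 1 / qt q (m + r)"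
    proof -
      have e: "q ^ r * qt q r * qt q (m + r) = q ^ ((m + r) * r) * qt q m"
        unfolding mult.commute[of "q ^ r" "qt q r"] by (rule qt_reverse)
      have gen: "a / b = 1 / d" if "a * d = b" "b \<noteq> 0" "d \<noteq> 0" for a b d :: real
        by (rule frac_eq_eq[THEN iffD2, OF that(2,3)]) (simp only: that(1) mult_1_left)
      show ?thesis by (rule gen[OF e]) simp_all
    qed
    have "q ^ r * qp q (1 / q ^ N) r * qp q (1 / q ^ j) r * qp q (c * q ^ r) (N - r) * qp q (c * Y) r *
      qp q (q powi (1 - int j - int (N - r)) * Y) (N - r) / qp q q r =
      (q ^ r * qt q r / (q ^ ((m + r) * r) * qt q m)) * saal_term q (1 / q ^ j) (c * Y) c E N r"
      unfolding N saal_term_def add_diff_cancel_right' p1 p2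
      by (simp only: divide_inverse inverse_mult_distrib mult_ac)
    then show ?thesis unfolding p3 N by (simp only: times_divide_eq_left mult_1_left)
  qed
  note term_eq = this
  have "(\<Sum>r\<le>N. q ^ r * qp q (1 / q ^ N) r * qp q (1 / q ^ j) r * qp q (c * q ^ r) (N - r) * qp q (c * Y) r *
      qp q (q powi (1 - int j - int (N - r)) * Y) (N - r) / qp q q r) =
     (\<Sum>r\<le>N. saal_term q (1 / q ^ j) (c * Y) c E N r / qt q N)"
    by (rule sum.cong[OF refl], rule term_eq) (simp only: atMost_iff)
  also have "\<dots> = (\<Prod>i<N. (1 / q ^ j + c * Y) * q ^ i - E - c * q ^ (2 * i)) / qt q N"
    by (simp only: sum_divide_distrib[symmetric] q_saalschuetz[OF q01 AB])
  \<comment> \<open>With these parameters each quadratic factor of the Saalschuetz product splits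
    into linear ones.\<close>
  also have "(\<Prod>i<N. (1 / q ^ j + c * Y) * q ^ i - E - c * q ^ (2 * i)) = (\<Prod>i<N. (q ^ i - Y) * (1 / q ^ j - c * q ^ i))"
  proof (intro prod.cong refl)
    fix i
    have "q ^ (2 * i) = q ^ i * q ^ i" by (simp only: mult_2 power_add)
    then show "(1 / q ^ j + c * Y) * q ^ i - E - c * q ^ (2 * i) = (q ^ i - Y) * (1 / q ^ j - c * q ^ i)"
    proof -
      have "(a + c * Y) * x - Y * a - c * (x * x) = (x - Y) * (a - c * x)" for a x :: real
        by (simp add: algebra_simps)
      from this[of "1 / q ^ j" "q ^ i"] show ?thesis
        unfolding E_def \<open>q ^ (2 * i) = _\<close> by (simp only: times_divide_eq_right mult_1_right)
    qed
  qed
  finally show ?thesis .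
qed

text \<open>Path conservation with \<open>j1 \<le> i1\<close> is solved by d = i1 - j1 and N = j2.
  The positive factor P is left inexplicit, since only sign and zeros are wanted: these are carried
  by the two products, whose arguments equal 1 at \<open>\<theta> = - s\<close> and at
  \<open>s * \<theta> = - 1\<close> respectively.\<close>

lemma wstar_sqW_pos:
  assumes \<theta>: "0 < \<theta>"
  shows "\<exists>P>0. wstar_spec q s (sqW \<theta>) (j1 + d) j1 (N + d) N = P * (qp q (- s / \<theta>) N * qp q (- s * \<theta>) d)"
proof -
  define Y where "Y = - \<theta> / s"
  \<comment> \<open>What the lower parameter \<open>s\<^sup>2\<close> becomes once the summation
    starts at d instead of 0.\<close>
  define c where "c = s\<^sup>2 * q ^ d"
  have qd: "q ^ n \<le> 1" for n using q0 q1 by (simp add: power_le_one)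
  have c1: "c < 1" unfolding c_def using s_sq mult_left_le[OF qd[of d] zero_le_power2[of s]] by linarith
  define T where "T = (\<lambda>r. q ^ r * qp q (1 / q ^ N) r * qp q (1 / q ^ j1) r * qp q (c * q ^ r) (N - r) * qp q (c * Y) r *
      qp q (q powi (1 - int j1 - int (N - r)) * Y) (N - r) / qp q q r)"
  define K where "K = q ^ d * qp q (1 / q ^ (N + d)) d * qp q (1 / q ^ (j1 + d)) d * qp q q N"
  have phi: "phi43 q (N + d) (q powi - int (j1 + d), s * s * Y, q * s / s) (s\<^sup>2, q powi (1 + int N - int (N + d)), q powi (1 - int (j1 + d) - int N) * Y) q
     = K * qp q (- s * \<theta>) d * (\<Sum>r\<le>N. T r)"
  proof -
    have sY: "s * s * Y = - s * \<theta>" using s0 by (simp add: Y_def)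
    have cY: "- s * \<theta> * q ^ d = c * Y" using s0 by (simp add: Y_def c_def power2_eq_square)
    have qs: "q * s / s = q" using s0 by simp
    define F where "F = (\<lambda>k. q ^ k * qp q (1 / q ^ (N + d)) k / qp q q k * qp q (1 / q ^ (j1 + d)) k * qp q (q ^ k * s\<^sup>2) (N + d - k)
       * qp q (s * s * Y) k * (qp q q N / qp q q (k + N - (N + d))) * qp q (q * s / s) k * qp q (q ^ k * (q powi (1 - int (j1 + d) - int N) * Y)) (N + d - k))"
    \<comment> \<open>After the shift k = r + d every product splits at d. At v = s the parameter
      \<open>q * s / s\<close> is q, so its product cancels the denominator
      \<open>qp q q k\<close>.\<close>
    have F: "F (r + d) = K * qp q (- s * \<theta>) d * T r" if "r \<le> N" for r
    proof -
      have 1: "qp q (1 / q ^ (n + d)) (r + d) = qp q (1 / q ^ (n + d)) d * qp q (1 / q ^ n) r" for n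
        unfolding add.commute[of r d] qp_add by (simp add: power_add)
      have 2: "qp q (- s * \<theta>) (r + d) = qp q (- s * \<theta>) d * qp q (c * Y) r"
        unfolding add.commute[of r d] qp_add cY ..
      have 3: "q ^ (r + d) * s\<^sup>2 = c * q ^ r" by (simp add: c_def power_add)
      have "q ^ (r + d) * q powi (1 - int (j1 + d) - int N) = q powi (int (r + d) + (1 - int (j1 + d) - int N))"
        by (simp only: power_int_add q_neq_0 power_int_of_nat simp_thms)
      also have "int (r + d) + (1 - int (j1 + d) - int N) = 1 - int j1 - int (N - r)" using that by simp
      finally have 4: "q ^ (r + d) * (q powi (1 - int (j1 + d) - int N) * Y) = q powi (1 - int j1 - int (N - r)) * Y"
        by (simp only: mult.assoc[symmetric])
      have 5: "N + d - (r + d) = N - r" "r + d + N - (N + d) = r" by simp_all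
      have 6: "n / z * a * b * e * (g / h) * z * f = (n * a * b * e * g * f) / h" if "z \<noteq> 0" for n z a b e g h f :: real
        using that by simp
      show ?thesis unfolding F_def sY qs 5 unfolding 1 2 3 4 unfolding 6[OF qq_pos(2)] T_def K_def unfolding power_add
        by (simp only: divide_inverse mult_ac)
    qed
    have "phi43 q (N + d) (q powi - int (j1 + d), s * s * Y, q * s / s) (s\<^sup>2, q powi (1 + int N - int (N + d)), q powi (1 - int (j1 + d) - int N) * Y) q
      = (\<Sum>k\<in>{N + d - N..N + d}. F k)"
      unfolding phi43_eq[OF q01] F_def ..
    also have "\<dots> = (\<Sum>r\<in>{0..N}. F (r + d))"
      using sum.shift_bounds_cl_nat_ivl[of F 0 d N] by simp
    also have "\<dots> = (\<Sum>r\<le>N. K * qp q (- s * \<theta>) d * T r)"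
      using F by (intro sum.cong) auto
    finally show ?thesis by (simp only: sum_distrib_left)
  qed
  have T: "(\<Sum>r\<le>N. T r) = (\<Prod>i<N. (q ^ i - Y) * (1 / q ^ j1 - c * q ^ i)) / qt q N"
    unfolding T_def by (rule saal_weight[OF c1])
  define G where "G = (\<Prod>i<N. 1 / q ^ j1 - c * q ^ i)"
  have "(\<Prod>i<N. (q ^ i - Y) * (1 / q ^ j1 - c * q ^ i)) = (\<Prod>i<N. q ^ i - Y) * G"
    by (simp add: G_def prod.distrib)
  moreover have "(\<Prod>i<N. q ^ i - Y) = (- Y) ^ N * qp q (- s / \<theta>) N"
  proof -
    have "q ^ i - Y = - Y * (1 - - s / \<theta> * q ^ i)" for i
      using s0 \<theta> by (simp add: Y_def field_simps)
    then show ?thesis unfolding qp_def by (simp only: prod.distrib prod_constant card_lessThan)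
  qed
  ultimately have T': "(\<Sum>r\<le>N. T r) = (- Y) ^ N * qp q (- s / \<theta>) N * G / qt q N" using T by simp
  have Gpos: "0 < G" unfolding G_def
  proof (rule prod_pos)
    fix i
    have "0 \<le> c" using q0 by (simp add: c_def)
    then have "c * q ^ i \<le> c" using qd[of i] by (intro mult_left_le)
    then have "c * q ^ i < 1" using c1 by simp
    moreover have "1 \<le> 1 / q ^ j1" using qd[of j1] by simp
    ultimately show "0 < 1 / q ^ j1 - c * q ^ i" by linarith
  qed
  have Kpos: "0 < K"
  proof -
    have "qp q (1 / q ^ (N + d)) d * qp q (1 / q ^ (j1 + d)) d =
      ((- 1) ^ d * (- 1) ^ d) * ((qt q d * qp q q (N + d) / (qp q q N * q ^ ((N + d) * d))) * (qt q d * qp q q (j1 + d) / (qp q q j1 * q ^ ((j1 + d) * d))))"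
      using qp_inv_pow'[OF q01, of d "N + d"] qp_inv_pow'[OF q01, of d "j1 + d"] by simp
    also have "(- 1 :: real) ^ d * (- 1) ^ d = 1" by (simp flip: power_mult_distrib)
    also have "0 < 1 * ((qt q d * qp q q (N + d) / (qp q q N * q ^ ((N + d) * d))) * (qt q d * qp q q (j1 + d) / (qp q q j1 * q ^ ((j1 + d) * d))))"
      by (intro mult_pos_pos divide_pos_pos) auto
    finally have "0 < q ^ d * (qp q (1 / q ^ (N + d)) d * qp q (1 / q ^ (j1 + d)) d) * qp q q N"
      by (rule mult_pos_pos[OF mult_pos_pos[OF q_neq_0(2)] qq_pos(1)])
    then show ?thesis unfolding K_def by (simp only: mult.assoc)
  qed
  \<comment> \<open>The prefactor (v/s) of index -d is \<open>inverse D\<close> at v = s. Its sign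
    (-1)^d compensates the sign of the weight.\<close>
  define D where "D = (\<Prod>i<d. 1 - 1 / q ^ Suc i)"
  have D: "inverse D * (- 1) ^ d = qt q d * q ^ d / qp q q d"
  proof -
    have "D * (qt q d * q ^ d) * (- 1) ^ d = qp q q d"
      unfolding D_def prod_one_minus_inv by (simp flip: power_mult_distrib)
    note a = this
    have "inverse D * t = x / p" if "D * x * t = p" "t * t = 1" "p \<noteq> 0" for x t p :: real
    proof -
      have "inverse D * t * p = (D * inverse D) * x * (t * t)" unfolding that(1)[symmetric] by (simp only: mult_ac)
      moreover have "D \<noteq> 0" using that by auto
      ultimately show ?thesis using that by (simp add: nonzero_eq_divide_eq)
    qed
    from this[OF a] show ?thesis by (simp flip: power_mult_distrib)
  qed
  define W where "W = qp q (s\<^sup>2) (j1 + d) * qp q q (N + d) / (qp q q (j1 + d) * qp q (s\<^sup>2) (N + d)) *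
     ((qt q (N + d) * q ^ ((N + d) * j1)) * (\<theta> ^ N * (qt q d * q ^ d / qp q q d)) * qp q q j1 /
      (qp q q (N + d) * qp q q N * qp q (s\<^sup>2) (j1 + (N + d))) * (K * G / qt q N))"
  have sqp: "0 < qp q (s\<^sup>2) n" for n by (rule qp_pos[OF q01 s_sq(1)])
  have Wpos: "0 < W" unfolding W_def using Kpos Gpos \<theta>
    by (intro mult_pos_pos divide_pos_pos sqp qq_pos qt_neq_0 q_neq_0 zero_less_power) auto
  have "wstar_spec q s (sqW \<theta>) (j1 + d) j1 (N + d) N = wstar_gen q s (s, Y) (j1 + d) j1 (N + d) N"
    unfolding wstar_spec_def Y_def
    by (intro tendsto_Lim col_filter_neq_bot) (simp add: tendsto_def eventually_principal)
  also have "\<dots> = qp q (s\<^sup>2) (j1 + d) * qp q q (N + d) / (qp q q (j1 + d) * qp q (s\<^sup>2) (N + d)) *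
     ((- 1) ^ (N + d + N) * (qt q (N + d) * q ^ ((N + d) * j1)) * s powi (- int d) * s ^ (N + d) * inverse D * qp q q j1 /
      (qp q q (N + d) * qp q q N * qp q (s\<^sup>2) (j1 + (N + d))) *
      (K * qp q (- s * \<theta>) d * ((- Y) ^ N * qp q (- s / \<theta>) N * G / qt q N)))"
  proof -
    have i: "int j1 - int (j1 + d) = - int d" "int N - int (N + d) = - int d" by simp_all
    have ss: "s / s = 1" using s0 by simp
    have Dq: "qpoch q (s / s) (- int d) = inverse D" unfolding qpoch_neg D_def ss by simp
    have e: "N + d + j1 = j1 + d + N" by simp
    show ?thesis
      unfolding wstar_gen_def w_gen_def prod.case i Dq phi T' qpoch_nat qt_eq'
      using e by (simp only: if_True simp_thms power2_eq_square)
  qed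
  also have "\<dots> = W * (qp q (- s / \<theta>) N * qp q (- s * \<theta>) d)"
  proof -
    have sg: "(- 1 :: real) ^ (N + d + N) = (- 1) ^ d" 
    proof -
      have "(- 1 :: real) ^ (N + d + N) = (- 1) ^ N * ((- 1) ^ N * (- 1) ^ d)" by (simp add: power_add)
      then show ?thesis unfolding sign_sq .
    qed
    have "s powi (- int d) * s ^ (N + d) = s ^ N" using s0 by (simp add: power_int_minus power_add)
    then have sN: "s powi (- int d) * s ^ (N + d) * (- Y) ^ N = \<theta> ^ N"
      using s0 by (simp add: Y_def flip: power_mult_distrib)
    show ?thesis unfolding W_def sg D[symmetric] sN[symmetric]
      by (simp only: divide_inverse inverse_mult_distrib mult_ac)
  qed
  finally show ?thesis using Wpos by blast
qed

text \<open>At v = s the prefactor is the product for argument 1 with the positive index j1 -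
  i1.\<close>

lemma wstar_sqW_0:
  assumes "i1 < j1"
  shows "wstar_spec q s (sqW \<theta>) i1 j1 i2 j2 = 0"
proof -
  have "qpoch q (s / s) (int j1 - int i1) = 0"
  proof -
    have "int j1 - int i1 = int (j1 - i1)" using assms by simp
    then show ?thesis using assms s0 by (simp only: qpoch_nat) (simp add: qp_one_arg)
  qed
  then have "wstar_gen q s (s, - \<theta> / s) i1 j1 i2 j2 = 0"
    by (simp add: wstar_gen_def w_gen_def)
  then show ?thesis
    unfolding wstar_spec_def
    by (intro tendsto_Lim col_filter_neq_bot) (simp add: tendsto_def eventually_principal)
qed


section \<open>Positivity and conservation\<close>

definition sg_r :: "row_spec \<Rightarrow> bool" where "sg_r \<rho> \<longleftrightarrow> (\<exists>\<alpha>. \<rho> = sg_row \<alpha>)"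
definition sg_c :: "col_spec \<Rightarrow> bool" where "sg_c \<rho>' \<longleftrightarrow> (\<exists>\<beta>. \<rho>' = sg_col \<beta>)"

lemma sg_simps [simp]: "sg_r (sg_row \<alpha>)" "\<not> sg_r (sHL u)" "sg_c (sg_col \<beta>)" "\<not> sg_c (sqW \<theta>)"
  by (simp_all add: sg_r_def sg_c_def)

text \<open>\<open>w_pos\<close>, \<open>ws_pos\<close> and \<open>R_pos\<close> describe the
  supports of the weights for the indices that occur in the field. Beyond path conservation, and
  \<open>j1 \<le> i1\<close> for sqW columns, a weight vanishes only at end points of the parameter
  range: \<open>u = 0\<close>, \<open>\<theta> = - s\<close> or
  \<open>s * \<theta> = - 1\<close>.\<close>

fun w_pos :: "row_spec \<Rightarrow> nat \<Rightarrow> nat \<Rightarrow> nat \<Rightarrow> nat \<Rightarrow> bool" where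
  "w_pos (sHL u) i1 j1 i2 j2 \<longleftrightarrow> i1 + j1 = i2 + j2 \<and> \<not> (u = 0 \<and> j1 = 0 \<and> j2 = 1)"
| "w_pos (sg_row \<alpha>) i1 j1 i2 j2 \<longleftrightarrow> i1 + j1 = i2 + j2"

fun ws_pos :: "col_spec \<Rightarrow> nat \<Rightarrow> nat \<Rightarrow> nat \<Rightarrow> nat \<Rightarrow> bool" where
  "ws_pos (sqW \<theta>) i1 j1 i2 j2 \<longleftrightarrow> i2 + j1 = i1 + j2 \<and> j1 \<le> i1 \<and> (\<theta> = - s \<longrightarrow> j2 = 0) \<and> (s * \<theta> = - 1 \<longrightarrow> j1 = i1)"
| "ws_pos (sg_col \<beta>) i1 j1 i2 j2 \<longleftrightarrow> i2 + j1 = i1 + j2"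

fun R_pos :: "row_spec \<Rightarrow> col_spec \<Rightarrow> nat \<Rightarrow> nat \<Rightarrow> nat \<Rightarrow> nat \<Rightarrow> bool" where
  "R_pos (sHL u) (sqW \<theta>) i1 j1 i2 j2 \<longleftrightarrow>
     i2 + j1 = i1 + j2 \<and> (i1 = 0 \<and> i2 = 1 \<longrightarrow> u \<noteq> 0 \<and> \<not> (\<theta> = - s \<and> j2 = 1))"
| "R_pos _ _ i1 j1 i2 j2 \<longleftrightarrow> i2 + j1 = i1 + j2"

lemma good_colD:
  assumes "good_col (sqW \<theta>)"
  shows "0 < \<theta>" "- s / \<theta> \<le> 1" "- s / \<theta> = 1 \<longleftrightarrow> \<theta> = - s" "- s * \<theta> \<le> 1"
proof -
  show \<theta>: "0 < \<theta>" using assms s0 by auto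
  show "- s / \<theta> \<le> 1" "- s / \<theta> = 1 \<longleftrightarrow> \<theta> = - s" using assms \<theta> by (auto simp: divide_simps)
  have "- s * \<theta> \<le> - s * (- inverse s)" using assms s0 by (intro mult_left_mono) auto
  then show "- s * \<theta> \<le> 1" using s0 by simp
qed

lemma qp_le1: "a \<le> 1 \<Longrightarrow> 0 \<le> qp q a n \<and> (0 < qp q a n \<longleftrightarrow> a = 1 \<longrightarrow> n = 0)"
  using qp_pos[OF q01, of a n] by (cases "a = 1") (auto simp: qp_one_arg)

lemma w_sign:
  assumes "good_row \<rho>" "sg_r \<rho> \<Longrightarrow> i1 = 0" "j1 \<in> row_occ \<rho>" "j2 \<in> row_occ \<rho>"
  shows "0 \<le> w_spec q s \<rho> i1 j1 i2 j2" "0 < w_spec q s \<rho> i1 j1 i2 j2 \<longleftrightarrow> w_pos \<rho> i1 j1 i2 j2"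
proof -
  have "0 \<le> w_spec q s \<rho> i1 j1 i2 j2 \<and> (0 < w_spec q s \<rho> i1 j1 i2 j2 \<longleftrightarrow> w_pos \<rho> i1 j1 i2 j2)"
  proof (cases "i1 + j1 = i2 + j2")
    case False
    then show ?thesis by (cases \<rho>) (simp_all add: w_spec_nonconserving)
  next
    case cons: True
    show ?thesis
    proof (cases \<rho>)
      case (sg_row \<alpha>)
      then have "j1 = i2 + j2" "i1 = 0" using assms cons by simp_all
      then show ?thesis using sg_row s0 by (simp add: w_spec_sg zero_less_mult_iff zero_less_divide_iff less_imp_le)
    next
      case (sHL u)
      have u: "0 \<le> u" "u < 1" using assms sHL by auto
      have su: "s * u \<le> 0" using u s0 by (simp add: mult_nonpos_nonneg)
      have d: "0 < 1 - s * u" using su by simp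
      have n0: "0 < 1 - s * u * q ^ g" for g using su mult_nonpos_nonneg[OF su, of "q ^ g"] q0 by simp
      have n1: "0 < 1 - q * q ^ g" for g using qq_pos(1)[of "Suc g"] qq_pos(1)[of g] by (simp add: qp_Suc zero_less_mult_iff)
      have n2: "0 < 1 - s\<^sup>2 * q ^ g" for g
      proof -
        have "s\<^sup>2 * q ^ g \<le> s\<^sup>2" using q0 q1 by (intro mult_left_le) (auto intro: power_le_one)
        then show ?thesis using s_sq by linarith
      qed
      have n3: "0 < u - s * q ^ g" for g
      proof -
        have "s * q ^ g < 0" using s0 q0 by (simp add: mult_neg_pos)
        then show ?thesis using u by simp
      qed
      consider "j1 = 0" "j2 = 0" | "j1 = 1" "j2 = 0" | "j1 = 0" "j2 = 1" | "j1 = 1" "j2 = 1"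
        using assms sHL by auto
      then show ?thesis
      proof cases
        case 1
        with cons have i: "i2 = i1" by simp
        have "0 < w_spec q s (sHL u) i1 0 i1 0"
          unfolding w_spec_sHL_eqs(1)[OF u] by (rule divide_pos_pos[OF n0 d])
        then show ?thesis unfolding sHL 1 i by simp
      next
        case 2
        with cons have i: "i2 = Suc i1" by simp
        have "0 < w_spec q s (sHL u) i1 1 (Suc i1) 0"
          unfolding w_spec_sHL_eqs(2)[OF u] by (rule divide_pos_pos[OF n1 d])
        then show ?thesis unfolding sHL 2 i by simp
      next
        case 3
        with cons have i: "i1 = Suc i2" by simp
        have c: "0 < (1 - s\<^sup>2 * q ^ i2) / (1 - s * u)" by (rule divide_pos_pos[OF n2 d])
        have w: "w_spec q s (sHL u) (Suc i2) 0 i2 1 = u * ((1 - s\<^sup>2 * q ^ i2) / (1 - s * u))"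
          unfolding w_spec_sHL_eqs(3)[OF u] by (simp only: times_divide_eq_right)
        have "0 \<le> u * c \<and> (0 < u * c \<longleftrightarrow> u \<noteq> 0)" if "0 < c" for c
          using that u by (auto simp: zero_less_mult_iff)
        from this[OF c] show ?thesis unfolding sHL 3 i w by simp
      next
        case 4
        with cons have i: "i2 = i1" by simp
        have "0 < w_spec q s (sHL u) i1 1 i1 1"
          unfolding w_spec_sHL_eqs(4)[OF u] by (rule divide_pos_pos[OF n3 d])
        then show ?thesis unfolding sHL 4 i by simp
      qed
    qed
  qed
  then show "0 \<le> w_spec q s \<rho> i1 j1 i2 j2" "0 < w_spec q s \<rho> i1 j1 i2 j2 \<longleftrightarrow> w_pos \<rho> i1 j1 i2 j2" by auto
qed

lemma ws_sign:
  assumes "good_col \<rho>'" "sg_c \<rho>' \<Longrightarrow> i2 = 0"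
  shows "0 \<le> wstar_spec q s \<rho>' i1 j1 i2 j2" "0 < wstar_spec q s \<rho>' i1 j1 i2 j2 \<longleftrightarrow> ws_pos \<rho>' i1 j1 i2 j2"
proof -
  have "0 \<le> wstar_spec q s \<rho>' i1 j1 i2 j2 \<and> (0 < wstar_spec q s \<rho>' i1 j1 i2 j2 \<longleftrightarrow> ws_pos \<rho>' i1 j1 i2 j2)"
  proof (cases "i2 + j1 = i1 + j2")
    case False
    then show ?thesis by (cases \<rho>') (simp_all add: wstar_spec_nonconserving)
  next
    case cons: True
    show ?thesis
    proof (cases \<rho>')
      case (sg_col \<beta>)
      then have "j1 = i1 + j2" "i2 = 0" using assms cons by simp_all
      moreover have "0 < qp q (s\<^sup>2) i1" by (rule qp_pos[OF q01 s_sq(1)])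
      ultimately show ?thesis using sg_col s0
        by (simp add: wstar_spec_sg zero_less_mult_iff zero_less_divide_iff less_imp_le)
    next
      case (sqW \<theta>)
      note g = good_colD[OF assms(1)[unfolded sqW]]
      show ?thesis
      proof (cases "j1 \<le> i1")
        case False
        then show ?thesis by (simp add: sqW wstar_sqW_0)
      next
        case True
        define d where "d = i1 - j1"
        have i: "i1 = j1 + d" "i2 = j2 + d" using True cons by (simp_all add: d_def)
        obtain P where P: "P > 0" "wstar_spec q s (sqW \<theta>) i1 j1 i2 j2 = P * (qp q (- s / \<theta>) j2 * qp q (- s * \<theta>) d)"
          unfolding i using wstar_sqW_pos[OF g(1), of j1 d j2] by auto
        have "0 \<le> qp q (- s / \<theta>) j2 \<and> (0 < qp q (- s / \<theta>) j2 \<longleftrightarrow> \<theta> = - s \<longrightarrow> j2 = 0)"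
          using qp_le1[OF g(2), of j2] g(3) by simp
        moreover have "0 \<le> qp q (- s * \<theta>) d \<and> (0 < qp q (- s * \<theta>) d \<longleftrightarrow> s * \<theta> = - 1 \<longrightarrow> d = 0)"
          using qp_le1[OF g(4), of d] by auto
        moreover have "0 \<le> P * (x * y) \<and> (0 < P * (x * y) \<longleftrightarrow> 0 < x \<and> 0 < y)" if "0 \<le> x" "0 \<le> y" for x y
          using that P(1) by (auto simp: zero_less_mult_iff)
        ultimately show ?thesis unfolding sqW P(2) using i True by simp
      qed
    qed
  qed
  then show "0 \<le> wstar_spec q s \<rho>' i1 j1 i2 j2" "0 < wstar_spec q s \<rho>' i1 j1 i2 j2 \<longleftrightarrow> ws_pos \<rho>' i1 j1 i2 j2" by auto
qed

lemma R_sign: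
  assumes g: "good_row \<rho>" "good_col \<rho>'" and occ: "i1 \<in> row_occ \<rho>" "i2 \<in> row_occ \<rho>"
    and sg: "sg_r \<rho> \<Longrightarrow> j2 = 0" "sg_c \<rho>' \<Longrightarrow> i2 = 0"
  shows "0 \<le> R_spec q s \<rho> \<rho>' i1 j1 i2 j2" "0 < R_spec q s \<rho> \<rho>' i1 j1 i2 j2 \<longleftrightarrow> R_pos \<rho> \<rho>' i1 j1 i2 j2"
proof -
  have "0 \<le> R_spec q s \<rho> \<rho>' i1 j1 i2 j2 \<and> (0 < R_spec q s \<rho> \<rho>' i1 j1 i2 j2 \<longleftrightarrow> R_pos \<rho> \<rho>' i1 j1 i2 j2)"
  proof (cases "i2 + j1 = i1 + j2")
    case False
    then show ?thesis by (cases \<rho>; cases \<rho>') (simp_all add: R_spec_nonconserving)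
  next
    case cons: True
    have i20: ?thesis if i2: "i2 = 0"
    proof -
      have j1: "j1 = i1 + j2" using cons i2 by simp
      \<comment> \<open>The bound on the second product can fail only for an sg row; there
        \<open>j2 = 0\<close> and the corresponding \<open>qp\<close> is empty.\<close>
      have uv: "row_u \<rho> * col_v s \<rho>' \<le> 0" "row_uX q \<rho> * col_v s \<rho>' < 1 \<or> j2 = 0"
        using g sg s0 q0 by (cases \<rho>; cases \<rho>'; auto simp: mult_nonneg_nonpos mult_nonpos_nonneg intro: le_less_trans[OF mult_nonneg_nonpos])+
      then have "0 < qp q (row_u \<rho> * col_v s \<rho>') (i1 + j2)" "0 < qp q (row_uX q \<rho> * col_v s \<rho>') j2"
        by (auto intro: qp_pos[OF q01])
      then have "0 < R_spec q s \<rho> \<rho>' i1 j1 i2 j2"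
        unfolding j1 i2 using uv(1) by (subst R_spec_0[OF g(2)]) auto
      moreover have "R_pos \<rho> \<rho>' i1 j1 i2 j2" using j1 i2 by (cases \<rho>; cases \<rho>') auto
      ultimately show ?thesis by simp
    qed
    show ?thesis
    proof (cases \<rho>')
      case (sg_col \<beta>)
      then show ?thesis using i20 sg by simp
    next
      case (sqW \<theta>)
      note \<theta> = good_colD[OF g(2)[unfolded sqW]]
      show ?thesis
      proof (cases \<rho>)
        case (sg_row \<alpha>)
        then have "j2 = 0" "i1 = i2 + j1" using sg cons by simp_all
        then show ?thesis using sqW sg_row R_spec_j2_0[OF g(2)[unfolded sqW], of \<alpha> i2 j1] by (simp add: less_imp_le)
      next
        case (sHL u)
        have u: "0 \<le> u" "u < 1" using g sHL by auto
        have d: "0 < 1 - u * s" using u s0 by (smt (verit) mult_nonneg_nonpos)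
        consider "i2 = 0" | "i1 = 0" "i2 = 1" | "i1 = 1" "i2 = 1" using occ sHL by auto
        then show ?thesis
        proof cases
          case 1
          then show ?thesis using i20 by simp
        next
          case 2
          then have j2: "j2 = Suc j1" using cons by simp
          have n: "0 \<le> s * q ^ j1 + \<theta> \<and> (0 < s * q ^ j1 + \<theta> \<longleftrightarrow> \<not> (\<theta> = - s \<and> j1 = 0))"
          proof -
            have "- s \<le> \<theta>" using g sqW by simp
            moreover have "s \<le> s * q ^ j1" using s0 q0 q1 power_le_one[of q j1] by (simp add: mult_le_cancel_left)
            moreover have "s < s * q ^ j1" if "j1 \<noteq> 0"
            proof -
              have "q ^ j1 < 1" using that q0 q1 by (simp add: power_less_one_iff)
              then show ?thesis using s0 by (simp add: mult_less_cancel_left)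
            qed
            ultimately show ?thesis by (cases "j1 = 0") auto
          qed
          show ?thesis using 2 j2 sqW sHL R_spec_01[OF u, of \<theta> j1] n d u
            by (auto simp: zero_less_mult_iff zero_le_mult_iff zero_le_divide_iff zero_less_divide_iff)
        next
          case 3
          then have j2: "j2 = j1" using cons by simp
          have "0 < q ^ j1 + u * \<theta>" using u \<theta>(1) q0 by (simp add: add_pos_nonneg)
          then show ?thesis using 3 j2 sqW sHL R_spec_11[OF u, of \<theta> j1] d
            by (simp add: less_imp_le)
        qed
      qed
    qed
  qed
  then show "0 \<le> R_spec q s \<rho> \<rho>' i1 j1 i2 j2" "0 < R_spec q s \<rho> \<rho>' i1 j1 i2 j2 \<longleftrightarrow> R_pos \<rho> \<rho>' i1 j1 i2 j2" by auto
qed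

text \<open>The boundary data that occur in the field: along the bottom row \<open>\<mu>\<close> and \<open>\<kappa>\<close> are empty, along
  the left column \<open>\<Lambda>\<close> and \<open>\<kappa>\<close> are.\<close>

definition adm :: "row_spec \<Rightarrow> col_spec \<Rightarrow> ybdata \<Rightarrow> bool" where
  "adm \<rho> \<rho>' = (\<lambda>(a, a', m, b, b', l). a \<in> row_occ \<rho> \<and> b' \<in> row_occ \<rho> \<and>
     (sg_r \<rho> \<longrightarrow> m = 0 \<and> b = 0) \<and> (sg_c \<rho>' \<longrightarrow> l = 0 \<and> b' = 0))"

lemma yb_left_sign:
  assumes g: "good_row \<rho>" "good_col \<rho>'" and c: "c = (a, a', m, b, b', l)" "adm \<rho> \<rho>' c"
  shows "0 \<le> yb_left q s \<rho> \<rho>' c (k, p, p')"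
    and "0 < yb_left q s \<rho> \<rho>' c (k, p, p') \<longleftrightarrow> p' \<in> row_occ \<rho> \<and>
      R_pos \<rho> \<rho>' a a' p' p \<and> ws_pos \<rho>' m p k b \<and> w_pos \<rho> k p' l b'"
proof -
  have "0 \<le> yb_left q s \<rho> \<rho>' c (k, p, p') \<and> (0 < yb_left q s \<rho> \<rho>' c (k, p, p') \<longleftrightarrow> p' \<in> row_occ \<rho> \<and>
      R_pos \<rho> \<rho>' a a' p' p \<and> ws_pos \<rho>' m p k b \<and> w_pos \<rho> k p' l b')"
  proof (cases "p' \<in> row_occ \<rho> \<and> k + p = m + b \<and> k + p' = l + b'")
    case False
    have "ws_pos \<rho>' m p k b \<Longrightarrow> k + p = m + b" by (cases \<rho>') auto
    moreover have "w_pos \<rho> k p' l b' \<Longrightarrow> k + p' = l + b'" by (cases \<rho>) auto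
    ultimately show ?thesis using False
      by (auto simp: yb_left_def c w_spec_nonconserving wstar_spec_nonconserving)
  next
    case True
    \<comment> \<open>In an sg row m = b = 0, so conservation forces k = p = 0; for an sg column l =
      b' = 0 forces k = p' = 0. These are the side conditions under which the signs are
      known.\<close>
    have *: "sg_r \<rho> \<Longrightarrow> k = 0" "sg_c \<rho>' \<Longrightarrow> k = 0" "sg_r \<rho> \<Longrightarrow> p = 0" "sg_c \<rho>' \<Longrightarrow> p' = 0"
      using True c by (auto simp: adm_def)
    have occ: "a \<in> row_occ \<rho>" "b' \<in> row_occ \<rho>" "p' \<in> row_occ \<rho>" using True c by (auto simp: adm_def)
    show ?thesis
      using R_sign[OF g occ(1,3) *(3,4), of a'] ws_sign[OF g(2) *(2), of m p b] w_sign[OF g(1) *(1) occ(3,2), of l] True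
      by (auto simp: yb_left_def c zero_less_mult_iff)
  qed
  then show "0 \<le> yb_left q s \<rho> \<rho>' c (k, p, p')"
    "0 < yb_left q s \<rho> \<rho>' c (k, p, p') \<longleftrightarrow> p' \<in> row_occ \<rho> \<and>
      R_pos \<rho> \<rho>' a a' p' p \<and> ws_pos \<rho>' m p k b \<and> w_pos \<rho> k p' l b'" by blast+
qed

lemma yb_right_sign:
  assumes g: "good_row \<rho>" "good_col \<rho>'" and c: "c = (a, a', m, b, b', l)" "adm \<rho> \<rho>' c"
  shows "0 \<le> yb_right q s \<rho> \<rho>' c (n, t, t')"
    and "0 < yb_right q s \<rho> \<rho>' c (n, t, t') \<longleftrightarrow> t \<in> row_occ \<rho> \<and>
      R_pos \<rho> \<rho>' t t' b' b \<and> ws_pos \<rho>' n a' l t' \<and> w_pos \<rho> m a n t"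
proof -
  have *: "sg_r \<rho> \<Longrightarrow> m = 0" "sg_c \<rho>' \<Longrightarrow> l = 0" "sg_r \<rho> \<Longrightarrow> b = 0" "sg_c \<rho>' \<Longrightarrow> b' = 0"
    and occ: "a \<in> row_occ \<rho>" "b' \<in> row_occ \<rho>" using c by (auto simp: adm_def)
  have "0 \<le> yb_right q s \<rho> \<rho>' c (n, t, t') \<and> (0 < yb_right q s \<rho> \<rho>' c (n, t, t') \<longleftrightarrow> t \<in> row_occ \<rho> \<and>
      R_pos \<rho> \<rho>' t t' b' b \<and> ws_pos \<rho>' n a' l t' \<and> w_pos \<rho> m a n t)"
  proof (cases "t \<in> row_occ \<rho>")
    case True
    show ?thesis
      using R_sign[OF g True occ(2) *(3,4), of t'] ws_sign[OF g(2) *(2), of n a' t'] w_sign[OF g(1) *(1) occ(1) True, of n] True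
      by (auto simp: yb_right_def c zero_less_mult_iff)
  qed (auto simp: yb_right_def c)
  then show "0 \<le> yb_right q s \<rho> \<rho>' c (n, t, t')"
    "0 < yb_right q s \<rho> \<rho>' c (n, t, t') \<longleftrightarrow> t \<in> row_occ \<rho> \<and>
      R_pos \<rho> \<rho>' t t' b' b \<and> ws_pos \<rho>' n a' l t' \<and> w_pos \<rho> m a n t" by blast+
qed

text \<open>B, D and U stand for \<open>\<theta> = - s\<close>, \<open>s * \<theta> = - 1\<close>
  and \<open>u = 0\<close>. Conservation determines n and t' from t, so only the bit t has to be
  chosen. Normally t = b' if p' = b', and t = p' + 1 modulo 2 otherwise, which in all these cases
  gives t' = b; when this violates \<open>t' \<le> l\<close> or the condition imposed by D, the
  other bit gives t' = l.\<close>

lemma yb_exchange: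
  fixes a a' m b b' l k p p' :: nat and B D U :: bool
  assumes "\<not> (B \<and> D)" "a = 0 \<or> a = 1" "b' = 0 \<or> b' = 1" "p' = 0 \<or> p' = 1" "p' + a' = a + p"
    "a = 0 \<and> p' = 1 \<longrightarrow> \<not> U \<and> \<not> (B \<and> p = 1)" "k + p = m + b" "b \<le> k" "B \<longrightarrow> b = 0" "D \<longrightarrow> p = m"
    "k + p' = l + b'" "p' = 0 \<and> b' = 1 \<longrightarrow> \<not> U"
  shows "\<exists>n t t'. (t = 0 \<or> t = 1) \<and> b' + t' = t + b \<and> t' \<le> l \<and> n + t = m + a \<and> l + a' = n + t' \<and>
    (b' = 1 \<and> t = 0 \<longrightarrow> \<not> U \<and> \<not> (B \<and> b = 1)) \<and> (B \<longrightarrow> t' = 0) \<and> (D \<longrightarrow> l = t') \<and> (a = 0 \<and> t = 1 \<longrightarrow> \<not> U)"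
    (is "\<exists>n t t'. ?S n t t'")
proof -
  have "b \<le> l \<or> b = Suc l" if "p' = 0" "b' = 1"
  proof -
    have "b \<le> Suc l" using assms(8,11) that by linarith
    then show ?thesis by (simp only: le_Suc_eq)
  qed
  then consider "p' = b'" | "p' = 0" "b' = 1" "b \<le> l" "\<not> D" | "p' = 0" "b' = 1" "b = Suc l \<or> D"
    | "p' = 1" "b' = 0" "\<not> D" | "p' = 1" "b' = 0" "D"
    using assms(3,4) by blast
  moreover have pm: "p \<le> m" and pa: "p' \<le> a + p" using assms(5,7,8) by linarith+
  ultimately show ?thesis
  proof cases
    case 1
    have "k = l" using 1 assms(11) by linarith
    moreover have "b' \<le> m + a" using 1 pm pa by linarith
    ultimately have "m + a - b' + b' = m + a" "l + a' = m + a - b' + b" "b \<le> l" "D \<longrightarrow> l = b"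
      using 1 assms(5,7,8,10) by linarith+
    then have "?S (m + a - b') b' b" using assms(3,6,9) 1 zero_neq_one[where 'a = nat] by metis
    then show ?thesis by blast
  next
    case 2
    have "1 \<le> m + a" using 2 assms(7,11) by linarith
    then have "m + a - 1 + 1 = m + a" "l + a' = m + a - 1 + b" "b' + b = 1 + b"
      using 2 assms(5,7,11) by linarith+
    then have "?S (m + a - 1) 1 b" using assms(9,12) 2 zero_neq_one[where 'a = nat] by metis
    then show ?thesis by blast
  next
    case 3
    have "b = Suc l" using 3 assms(7,10,11) by linarith
    then have "b' + l = 0 + b" "l + a' = m + a + l" "m + a + 0 = m + a" "l \<le> l" "b \<noteq> 0"
      using 3 assms(5,7,11) by linarith+
    then have "?S (m + a) 0 l" using assms(9,12) 3 zero_neq_one[where 'a = nat] by metis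
    then show ?thesis by blast
  next
    case 4
    have "b \<le> l" "l + a' = m + a + b" "m + a + 0 = m + a" "b' + b = 0 + b"
      using 4 assms(5,7,8,11) by linarith+
    then have "?S (m + a) 0 b" using assms(9) 4 zero_neq_one[where 'a = nat] by metis
    then show ?thesis by blast
  next
    case 5
    \<comment> \<open>D forces k = b, hence l = b + 1. The choice t' = l is then positive, which is
      compatible with the condition from B because B and D exclude each other.\<close>
    have "p = m" using 5 assms(10) by blast
    then have "m + a - 1 + 1 = m + a" "l + a' = m + a - 1 + l" "b' + l = 1 + b" "l \<le> l"
      using 5 assms(5,7,11) by linarith+
    then have "?S (m + a - 1) 1 l" using assms(1,6) 5 zero_neq_one[where 'a = nat] by metis
    then show ?thesis by blast
  qed
qed

text \<open>The two values are the end points -s and -1/s of the admissible interval, which differ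
  because \<open>s\<^sup>2 < 1\<close>.\<close>

lemma \<theta>_ne: "\<not> (\<theta> = - s \<and> s * \<theta> = - 1)"
proof
  assume "\<theta> = - s \<and> s * \<theta> = - 1"
  then have "s * - s = - 1" by metis
  then have "s\<^sup>2 = 1" by (simp add: power2_eq_square)
  then show False using s_sq by simp
qed

text \<open>This replaces the Yang--Baxter equation: only the positivity of both of its sides is needed.\<close>

lemma yb_right_exists:
  assumes g: "good_row \<rho>" "good_col \<rho>'" and c: "c = (a, a', m, b, b', l)" "adm \<rho> \<rho>' c"
    and left: "0 < yb_left q s \<rho> \<rho>' c (k, p, p')"
  shows "\<exists>\<tau>'. 0 < yb_right q s \<rho> \<rho>' c \<tau>'"
proof -
  have L: "p' \<in> row_occ \<rho>" "R_pos \<rho> \<rho>' a a' p' p" "ws_pos \<rho>' m p k b" "w_pos \<rho> k p' l b'"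
    using left yb_left_sign(2)[OF g c] by auto
  have A: "a \<in> row_occ \<rho>" "b' \<in> row_occ \<rho>" "sg_r \<rho> \<Longrightarrow> m = 0 \<and> b = 0" "sg_c \<rho>' \<Longrightarrow> l = 0 \<and> b' = 0"
    using c by (auto simp: adm_def)
  have "\<exists>n t t'. t \<in> row_occ \<rho> \<and> R_pos \<rho> \<rho>' t t' b' b \<and> ws_pos \<rho>' n a' l t' \<and> w_pos \<rho> m a n t"
  proof (cases \<rho>)
    case \<rho>: (sg_row \<alpha>)
    have mb: "m = 0" "b = 0" using A(3) \<rho> by simp_all
    have cons: "p' + a' = a + p" "k + p = m + b" "k + p' = l + b'"
      using L \<rho> by (cases \<rho>'; simp)+
    have a: "a = a' + l + b'" using cons mb by simp
    \<comment> \<open>With m = b = 0 the right-hand triples form a family with free parameter t':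
      conservation gives t = b' + t' and n = a' + l - t'.\<close>
    have sol: ?thesis if "ws_pos \<rho>' n a' l t'" "n + t' = a' + l" for n t'
    proof (intro exI conjI)
      show "ws_pos \<rho>' n a' l t'" by (rule that(1))
      show "b' + t' \<in> row_occ \<rho>" using \<rho> by simp
      show "R_pos \<rho> \<rho>' (b' + t') t' b' b" using \<rho> mb by (cases \<rho>') simp_all
      show "w_pos \<rho> m a n (b' + t')" unfolding \<rho> w_pos.simps using that(2) mb a by linarith
    qed
    show ?thesis
    proof (cases \<rho>')
      case (sg_col \<beta>)
      then have "ws_pos \<rho>' (a' + l) a' l 0" by simp
      then show ?thesis by (rule sol) simp
    next
      case (sqW \<theta>)
      show ?thesis
      \<comment> \<open>The end \<open>\<theta> = - s\<close> requires t' = 0 and the end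
        \<open>s * \<theta> = - 1\<close> requires n = a', that is t' = l. Hence t' = 0 is chosen at
        the former and t' = l everywhere else.\<close>
      proof (cases "\<theta> = - s")
        case False
        have "ws_pos \<rho>' a' a' l l" unfolding sqW ws_pos.simps using False by simp
        then show ?thesis by (rule sol) simp
      next
        case True
        then have "ws_pos \<rho>' (a' + l) a' l 0" unfolding sqW ws_pos.simps using \<theta>_ne[of \<theta>] by auto
        then show ?thesis by (rule sol) simp
      qed
    qed
  next
    case \<rho>: (sHL u)
    show ?thesis
    proof (cases \<rho>')
      case (sg_col \<beta>)
      have "R_pos \<rho> \<rho>' 0 b 0 b" "ws_pos \<rho>' (m + a) a' 0 b" "w_pos \<rho> m a (m + a) 0"
        using L A \<rho> sg_col by auto
      then show ?thesis using A \<rho> sg_col by (intro exI[of _ "m + a"] exI[of _ 0] exI[of _ b]) auto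
    next
      case (sqW \<theta>)
      have a: "a = 0 \<or> a = 1" and b': "b' = 0 \<or> b' = 1" and p': "p' = 0 \<or> p' = 1" using A L \<rho> by auto
      have R: "p' + a' = a + p" "a = 0 \<and> p' = 1 \<longrightarrow> \<not> u = 0 \<and> \<not> (\<theta> = - s \<and> p = 1)"
        using L(2) unfolding \<rho> sqW R_pos.simps by blast+
      have W: "k + p = m + b" "p \<le> m" "\<theta> = - s \<longrightarrow> b = 0" "s * \<theta> = - 1 \<longrightarrow> p = m"
        using L(3) unfolding sqW ws_pos.simps by blast+
      have w: "k + p' = l + b'" "p' = 0 \<and> b' = 1 \<longrightarrow> \<not> u = 0"
        using L(4) unfolding \<rho> w_pos.simps by blast+
      have bk: "b \<le> k" using W(1,2) by linarith
      obtain n t t' where nt: "t = 0 \<or> t = 1" "b' + t' = t + b" "t' \<le> l" "n + t = m + a" "l + a' = n + t'"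
        "b' = 1 \<and> t = 0 \<longrightarrow> \<not> u = 0 \<and> \<not> (\<theta> = - s \<and> b = 1)" "\<theta> = - s \<longrightarrow> t' = 0" "s * \<theta> = - 1 \<longrightarrow> l = t'"
        "a = 0 \<and> t = 1 \<longrightarrow> \<not> u = 0"
        using yb_exchange[OF \<theta>_ne a b' p' R W(1) bk W(3,4) w] by (elim exE conjE) rule
      have "R_pos \<rho> \<rho>' t t' b' b" using nt(2,6) \<rho> sqW by simp
      moreover have "ws_pos \<rho>' n a' l t'"
      proof -
        have "a' \<le> n" using nt(3,5) by linarith
        moreover have "a' = n" if "s * \<theta> = - 1" using nt(5) nt(8)[rule_format, OF that] by linarith
        ultimately show ?thesis unfolding sqW ws_pos.simps using nt(5,7) by blast
      qed
      moreover have "w_pos \<rho> m a n t" unfolding \<rho> w_pos.simps using nt(4,9) by metis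
      moreover have "t \<in> row_occ \<rho>" using nt(1) \<rho> by auto
      ultimately show ?thesis by blast
    qed
  qed
  then show ?thesis using yb_right_sign(2)[OF g c] by blast
qed

lemma infsum_pos_finite:
  fixes f :: "'x \<Rightarrow> real"
  assumes "finite S" "\<And>x. f x \<noteq> 0 \<Longrightarrow> x \<in> S" "\<And>x. 0 \<le> f x" "0 < f x0"
  shows "0 < infsum f UNIV"
proof -
  have "infsum f UNIV = infsum f S" by (rule infsum_cong_neutral) (use assms in auto)
  also have "\<dots> = sum f S" using assms by simp
  also have "0 < sum f S" using assms by (intro sum_pos2[of S x0]) auto
  finally show ?thesis .
qed

text \<open>The given left term and \<open>yb_right_exists\<close> make both sums positive, so the
  marginals of the coupling are prescribed at c. A pair of positive coupling mass then has its
  second entry in the support of the right-hand side.\<close>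

lemma yb_step:
  assumes g: "good_row \<rho>" "good_col \<rho>'" and c: "c = (a, a', m, b, b', l)" "adm \<rho> \<rho>' c"
    and C: "yb_coupling q s \<rho> \<rho>' C"
    and left: "0 < yb_left q s \<rho> \<rho>' c \<tau>" and fw: "yb_forward C c \<tau> \<tau>' \<noteq> 0"
  shows "0 < yb_right q s \<rho> \<rho>' c \<tau>'"
proof -
  obtain k p p' where \<tau>: "\<tau> = (k, p, p')" by (metis prod_cases3)
  have SL: "0 < infsum (yb_left q s \<rho> \<rho>' c) UNIV"
  proof (rule infsum_pos_finite[where S = "{..m + b} \<times> {..m + b} \<times> {..l + b'}"])
    show "x \<in> {..m + b} \<times> {..m + b} \<times> {..l + b'}" if "yb_left q s \<rho> \<rho>' c x \<noteq> 0" for x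
    proof -
      obtain k p p' where x: "x = (k, p, p')" by (metis prod_cases3)
      have "k + p = m + b" "k + p' = l + b'"
        using that wstar_spec_nonconserving[of k p m b \<rho>'] w_spec_nonconserving[of k p' l b' \<rho>]
        by (auto simp: x c yb_left_def split: if_splits)
      then show ?thesis by (auto simp: x)
    qed
    show "0 \<le> yb_left q s \<rho> \<rho>' c x" for x using yb_left_sign(1)[OF g c] by (cases x) auto
  qed (use left in auto)
  obtain \<tau>0 where "0 < yb_right q s \<rho> \<rho>' c \<tau>0" using yb_right_exists[OF g c left[unfolded \<tau>]] by blast
  then have SR: "0 < infsum (yb_right q s \<rho> \<rho>' c) UNIV"
  proof (rule infsum_pos_finite[where S = "{..m + a} \<times> {..m + a} \<times> {..l + a'}", rotated 3])
    show "x \<in> {..m + a} \<times> {..m + a} \<times> {..l + a'}" if "yb_right q s \<rho> \<rho>' c x \<noteq> 0" for x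
    proof -
      obtain n t t' where x: "x = (n, t, t')" by (metis prod_cases3)
      have "m + a = n + t" "l + a' = n + t'"
        using that wstar_spec_nonconserving[of l a' n t' \<rho>'] w_spec_nonconserving[of m a n t \<rho>]
        by (auto simp: x c yb_right_def split: if_splits)
      then show ?thesis by (auto simp: x)
    qed
    show "0 \<le> yb_right q s \<rho> \<rho>' c x" for x using yb_right_sign(1)[OF g c] by (cases x) auto
  qed auto
  have "a \<in> row_occ \<rho>" "b' \<in> row_occ \<rho>" using c by (auto simp: adm_def)
  then have right: "pmf (map_pmf snd (C c)) \<tau>' = yb_right q s \<rho> \<rho>' c \<tau>' / infsum (yb_right q s \<rho> \<rho>' c) UNIV"
    using C SL SR unfolding yb_coupling_def c(1) Let_def by blast
  have "pmf (C c) (\<tau>, \<tau>') \<noteq> 0" using fw by (auto simp: yb_forward_def)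
  then have "(\<tau>, \<tau>') \<in> set_pmf (C c)" by (simp add: set_pmf_iff)
  then have "\<tau>' \<in> set_pmf (map_pmf snd (C c))" by force
  then have "0 < pmf (map_pmf snd (C c)) \<tau>'" by (simp add: pmf_positive)
  then show ?thesis using right SR by (simp add: zero_less_divide_iff)
qed

lemma b_row_neq_0_occ: "b_row q \<rho> j \<noteq> 0 \<Longrightarrow> j \<in> row_occ \<rho>"
  by (cases \<rho>) (auto simp: b_row_sHL split: if_splits)

section \<open>Conservation along one forward transition\<close>

lemma tail_step: "1 \<le> h \<Longrightarrow> tail \<mu> (h - 1) = tail \<mu> h + count \<mu> h"
proof -
  assume h: "1 \<le> h"
  have "{#r \<in># \<mu>. h - 1 < r#} = {#r \<in># \<mu>. h < r#} + {#r \<in># \<mu>. r = h#}"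
    using h by (intro multiset_eqI) auto
  then show ?thesis by (simp add: tail_def filter_eq_replicate_mset)
qed

lemma tail_eventually_0: "\<forall>\<^sub>F h in sequentially. tail \<mu> h = 0"
proof -
  have "tail \<mu> h = 0" if "Max (insert 0 (set_mset \<mu>)) \<le> h" for h
  proof -
    have "r \<le> h" if "r \<in># \<mu>" for r using that \<open>Max _ \<le> h\<close> by (meson Max_ge finite_insert finite_set_mset insertCI order.trans)
    then show ?thesis by (fastforce simp: tail_def)
  qed
  then show ?thesis unfolding eventually_sequentially by blast
qed

lemma tail_empty [simp]: "tail {#} h = 0"
  by (simp add: tail_def)

lemma tail_0: "0 \<notin># \<mu> \<Longrightarrow> tail \<mu> 0 = size \<mu>"
proof -
  assume "0 \<notin># \<mu>"
  then have "{#r \<in># \<mu>. 0 < r#} = \<mu>" by (intro filter_mset_eq_conv[THEN iffD2]) (auto intro: ccontr)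
  then show ?thesis by (simp add: tail_def)
qed

text \<open>The difference \<open>tail \<nu> h - tail \<mu> h - j h\<close>, taken in the integers,
  does not change with h. It is 0 for large h, since the diagrams are finite and j is eventually
  0.\<close>

lemma tail_conserved:
  assumes cons: "\<And>h. 1 \<le> h \<Longrightarrow> count \<mu> h + j (h - 1) = count \<nu> h + j h"
    and ev: "\<forall>\<^sub>F h in sequentially. j h = 0"
  shows "tail \<nu> h = tail \<mu> h + j h"
proof -
  have eq: "int (tail \<nu> h) - int (tail \<mu> h) - int (j h) = int (tail \<nu> (h + n)) - int (tail \<mu> (h + n)) - int (j (h + n))" for n
  proof (induction n)
    case (Suc n)
    show ?case unfolding Suc using cons[of "Suc (h + n)"] tail_step[of "Suc (h + n)" \<nu>] tail_step[of "Suc (h + n)" \<mu>]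
      by simp
  qed simp
  have "\<forall>\<^sub>F k in sequentially. tail \<nu> k = 0 \<and> tail \<mu> k = 0 \<and> j k = 0"
    using tail_eventually_0[of \<nu>] tail_eventually_0[of \<mu>] ev by eventually_elim auto
  then obtain K where "\<And>k. K \<le> k \<Longrightarrow> tail \<nu> k = 0 \<and> tail \<mu> k = 0 \<and> j k = 0"
    by (auto simp: eventually_sequentially)
  then show ?thesis using eq[of K] by simp
qed

text \<open>The invariant handed to the right neighbour, where \<mu>, \<nu> and j take the roles of
  \<kappa>, \<Lambda> and i'; \<open>col_ok\<close> is handed upwards in the same way. The last
  clause keeps the denominators of the neighbour's initial probability away from 0.\<close>

definition row_ok :: "row_spec \<Rightarrow> nat multiset \<Rightarrow> nat multiset \<Rightarrow> (nat \<Rightarrow> nat) \<Rightarrow> bool" where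
  "row_ok \<rho> \<mu> \<nu> j \<longleftrightarrow> (\<forall>h. j h \<in> row_occ \<rho> \<and> tail \<nu> h = tail \<mu> h + j h) \<and>
     (\<forall>h\<ge>1. w_pos \<rho> (count \<mu> h) (j (h - 1)) (count \<nu> h) (j h)) \<and> b_row q \<rho> (j 0) \<noteq> 0"

definition col_ok :: "col_spec \<Rightarrow> nat multiset \<Rightarrow> nat multiset \<Rightarrow> (nat \<Rightarrow> nat) \<Rightarrow> bool" where
  "col_ok \<rho>' \<Lambda> \<nu> j \<longleftrightarrow> (\<forall>h. tail \<nu> h = tail \<Lambda> h + j h) \<and>
     (\<forall>h\<ge>1. ws_pos \<rho>' (count \<nu> h) (j (h - 1)) (count \<Lambda> h) (j h)) \<and> b_col q s \<rho>' (j 0) \<noteq> 0"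

lemma row_ok_empty: "row_ok \<rho> {#} {#} (\<lambda>_. 0)"
  by (cases \<rho>) (auto simp: row_ok_def b_row_sHL b_row_sg)

lemma col_ok_empty: "col_ok \<rho>' {#} {#} (\<lambda>_. 0)"
  by (cases \<rho>') (auto simp: col_ok_def b_col_sqW b_col_sg)

text \<open>Induction on h with the invariant
  \<open>R_pos \<rho> \<rho>' (j h) (j' h) (i' h) (i h)\<close>. A nonzero initial probability
  starts it; together with the supports from \<open>ok\<close> it makes the left term of the next
  step positive, and membership in the right support returns it for that step along with the
  conservation laws.\<close>

lemma forward_ok:
  assumes g: "good_row \<rho>" "good_col \<rho>'" and C: "yb_coupling q s \<rho> \<rho>' C"
    and sg: "sg_r \<rho> \<Longrightarrow> \<mu> = {#}" "sg_c \<rho>' \<Longrightarrow> \<Lambda> = {#}"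
    and ok: "row_ok \<rho> \<kappa> \<Lambda> i'" "col_ok \<rho>' \<kappa> \<mu> i"
    and init: "initial_prob q s \<rho> \<rho>' (\<kappa>, \<mu>, \<Lambda>) (j 0, j' 0) \<noteq> 0"
    and step: "\<And>h. 1 \<le> h \<Longrightarrow> step_prob C h ((\<kappa>, \<mu>, \<Lambda>), (j (h - 1), j' (h - 1))) (count \<nu> h, j h, j' h) \<noteq> 0"
    and ev: "\<forall>\<^sub>F h in sequentially. j h = 0 \<and> j' h = 0"
  shows "row_ok \<rho> \<mu> \<nu> j" "col_ok \<rho>' \<Lambda> \<nu> j'"
proof -
  have i: "tail \<mu> h - tail \<kappa> h = i h" "tail \<Lambda> h - tail \<kappa> h = i' h" for h
    using ok by (simp_all add: row_ok_def col_ok_def)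
  have i'occ: "i' h \<in> row_occ \<rho>" for h using ok by (simp add: row_ok_def)
  have sgi: "sg_r \<rho> \<Longrightarrow> i h = 0" "sg_c \<rho>' \<Longrightarrow> i' h = 0" for h
    using sg i[of h] by auto
  have bs: "b_row q \<rho> (j 0) \<noteq> 0" "b_col q s \<rho>' (j' 0) \<noteq> 0" and R0: "R_spec q s \<rho> \<rho>' (j 0) (j' 0) (i' 0) (i 0) \<noteq> 0"
    using init by (auto simp: initial_prob_def Let_def i)
    have st: "ws_pos \<rho>' (count \<nu> h) (j' (h - 1)) (count \<Lambda> h) (j' h) \<and> w_pos \<rho> (count \<mu> h) (j (h - 1)) (count \<nu> h) (j h)
       \<and> j h \<in> row_occ \<rho> \<and> R_pos \<rho> \<rho>' (j h) (j' h) (i' h) (i h)"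
      if h: "1 \<le> h" and prev: "j (h - 1) \<in> row_occ \<rho> \<and> R_pos \<rho> \<rho>' (j (h - 1)) (j' (h - 1)) (i' (h - 1)) (i (h - 1))" for h
    proof -
      define c where "c = (j (h - 1), j' (h - 1), count \<mu> h, i h, i' h, count \<Lambda> h)"
      have adm: "adm \<rho> \<rho>' c" unfolding adm_def c_def using prev i'occ sgi[of h] sg by auto
      have "0 < yb_left q s \<rho> \<rho>' c (count \<kappa> h, i (h - 1), i' (h - 1))"
        unfolding yb_left_sign(2)[OF g c_def adm] using ok h prev i'occ by (auto simp: row_ok_def col_ok_def)
      moreover have "yb_forward C c (count \<kappa> h, i (h - 1), i' (h - 1)) (count \<nu> h, j h, j' h) \<noteq> 0"
        using step[OF h] by (simp add: step_prob_def c_def i)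
      ultimately have "0 < yb_right q s \<rho> \<rho>' c (count \<nu> h, j h, j' h)" by (rule yb_step[OF g c_def adm C])
      then show ?thesis unfolding yb_right_sign(2)[OF g c_def adm] by blast
    qed
    have inv: "j h \<in> row_occ \<rho> \<and> R_pos \<rho> \<rho>' (j h) (j' h) (i' h) (i h)" for h
    proof (induction h)
      case 0
      have "j 0 \<in> row_occ \<rho>" using bs(1) by (rule b_row_neq_0_occ)
      moreover from this have "R_pos \<rho> \<rho>' (j 0) (j' 0) (i' 0) (i 0)"
        using R_sign[OF g _ i'occ[of 0] sgi(1)[of 0] sgi(2)[of 0], of "j 0" "j' 0"] R0 by linarith
      ultimately show ?case by simp
    next
      case (Suc h)
      then show ?case using st[of "Suc h"] by simp
    qed
  have wc: "w_pos \<rho> i1 j1 i2 j2 \<Longrightarrow> i1 + j1 = i2 + j2" for i1 j1 i2 j2 by (cases \<rho>) auto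
  have wsc: "ws_pos \<rho>' i1 j1 i2 j2 \<Longrightarrow> i2 + j1 = i1 + j2" for i1 j1 i2 j2 by (cases \<rho>') auto
  have "tail \<nu> h = tail \<mu> h + j h" for h
    by (rule tail_conserved) (use wc st[OF _ inv] ev in \<open>auto elim: eventually_mono\<close>)
  then show "row_ok \<rho> \<mu> \<nu> j" using inv st[OF _ inv] bs by (simp add: row_ok_def)
  have "tail \<nu> h = tail \<Lambda> h + j' h" for h
    by (rule tail_conserved) (use wsc st[OF _ inv] ev in \<open>auto elim: eventually_mono\<close>)
  then show "col_ok \<rho>' \<Lambda> \<nu> j'" using st[OF _ inv] bs by (simp add: col_ok_def)
qed

text \<open>A pathwise statement for one fixed outcome off a null set: induction over antidiagonals,
  each vertex receiving i' from its left and i from its lower neighbour.\<close>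

lemma field_ok:
  fixes E :: "nat \<Rightarrow> nat \<Rightarrow> 'w \<Rightarrow> nat multiset"
  assumes g: "\<And>y. good_row (\<rho> y)" "\<And>x. good_col (\<rho>' x)" and C: "\<And>x y. yb_coupling q s (\<rho> y) (\<rho>' x) (C (\<rho> y) (\<rho>' x))"
    and sg: "\<And>y. sg_r (\<rho> y) \<Longrightarrow> y = 0" "\<And>x. sg_c (\<rho>' x) \<Longrightarrow> x = 0"
    and init: "\<And>x y. initial_prob q s (\<rho> y) (\<rho>' x) (field_input E x y \<omega>) (J x y 0 \<omega>, J' x y 0 \<omega>) \<noteq> 0"
    and step: "\<And>x y h. 1 \<le> h \<Longrightarrow> step_prob (C (\<rho> y) (\<rho>' x)) h (field_input E x y \<omega>, (J x y (h - 1) \<omega>, J' x y (h - 1) \<omega>))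
       (field_data E J J' x y h \<omega>) \<noteq> 0"
    and ev: "\<And>x y. \<forall>\<^sub>F h in sequentially. J x y h \<omega> = 0 \<and> J' x y h \<omega> = 0"
  shows "row_ok (\<rho> y) (if y = 0 then {#} else E x (y - 1) \<omega>) (E x y \<omega>) (\<lambda>h. J x y h \<omega>) \<and>
    col_ok (\<rho>' x) (if x = 0 then {#} else E (x - 1) y \<omega>) (E x y \<omega>) (\<lambda>h. J' x y h \<omega>)"
proof (induction "x + y" arbitrary: x y rule: less_induct)
  case less
  define \<kappa> where "\<kappa> = (if x = 0 \<or> y = 0 then {#} else E (x - 1) (y - 1) \<omega>)"
  define \<mu> where "\<mu> = (if y = 0 then {#} else E x (y - 1) \<omega>)"
  define \<Lambda> where "\<Lambda> = (if x = 0 then {#} else E (x - 1) y \<omega>)"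
  have inp: "field_input E x y \<omega> = (\<kappa>, \<mu>, \<Lambda>)" by (simp add: field_input_def \<kappa>_def \<mu>_def \<Lambda>_def)
  have "\<exists>i'. row_ok (\<rho> y) \<kappa> \<Lambda> i'"
  proof (cases "x = 0")
    case True
    then show ?thesis using row_ok_empty by (auto simp: \<kappa>_def \<Lambda>_def)
  next
    case False
    then have "row_ok (\<rho> y) (if y = 0 then {#} else E (x - 1) (y - 1) \<omega>) (E (x - 1) y \<omega>) (\<lambda>h. J (x - 1) y h \<omega>)"
      using less[of "x - 1" y] by simp
    then show ?thesis using False by (auto simp: \<kappa>_def \<Lambda>_def)
  qed
  then obtain i' where i': "row_ok (\<rho> y) \<kappa> \<Lambda> i'" ..
  have "\<exists>i. col_ok (\<rho>' x) \<kappa> \<mu> i"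
  proof (cases "y = 0")
    case True
    then show ?thesis using col_ok_empty by (auto simp: \<kappa>_def \<mu>_def)
  next
    case False
    then have "col_ok (\<rho>' x) (if x = 0 then {#} else E (x - 1) (y - 1) \<omega>) (E x (y - 1) \<omega>) (\<lambda>h. J' x (y - 1) h \<omega>)"
      using less[of x "y - 1"] by simp
    then show ?thesis using False by (auto simp: \<kappa>_def \<mu>_def)
  qed
  then obtain i where i: "col_ok (\<rho>' x) \<kappa> \<mu> i" ..
  have sgs: "sg_r (\<rho> y) \<Longrightarrow> \<mu> = {#}" "sg_c (\<rho>' x) \<Longrightarrow> \<Lambda> = {#}"
    using sg(1)[of y] sg(2)[of x] by (simp_all add: \<mu>_def \<Lambda>_def)
  have "row_ok (\<rho> y) \<mu> (E x y \<omega>) (\<lambda>h. J x y h \<omega>) \<and> col_ok (\<rho>' x) \<Lambda> (E x y \<omega>) (\<lambda>h. J' x y h \<omega>)"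
    using forward_ok[OF g(1)[of y] g(2)[of x] C sgs i' i, of "\<lambda>h. J x y h \<omega>" "\<lambda>h. J' x y h \<omega>" "E x y \<omega>"]
      init[of y x] step[of _ y x] ev[of x y] unfolding inp field_data_def by blast
  then show ?case by (simp add: \<mu>_def \<Lambda>_def)
qed

end

section \<open>Generated events and sequential sampling\<close>

lemma countable_multiset: "countable (UNIV :: 'x :: countable multiset set)"
proof -
  have "(UNIV :: 'x multiset set) = range mset" using surj_mset by auto
  then show ?thesis by (metis countable_image countableI_type)
qed

lemma gen_by_sigma: "sigma_algebra (space M) (gen_by M Xs)"
  unfolding gen_by_def by (rule sigma_algebra_sigma_sets) auto

lemma gen_by_space: "space M \<in> gen_by M Xs"
  unfolding gen_by_def by (rule sigma_sets_top)

lemma gen_by_Int: "A \<in> gen_by M Xs \<Longrightarrow> B \<in> gen_by M Xs \<Longrightarrow> A \<inter> B \<in> gen_by M Xs"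
  by (rule semiring_of_sets.Int[OF ring_of_sets.axioms(1)[OF algebra.axioms(1)[OF sigma_algebra.axioms(1)[OF gen_by_sigma]]]])

lemma gen_by_Collect: "X \<in> Xs \<Longrightarrow> {\<omega> \<in> space M. P (X \<omega>)} \<in> gen_by M Xs"
  unfolding gen_by_def
  by (rule sigma_sets.Basic) (auto intro!: exI[of _ X] exI[of _ "Collect P"])

lemma gen_by_Ball:
  assumes "finite I" "\<And>i. i \<in> I \<Longrightarrow> {\<omega> \<in> space M. P i \<omega>} \<in> gen_by M Xs"
  shows "{\<omega> \<in> space M. \<forall>i\<in>I. P i \<omega>} \<in> gen_by M Xs"
  using assms
proof (induction I rule: finite_induct)
  case empty
  then show ?case using gen_by_space by simp
next
  case (insert i I)
  have "{\<omega> \<in> space M. \<forall>i\<in>insert i I. P i \<omega>} = {\<omega> \<in> space M. P i \<omega>} \<inter> {\<omega> \<in> space M. \<forall>i\<in>I. P i \<omega>}"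
    by auto
  then show ?case using gen_by_Int[OF insert.prems[of i] insert.IH] insert.prems by auto
qed

lemma gen_by_sets:
  assumes "\<And>X. X \<in> Xs \<Longrightarrow> X \<in> M \<rightarrow>\<^sub>M count_space UNIV"
  shows "gen_by M Xs \<subseteq> sets M"
  unfolding gen_by_def
  by (rule sets.sigma_sets_subset) (auto intro!: measurable_sets[OF assms])

lemma Collect_in_sets: "X \<in> M \<rightarrow>\<^sub>M count_space UNIV \<Longrightarrow> {\<omega> \<in> space M. P (X \<omega>)} \<in> sets M"
  using measurable_sets[of X M "count_space UNIV" "Collect P"] by (simp add: vimage_def Int_def conj_commute)

text \<open>Conditioning on the whole space makes each pair (input, output) of zero kernel a null
  event. There are countably many pairs, so their union is null too.\<close>

lemma sampled_neq_0:
  assumes M: "prob_space M" and s: "sampled M G In Out p" and G: "space M \<in> G"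
    and In: "\<And>i. {\<omega> \<in> space M. In \<omega> = i} \<in> sets M" and Out: "\<And>r. {\<omega> \<in> space M. Out \<omega> = r} \<in> sets M"
    and c: "countable (UNIV :: 'i set)" "countable (UNIV :: 'o set)"
  shows "AE \<omega> in M. p (In \<omega> :: 'i) (Out \<omega> :: 'o) \<noteq> 0"
proof -
  interpret prob_space M by (rule M)
  have "AE \<omega> in M. \<not> (In \<omega> = i \<and> Out \<omega> = r)" if "p i r = 0" for i r
  proof -
    have "measure M (space M \<inter> {\<omega> \<in> space M. In \<omega> = i \<and> Out \<omega> = r}) = 0"
      using s G that unfolding sampled_def by simp
    moreover have "{\<omega> \<in> space M. In \<omega> = i \<and> Out \<omega> = r} = {\<omega> \<in> space M. In \<omega> = i} \<inter> {\<omega> \<in> space M. Out \<omega> = r}" by auto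
    then have "{\<omega> \<in> space M. In \<omega> = i \<and> Out \<omega> = r} \<in> sets M" using In[of i] Out[of r] by simp
    ultimately have "AE \<omega> in M. \<omega> \<notin> {\<omega> \<in> space M. In \<omega> = i \<and> Out \<omega> = r}"
      by (subst (asm) Int_absorb1) (auto simp: prob_eq_0)
    then show ?thesis using AE_space by eventually_elim auto
  qed
  then have "AE \<omega> in M. \<forall>x\<in>{x. p (fst x) (snd x) = 0}. \<not> (In \<omega> = fst x \<and> Out \<omega> = snd x)"
    by (intro AE_ball_countable') (auto intro: countable_subset[OF subset_UNIV] simp: c countable_SIGMA UNIV_Times_UNIV[symmetric] simp del: UNIV_Times_UNIV)
  then show ?thesis by eventually_elim auto
qed

text \<open>Only the diagrams enter the sampling of a cell of the field, whereas the conditioning is on the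
  cells; \<open>k\<close> is the common value of the probability on \<open>A\<close>.\<close>

lemma sampled_kernel:
  assumes M: "prob_space M" and s: "sampled M G In Out p" and A: "A \<in> G" "A \<in> sets M"
    and In: "\<And>i. {\<omega> \<in> space M. In \<omega> = i} \<in> sets M" and Out: "\<And>r. {\<omega> \<in> space M. Out \<omega> = r} \<in> sets M"
    and E: "{\<omega> \<in> space M. E \<omega>} \<in> sets M"
    and c: "countable (UNIV :: 'i set)"
    and k: "AE \<omega> in M. \<omega> \<in> A \<longrightarrow> (E \<omega> \<longleftrightarrow> Out \<omega> = r (In \<omega> :: 'i)) \<and> p (In \<omega>) (r (In \<omega>)) = k" "0 \<le> k"
  shows "measure M (A \<inter> {\<omega> \<in> space M. E \<omega>}) = measure M A * k"
proof -
  interpret prob_space M by (rule M)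
  define X where "X i = A \<inter> {\<omega> \<in> space M. In \<omega> = i}" for i
  define Y where "Y i = A \<inter> {\<omega> \<in> space M. In \<omega> = i \<and> Out \<omega> = r i}" for i
  have X: "X i \<in> sets M" for i unfolding X_def using A In by simp
  have "Y i = X i \<inter> {\<omega> \<in> space M. Out \<omega> = r i}" for i by (auto simp: X_def Y_def)
  then have Y: "Y i \<in> sets M" for i using X Out by simp
  have XY: "emeasure M (Y i) = emeasure M (X i) * ennreal k" for i
  proof -
    have mY: "measure M (Y i) = measure M (X i) * p i (r i)"
      using s A unfolding sampled_def X_def Y_def by blast
    \<comment> \<open>An input whose kernel differs from k has probability 0 on A, so the product
      formula with k holds for every i.\<close>
    have "measure M (X i) = 0" if "p i (r i) \<noteq> k"
    proof -
      have "AE \<omega> in M. \<omega> \<notin> X i" using k(1) by eventually_elim (use that in \<open>auto simp: X_def\<close>)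
      then show ?thesis using X by (simp add: prob_eq_0)
    qed
    then have "measure M (Y i) = measure M (X i) * k" using mY by (cases "p i (r i) = k") auto
    then show ?thesis by (simp add: emeasure_eq_measure ennreal_mult')
  qed
  have "emeasure M (A \<inter> {\<omega> \<in> space M. E \<omega>}) = emeasure M (\<Union>i. Y i)"
  proof (rule emeasure_eq_AE)
    show "AE \<omega> in M. \<omega> \<in> A \<inter> {\<omega> \<in> space M. E \<omega>} \<longleftrightarrow> \<omega> \<in> (\<Union>i. Y i)"
      using k(1) by eventually_elim (auto simp: Y_def)
    show "(\<Union>i. Y i) \<in> sets M" using Y c by (intro sets.countable_UN') auto
  qed (use A E in auto)
  also have "\<dots> = (\<integral>\<^sup>+i. emeasure M (Y i) \<partial>count_space UNIV)"
    using Y c by (intro emeasure_UN_countable) (auto simp: disjoint_family_on_def Y_def)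
  also have "\<dots> = (\<integral>\<^sup>+i. emeasure M (X i) \<partial>count_space UNIV) * ennreal k"
    unfolding XY by (rule nn_integral_multc) simp
  also have "(\<integral>\<^sup>+i. emeasure M (X i) \<partial>count_space UNIV) = emeasure M (\<Union>i. X i)"
    using X c by (intro emeasure_UN_countable[symmetric]) (auto simp: disjoint_family_on_def X_def)
  also have "(\<Union>i. X i) = A" using sets.sets_into_space[OF A(2)] by (auto simp: X_def)
  finally show ?thesis using k(2) by (simp add: emeasure_eq_measure ennreal_mult'[symmetric])
qed

section \<open>The initial probability at the four kinds of vertices\<close>

context higher_spin
begin

lemma kernel_origin:
  assumes "\<alpha> * \<beta> < 1"
  shows "b_col q s (sg_col \<beta>) j * b_row q (sg_row \<alpha>) j * R_spec q s (sg_row \<alpha>) (sg_col \<beta>) j j 0 0 /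
    (Pi_spec q s (sg_row \<alpha>) (sg_col \<beta>) * b_col q s (sg_col \<beta>) 0 * b_row q (sg_row \<alpha>) 0) =
    (\<alpha> * \<beta>) ^ j / qp q q j * qpoch_inf q (\<alpha> * \<beta>)"
proof -
  have R: "R_spec q s (sg_row \<alpha>) (sg_col \<beta>) j j 0 0 = qp q q j"
    using R_spec_0[of "sg_col \<beta>" "sg_row \<alpha>" j 0] by simp
  have Pi: "Pi_spec q s (sg_row \<alpha>) (sg_col \<beta>) = 1 / qpoch_inf q (\<alpha> * \<beta>)"
    using assms by (subst Pi_spec_eq) auto
  show ?thesis unfolding R Pi b_col_sg b_row_sg by (simp add: power_mult_distrib)
qed

text \<open>The powers of \<alpha> and the q-factorials containing i' cancel. The result is free of
  i', which makes the entries along the bottom axis independent. The hypothesis on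
  \<open>b_row\<close> matters for \<open>\<alpha> = 0\<close>, where it forces i' = 0.\<close>

lemma kernel_bottom:
  assumes \<theta>: "good_col (sqW \<theta>)" and \<alpha>\<theta>: "\<alpha> * \<theta> < 1" and b: "b_row q (sg_row \<alpha>) i' \<noteq> 0"
  shows "b_col q s (sqW \<theta>) v * b_row q (sg_row \<alpha>) (i' + v) * R_spec q s (sg_row \<alpha>) (sqW \<theta>) (i' + v) v i' 0 /
    (Pi_spec q s (sg_row \<alpha>) (sqW \<theta>) * b_col q s (sqW \<theta>) 0 * b_row q (sg_row \<alpha>) i') =
    (\<alpha> * \<theta>) ^ v * qp q (- s / \<theta>) v / qp q q v * (qpoch_inf q (\<alpha> * \<theta>) / qpoch_inf q (- s * \<alpha>))"
proof -
  have Pi: "Pi_spec q s (sg_row \<alpha>) (sqW \<theta>) = qpoch_inf q (- s * \<alpha>) / qpoch_inf q (\<alpha> * \<theta>)"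
    using \<alpha>\<theta> by (subst Pi_spec_eq) (auto simp: mult.commute)
  have \<alpha>: "\<alpha> ^ i' \<noteq> 0" using b by (simp add: b_row_sg)
  have "t * a / z * (x * y / w) * (w / k) / (P * 1 * (x / k)) = (y * t) * a / z * (1 / P)"
    if "x \<noteq> 0" "w \<noteq> 0" "k \<noteq> 0" for t a z x y w k P :: real
    using that by (simp add: mult_ac)
  note gen = this[OF \<alpha> qq_pos(2) qq_pos(2)]
  have b0: "b_col q s (sqW \<theta>) 0 = 1" by (simp add: b_col_sqW)
  show ?thesis
    unfolding R_spec_j2_0[OF \<theta>] b0 unfolding b_col_sqW b_row_sg Pi power_add gen power_mult_distrib by simp
qed

text \<open>The result is free of i, whence independence along the left axis. A path enters exactly
  when j = 0, which gives the probability 1/(1 + u \<beta>).\<close>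

lemma kernel_left:
  assumes u: "0 \<le> u" "u < 1" and \<beta>: "0 \<le> \<beta>" and b: "b_col q s (sg_col \<beta>) i \<noteq> 0" and j: "j = 0 \<or> j = 1"
  shows "b_col q s (sg_col \<beta>) (i + j) * b_row q (sHL u) j * R_spec q s (sHL u) (sg_col \<beta>) j (i + j) 0 i /
    (Pi_spec q s (sHL u) (sg_col \<beta>) * b_col q s (sg_col \<beta>) i * b_row q (sHL u) 0) =
    (if j = 0 then 1 else u * \<beta>) / (1 + u * \<beta>)"
proof -
  have ub: "0 \<le> u * \<beta>" using u \<beta> by simp
  have R: "R_spec q s (sHL u) (sg_col \<beta>) j (i + j) 0 i = qp q q (i + j) / qp q q i"
    using R_spec_0[of "sg_col \<beta>" "sHL u" j i] by (simp add: add.commute)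
  have "qpoch_inf q (- (u * \<beta>)) = (1 + u * \<beta>) * qpoch_inf q (- (u * \<beta>) * q)"
    using qpoch_inf_Suc[OF q01, of "- (u * \<beta>)"] ub by simp
  moreover have neg: "- (u * \<beta>) * q < 1" using ub q0 by (smt (verit) mult_nonneg_nonneg mult_minus_left)
  then have "0 < qpoch_inf q (- (u * \<beta>) * q)" by (rule qpoch_inf_pos[OF q01])
  ultimately have Pi: "Pi_spec q s (sHL u) (sg_col \<beta>) = 1 + u * \<beta>"
    using neg by (subst Pi_spec_eq) (auto simp: mult_ac)
  have b': "\<beta> ^ i \<noteq> 0" using b by (simp add: b_col_sg)
  have b1: "b_row q (sHL u) j = u ^ j" "b_row q (sHL u) 0 = 1" using j by (auto simp: b_row_sHL)
  have "x * y / w * t * (w / k) / (P * (x / k) * 1) = y * t / P"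
    if "x \<noteq> 0" "w \<noteq> 0" "k \<noteq> 0" for t x y w k P :: real
    using that by (simp add: mult_ac)
  note gen = this[OF b' qq_pos(2) qq_pos(2)]
  show ?thesis unfolding R Pi b1 b_col_sg power_add gen using j by (auto simp: mult.commute)
qed

lemma b_col_sqW_Suc:
  assumes "good_col (sqW \<theta>)"
  shows "b_col q s (sqW \<theta>) (Suc i) = b_col q s (sqW \<theta>) i * ((\<theta> + s * q ^ i) / (1 - q * q ^ i))"
proof -
  have "\<theta> * (1 - - s / \<theta> * q ^ i) = \<theta> + s * q ^ i" using good_colD(1)[OF assms] by (simp add: field_simps)
  then have e: "\<theta> + s * q ^ i = \<theta> * (1 - - s / \<theta> * q ^ i)" by simp
  show ?thesis unfolding b_col_sqW qp_Suc power_Suc e by (simp only: divide_inverse inverse_mult_distrib mult_ac)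
qed

text \<open>The ratios of the b-weights renormalize R to the stochastic weight: for columns a step
  of one in the index contributes (\<theta> + s q^n)/(1 - q^(n+1)) or its inverse, for rows a power
  of u. The nonvanishing hypotheses justify these cancellations at the end points of the parameter
  range.\<close>

lemma kernel_bulk:
  assumes u: "0 \<le> u" "u < 1" and \<theta>: "good_col (sqW \<theta>)" and b: "b_col q s (sqW \<theta>) i \<noteq> 0"
    and j: "j = 0 \<or> j = 1" and i': "i' = 0 \<or> i' = 1" and bi': "b_row q (sHL u) i' \<noteq> 0"
  shows "b_col q s (sqW \<theta>) v * b_row q (sHL u) j * R_spec q s (sHL u) (sqW \<theta>) j v i' i /
    (Pi_spec q s (sHL u) (sqW \<theta>) * b_col q s (sqW \<theta>) i * b_row q (sHL u) i') =
    hs_weight q s u \<theta> (i, 1 - i') (v, 1 - j)"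
proof -
  note \<theta>pos = good_colD(1)[OF \<theta>]
  have us: "u * s \<le> 0" using u s0 by (simp add: mult_nonneg_nonpos)
  have ut: "0 \<le> u * \<theta>" using u \<theta>pos by simp
  have d: "1 - u * s \<noteq> 0" "1 + u * \<theta> \<noteq> 0" using us ut by auto
  have nq: "1 - q * q ^ n \<noteq> 0" for n using qq_pos(2)[of "Suc n"] by (simp add: qp_Suc)
  have usq: "u * q * s \<le> 0" 
  proof -
    have "u * s * q \<le> 0" by (rule mult_nonpos_nonneg[OF us less_imp_le[OF q0]])
    then show ?thesis by (simp only: mult_ac)
  qed
  have utq: "- (u * \<theta>) * q < 1" using ut q0 by (smt (verit) mult_nonneg_nonneg mult_minus_left)
  \<comment> \<open>At X = q the arguments of the infinite products differ by one power of q in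
    pairs, so each ratio leaves a single factor.\<close>
  have Pi: "Pi_spec q s (sHL u) (sqW \<theta>) = (1 + u * \<theta>) / (1 - u * s)"
  proof -
    have e: "u * q * - \<theta> = - (u * \<theta>) * q" "u * q * s = u * s * q" by simp_all
    have e': "u * q * \<theta> = u * \<theta> * q" by simp
    have "qpoch_inf q (u * - \<theta>) = (1 + u * \<theta>) * qpoch_inf q (- (u * \<theta>) * q)"
      using qpoch_inf_Suc[OF q01, of "- (u * \<theta>)"] ut by simp
    moreover have "qpoch_inf q (u * s) = (1 - u * s) * qpoch_inf q (u * s * q)"
      using us by (intro qpoch_inf_Suc[OF q01]) simp
    moreover have "0 < qpoch_inf q (u * s * q)" using usq by (intro qpoch_inf_pos[OF q01]) (simp add: e)
    moreover have "0 < qpoch_inf q (- (u * \<theta>) * q)" by (rule qpoch_inf_pos[OF q01 utq])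
    moreover have "a * x * y / (c * y * x) = a / c" if "0 < x" "0 < y" for a c x y :: real
      using that by simp
    moreover have "Pi_spec q s (sHL u) (sqW \<theta>) = qpoch_inf q (u * - \<theta>) * qpoch_inf q (u * s * q) / (qpoch_inf q (u * s) * qpoch_inf q (- (u * \<theta>) * q))"
      using us utq by (subst Pi_spec_eq) (simp_all add: e e')
    ultimately show ?thesis by simp
  qed
  have cancel: "B * c * t / (x / d * B * e) = c * t * d / (x * e)" if "B \<noteq> 0" for B c t x d e :: real
    using that by simp
  show ?thesis
  proof (cases "i' + v = j + i")
    case False
    then have "R_spec q s (sHL u) (sqW \<theta>) j v i' i = 0" by (rule R_spec_nonconserving)
    moreover have "hs_weight q s u \<theta> (i, 1 - i') (v, 1 - j) = 0"
      using False j i' by (auto simp: hs_weight_def)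
    ultimately show ?thesis by simp
  next
    case cons: True
    have qpn: "0 < qp q (u * s) n" "0 < qp q (u * q * s) n" for n
      using us usq by (auto intro!: qp_pos[OF q01])
    have qps: "qp q (u * s) (Suc n) = (1 - u * s) * qp q (u * q * s) n" for n
      unfolding qp_Suc_left by (simp add: mult_ac)
    consider "i' = 0" "j = 0" | "i' = 0" "j = 1" | "i' = 1" "j = 0" | "i' = 1" "j = 1" using j i' by auto
    then show ?thesis
    proof cases
      case 1
      then have v: "v = i" using cons by simp
      have "R_spec q s (sHL u) (sqW \<theta>) 0 i 0 i = qp q (u * q * s) i / qp q (u * s) i"
        using R_spec_0[OF \<theta>, of "sHL u" 0 i] us by simp
      also have "\<dots> = (1 - u * s * q ^ i) / (1 - u * s)"
        using qps[of i] qp_Suc[of q "u * s" i] qpn(1)[of i] d by (simp add: divide_simps mult_ac)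
      finally have R: "R_spec q s (sHL u) (sqW \<theta>) 0 i 0 i = (1 - u * s * q ^ i) / (1 - u * s)" .
      have b0: "b_row q (sHL u) 0 = 1" by (simp add: b_row_sHL)
      show ?thesis unfolding 1 v R Pi b0 cancel[OF b] using d by (simp add: hs_weight_def)
    next
      case 2
      then have v: "v = Suc i" using cons by simp
      have "R_spec q s (sHL u) (sqW \<theta>) 1 (Suc i) 0 i = qp q (u * q * s) i * qp q q (Suc i) / (qp q (u * s) (Suc i) * qp q q i)"
        using R_spec_0[OF \<theta>, of "sHL u" 1 i] us by simp
      also have "\<dots> = (1 - q * q ^ i) / (1 - u * s)"
      proof -
        have "a * (w * x) / (c * a * w) = x / c" if "0 < a" "0 < w" for a w x c :: real
          using that by simp
        from this[OF qpn(2) qq_pos(1)] show ?thesis unfolding qps qp_Suc[of q q i] .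
      qed
      finally have R: "R_spec q s (sHL u) (sqW \<theta>) 1 (Suc i) 0 i = (1 - q * q ^ i) / (1 - u * s)" .
      have b0: "b_row q (sHL u) 0 = 1" "b_row q (sHL u) 1 = u" by (simp_all add: b_row_sHL)
      have "B * (T / K) * u * (K / D) / (X / D * B * 1) = u * T / X" if "B \<noteq> 0" "K \<noteq> 0" "D \<noteq> 0" for B T K D X :: real
        using that by simp
      from this[OF b nq d(1)] show ?thesis unfolding 2 v R Pi b0 b_col_sqW_Suc[OF \<theta>] by (simp add: hs_weight_def)
    next
      case 3
      then obtain n where i: "i = Suc n" and v: "v = n" using cons by (cases i) auto
      have bi: "b_col q s (sqW \<theta>) n \<noteq> 0" "(\<theta> + s * q ^ n) / (1 - q * q ^ n) \<noteq> 0"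
        using b unfolding i b_col_sqW_Suc[OF \<theta>] by auto
      \<comment> \<open>The b-weight at n + 1 contains this factor, so it is nonzero even at
        \<open>\<theta> = - s\<close>, where only n = 0 would make it vanish.\<close>
      then have T: "\<theta> + s * q ^ n \<noteq> 0" by auto
      have b0: "b_row q (sHL u) 0 = 1" "b_row q (sHL u) 1 = u" by (simp_all add: b_row_sHL)
      have u0: "u \<noteq> 0" using bi' 3 b0 by simp
      have "B * 1 * (u * T / D) / (X / D * (B * (T / K)) * u) = K / X" if "B \<noteq> 0" "T \<noteq> 0" "D \<noteq> 0" for B T K D X :: real
        using that u0 by simp
      from this[OF bi(1) T d(1)] show ?thesis
        unfolding 3 v i Pi b0 b_col_sqW_Suc[OF \<theta>] R_spec_01[OF u] add.commute[of "s * q ^ n"]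
        by (simp add: hs_weight_def)
    next
      case 4
      then have v: "v = i" using cons by simp
      have b0: "b_row q (sHL u) 1 = u" by (simp add: b_row_sHL)
      have u0: "u \<noteq> 0" using bi' 4 b0 by simp
      have "B * u * (T / D) / (X / D * B * u) = T / X" if "B \<noteq> 0" "D \<noteq> 0" for B T D X :: real
        using that u0 by simp
      from this[OF b d(1)] show ?thesis
        unfolding 4 v Pi b0 R_spec_11[OF u] by (simp add: hs_weight_def)
    qed
  qed
qed

end

section \<open>The law of the lengths\<close>

lemma triangle_mono: "m \<le> n \<Longrightarrow> triangle m \<le> triangle n"
  by (rule lift_Suc_mono_le[of triangle]) simp_all

text \<open>\<open>prod_encode\<close> runs through the quadrant by antidiagonals, so cells with a
  smaller code lie in the past that conditions the sampling at (x, y) in both models.\<close>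

lemma prod_encode_less:
  assumes "prod_encode (x', y') < prod_encode (x, y)"
  shows "x' + y' \<le> x + y" "(x', y') \<noteq> (x, y)"
proof -
  show "x' + y' \<le> x + y"
  proof (rule ccontr)
    assume "\<not> x' + y' \<le> x + y"
    then have "triangle (Suc (x + y)) \<le> triangle (x' + y')" by (intro triangle_mono) simp
    then show False using assms by (simp add: prod_encode_def)
  qed
  show "(x', y') \<noteq> (x, y)" using assms by auto
qed

lemma prod_encode_pred:
  "1 \<le> y \<Longrightarrow> prod_encode (x, y - 1) < prod_encode (x, y)"
  "1 \<le> x \<Longrightarrow> prod_encode (x - 1, y) < prod_encode (x, y)"
  by (cases y; cases x; simp add: prod_encode_def)+

lemma Collect_pair_sets:
  assumes "\<And>a. {\<omega> \<in> space M. f \<omega> = a} \<in> sets M" "\<And>b. {\<omega> \<in> space M. g \<omega> = b} \<in> sets M"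
  shows "{\<omega> \<in> space M. (f \<omega>, g \<omega>) = c} \<in> sets M"
proof -
  have "{\<omega> \<in> space M. (f \<omega>, g \<omega>) = c} = {\<omega> \<in> space M. f \<omega> = fst c} \<inter> {\<omega> \<in> space M. g \<omega> = snd c}"
    by (cases c) auto
  then show ?thesis using assms by simp
qed

text \<open>The complement 1 - j appears because a horizontal edge is occupied precisely when the
  row adds no part at that vertex.\<close>

definition zcell :: "nat \<times> nat \<Rightarrow> triple \<Rightarrow> nat \<times> nat" where
  "zcell = (\<lambda>(x, y) (_, j, j'). if x = 0 \<and> y = 0 then (j, 0) else if y = 0 then (j', 0)
     else if x = 0 then (0, 1 - j) else (j', 1 - j))"

text \<open>The cell at the origin contributes the shift by the q-Poisson variable; the other two
  terms are the centered height function.\<close>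

definition height :: "(nat \<times> nat \<Rightarrow> nat \<times> nat) \<Rightarrow> nat \<Rightarrow> nat \<Rightarrow> int" where
  "height c x y = int (card {k \<in> {1..y}. snd (c (x, k)) = 1}) - int (\<Sum>k=1..x. fst (c (k, 0))) - int (fst (c (0, 0)))"

locale hs_setup = higher_spin +
  fixes \<alpha> \<beta> :: real and u \<theta> :: "nat \<Rightarrow> real"
  assumes u: "\<And>y. 1 \<le> y \<Longrightarrow> 0 \<le> u y \<and> u y < 1"
    and \<theta>: "\<And>x. 1 \<le> x \<Longrightarrow> - s \<le> \<theta> x \<and> \<theta> x \<le> - inverse s"
    and \<alpha>: "0 \<le> \<alpha>" and \<beta>: "0 \<le> \<beta>" and \<alpha>\<beta>: "\<alpha> * \<beta> < 1"
    and \<alpha>\<theta>: "\<And>x. 1 \<le> x \<Longrightarrow> \<alpha> * \<theta> x < 1"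
begin

text \<open>A cell \<open>(x, y)\<close> carries the numbers of paths leaving the vertex \<open>(x, y)\<close> upwards and to the right; the
  cells on the axes carry the boundary conditions, and \<open>(0, 0)\<close> carries \<open>\<M>\<close>. \<open>kern z p\<close> is the
  probability of the value \<open>z p\<close> at \<open>p\<close> given the values \<open>z\<close> at the preceding cells.\<close>

definition kern :: "(nat \<times> nat \<Rightarrow> nat \<times> nat) \<Rightarrow> nat \<times> nat \<Rightarrow> real" where
  "kern z = (\<lambda>(x, y). let v = fst (z (x, y)); h = snd (z (x, y)) in
     if x = 0 \<and> y = 0 then (if h = 0 then (\<alpha> * \<beta>) ^ v / qp q q v * qpoch_inf q (\<alpha> * \<beta>) else 0)
     else if y = 0 then
       (if h = 0 then (\<alpha> * \<theta> x) ^ v * qp q (- s / \<theta> x) v / qp q q v *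
          (qpoch_inf q (\<alpha> * \<theta> x) / qpoch_inf q (- s * \<alpha>)) else 0)
     else if x = 0 then (if v = 0 \<and> h \<le> 1 then (if h = 1 then 1 else u y * \<beta>) / (1 + u y * \<beta>) else 0)
     else hs_weight q s (u y) (\<theta> x) (fst (z (x, y - 1)), snd (z (x - 1, y))) (v, h))"

lemma kern_cell:
  assumes "z (x, y) = (v, h)"
  shows "kern z (x, y) =
    (if x = 0 \<and> y = 0 then (if h = 0 then (\<alpha> * \<beta>) ^ v / qp q q v * qpoch_inf q (\<alpha> * \<beta>) else 0)
     else if y = 0 then
       (if h = 0 then (\<alpha> * \<theta> x) ^ v * qp q (- s / \<theta> x) v / qp q q v *
          (qpoch_inf q (\<alpha> * \<theta> x) / qpoch_inf q (- s * \<alpha>)) else 0)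
     else if x = 0 then (if v = 0 \<and> h \<le> 1 then (if h = 1 then 1 else u y * \<beta>) / (1 + u y * \<beta>) else 0)
     else hs_weight q s (u y) (\<theta> x) (fst (z (x, y - 1)), snd (z (x - 1, y))) (v, h))"
  unfolding kern_def prod.case assms fst_conv snd_conv Let_def ..

lemma good_sHL_rows: "good_row (sHL_rows \<alpha> u y)"
  using u[of y] by (auto simp: sHL_rows_def)

lemma good_sqW_cols: "good_col (sqW_cols \<beta> \<theta> x)"
  using \<theta>[of x] by (auto simp: sqW_cols_def)

lemma hs_weight_nonneg:
  assumes "1 \<le> x" "1 \<le> y"
  shows "0 \<le> hs_weight q s (u y) (\<theta> x) a b"
proof -
  have uy: "0 \<le> u y" and tx: "- s \<le> \<theta> x" "0 < \<theta> x" using u \<theta> s0 assms by (force)+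
  have ut: "0 \<le> u y * \<theta> x" using uy tx by simp
  have p: "q ^ n \<le> 1" for n using q0 q1 by (simp add: power_le_one)
  have 1: "u y * s * q ^ n \<le> 0" for n
    using mult_nonneg_nonpos[OF uy less_imp_le[OF s0]] q0 by (simp add: mult_nonpos_nonneg)
  have 2: "0 \<le> \<theta> x + s * q ^ n" for n
  proof -
    have "s \<le> s * q ^ n" using s0 p[of n] by (simp add: mult_le_cancel_left)
    then show ?thesis using tx by linarith
  qed
  have "0 \<le> u y * (\<theta> x + s * q ^ n)" for n using uy 2 by simp
  moreover have "0 \<le> 1 - u y * s * q ^ n" for n using 1[of n] by simp
  moreover have "0 \<le> q ^ n + u y * \<theta> x" for n using ut q0 by (simp add: add_nonneg_nonneg less_imp_le)
  moreover have "0 \<le> 1 + u y * \<theta> x" using ut by simp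
  ultimately show ?thesis using p
    by (cases a; cases b) (auto simp: hs_weight_def intro!: divide_nonneg_nonneg)
qed

lemma kern_nonneg: "0 \<le> kern z (x, y)"
proof -
  have "0 \<le> (\<alpha> * \<beta>) ^ v / qp q q v * qpoch_inf q (\<alpha> * \<beta>)" for v
    using \<alpha> \<beta> qpoch_inf_pos[OF q01 \<alpha>\<beta>] by (simp add: less_imp_le)
  moreover have "0 \<le> (\<alpha> * \<theta> x) ^ v * qp q (- s / \<theta> x) v / qp q q v * (qpoch_inf q (\<alpha> * \<theta> x) / qpoch_inf q (- s * \<alpha>))"
    if x: "1 \<le> x" for v
  proof -
    have g: "good_col (sqW (\<theta> x))" using \<theta>[OF x] by simp
    have "- s * \<alpha> \<le> \<theta> x * \<alpha>" using \<theta>[OF x] \<alpha> by (intro mult_right_mono) auto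
    then have "- s * \<alpha> < 1" using \<alpha>\<theta>[OF x] by (simp add: mult.commute)
    then show ?thesis using good_colD(1,2)[OF g] \<alpha> qp_nonneg[OF q01 good_colD(2)[OF g], of v] qpoch_inf_pos[OF q01 \<alpha>\<theta>[OF x]]
        qpoch_inf_pos[OF q01, of "- s * \<alpha>"]
      by (intro mult_nonneg_nonneg divide_nonneg_nonneg zero_le_power) (auto simp: less_imp_le)
  qed
  moreover have "0 \<le> u y * \<beta>" if "1 \<le> y" using u[OF that] \<beta> by simp
  ultimately show ?thesis using hs_weight_nonneg[of x y] by (auto simp: kern_def Let_def)
qed

text \<open>The chain rule along the enumeration of cells: given the earlier cells, the diagrams
  still vary, but the probability of the next cell value depends on them only through cells already
  fixed. This is what \<open>sampled_kernel\<close> needs.\<close>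

lemma field_law:
  assumes field: "yang_baxter_field M q s (sHL_rows \<alpha> u) (sqW_cols \<beta> \<theta>) C \<eta>"
  shows "\<exists>Z. (\<forall>p. Z p \<in> M \<rightarrow>\<^sub>M count_space UNIV) \<and>
    (\<forall>n z. measure M {\<omega> \<in> space M. \<forall>i\<in>{..<n}. Z (prod_decode i) \<omega> = z (prod_decode i)} = (\<Prod>i<n. kern z (prod_decode i))) \<and>
    (AE \<omega> in M. \<forall>x y. int y - int (size (\<eta> x y \<omega>)) = height (\<lambda>p. Z p \<omega>) x y)"
proof -
  let ?\<rho> = "sHL_rows \<alpha> u" and ?\<rho>' = "sqW_cols \<beta> \<theta>"
  interpret prob_space M using field by (simp add: yang_baxter_field_def)
  have C: "yb_coupling q s (?\<rho> y) (?\<rho>' x) (C (?\<rho> y) (?\<rho>' x))" for x y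
    using field by (simp add: yang_baxter_field_def)
  have \<eta>m: "\<eta> x y \<in> M \<rightarrow>\<^sub>M count_space UNIV" for x y using field by (simp add: yang_baxter_field_def)
  have \<eta>0: "0 \<notin># \<eta> x y \<omega>" if "\<omega> \<in> space M" for x y \<omega> using field that by (simp add: yang_baxter_field_def)
  have "\<exists>J J'.
        (\<forall>x y h. J x y h \<in> M \<rightarrow>\<^sub>M count_space UNIV \<and> J' x y h \<in> M \<rightarrow>\<^sub>M count_space UNIV) \<and>
        (\<forall>x y. sampled M (field_past M (field_data \<eta> J J') x y 0)
           (field_input \<eta> x y) (\<lambda>\<omega>. (J x y 0 \<omega>, J' x y 0 \<omega>))
           (initial_prob q s (?\<rho> y) (?\<rho>' x))) \<and>
        (\<forall>x y. \<forall>h\<ge>1. sampled M (field_past M (field_data \<eta> J J') x y h)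
           (\<lambda>\<omega>. (field_input \<eta> x y \<omega>, (J x y (h - 1) \<omega>, J' x y (h - 1) \<omega>)))
           (field_data \<eta> J J' x y h)
           (step_prob (C (?\<rho> y) (?\<rho>' x)) h)) \<and>
        (AE \<omega> in M. \<forall>x y. eventually (\<lambda>h. J x y h \<omega> = 0 \<and> J' x y h \<omega> = 0) sequentially)"
    using field unfolding yang_baxter_field_def by (elim conjE)
  then obtain J J' where
    JJ: "\<forall>x y h. J x y h \<in> M \<rightarrow>\<^sub>M count_space UNIV \<and> J' x y h \<in> M \<rightarrow>\<^sub>M count_space UNIV"
    and s0': "\<forall>x y. sampled M (field_past M (field_data \<eta> J J') x y 0)
           (field_input \<eta> x y) (\<lambda>\<omega>. (J x y 0 \<omega>, J' x y 0 \<omega>))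
           (initial_prob q s (?\<rho> y) (?\<rho>' x))"
    and sh': "\<forall>x y. \<forall>h\<ge>1. sampled M (field_past M (field_data \<eta> J J') x y h)
           (\<lambda>\<omega>. (field_input \<eta> x y \<omega>, (J x y (h - 1) \<omega>, J' x y (h - 1) \<omega>)))
           (field_data \<eta> J J' x y h)
           (step_prob (C (?\<rho> y) (?\<rho>' x)) h)"
    and ev: "AE \<omega> in M. \<forall>x y. eventually (\<lambda>h. J x y h \<omega> = 0 \<and> J' x y h \<omega> = 0) sequentially"
    by (elim exE conjE) (rule that)
  have Jm: "J x y h \<in> M \<rightarrow>\<^sub>M count_space UNIV" "J' x y h \<in> M \<rightarrow>\<^sub>M count_space UNIV" for x y h
    using JJ by blast+
  note s0 = s0'[rule_format] and sh = sh'[rule_format]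
  define Z where "Z p \<omega> = zcell p (field_data \<eta> J J' (fst p) (snd p) 0 \<omega>)" for p \<omega>
  have cnt: "countable (UNIV :: (nat multiset \<times> nat multiset \<times> nat multiset) set)"
    unfolding UNIV_Times_UNIV[symmetric] by (intro countable_SIGMA countable_multiset)
  have cnt': "countable (UNIV :: ((nat multiset \<times> nat multiset \<times> nat multiset) \<times> nat \<times> nat) set)"
    unfolding UNIV_Times_UNIV[symmetric] by (intro countable_SIGMA countable_multiset) auto
  have inm: "{\<omega> \<in> space M. field_input \<eta> x y \<omega> = i} \<in> sets M" for x y i
  proof -
    have e: "{\<omega> \<in> space M. \<eta> x y \<omega> = a} \<in> sets M" for x y a by (rule Collect_in_sets[OF \<eta>m])
    have e': "{\<omega> \<in> space M. (if b then {#} else \<eta> x y \<omega>) = a} \<in> sets M" for b x y a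
    proof (cases b)
      case True
      then show ?thesis by (cases "{#} = a") (simp_all only: if_True simp_thms Collect_mem_eq sets.top Collect_conj_eq Collect_const if_False Int_empty_right sets.empty_sets)
    next
      case False
      then show ?thesis by (simp only: if_False e)
    qed
    show ?thesis unfolding field_input_def by (intro Collect_pair_sets e')
  qed
  have Jpair: "{\<omega> \<in> space M. (J x y h \<omega>, J' x y h \<omega>) = i} \<in> sets M" for x y h i
    by (intro Collect_pair_sets Collect_in_sets Jm)
  have fd: "{\<omega> \<in> space M. field_data \<eta> J J' x y h \<omega> = i} \<in> sets M" for x y h i
    unfolding field_data_def
    by (intro Collect_pair_sets Collect_in_sets[OF Jm(1)] Collect_in_sets[OF Jm(2)] Collect_in_sets[OF \<eta>m, of "\<lambda>t. count t h = _"])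
  have past_space: "space M \<in> field_past M (field_data \<eta> J J') x y h" for x y h
    unfolding field_past_def by (rule gen_by_space)
  have "AE \<omega> in M. initial_prob q s (?\<rho> y) (?\<rho>' x) (field_input \<eta> x y \<omega>) (J x y 0 \<omega>, J' x y 0 \<omega>) \<noteq> 0" for x y
    by (rule sampled_neq_0[OF prob_space_axioms s0 past_space inm Jpair cnt]) simp
  moreover have "AE \<omega> in M. 1 \<le> h \<longrightarrow> step_prob (C (?\<rho> y) (?\<rho>' x)) h (field_input \<eta> x y \<omega>, (J x y (h - 1) \<omega>, J' x y (h - 1) \<omega>))
       (field_data \<eta> J J' x y h \<omega>) \<noteq> 0" for x y h
  proof (cases "1 \<le> h")
    case True
    have "AE \<omega> in M. step_prob (C (?\<rho> y) (?\<rho>' x)) h (field_input \<eta> x y \<omega>, (J x y (h - 1) \<omega>, J' x y (h - 1) \<omega>))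
       (field_data \<eta> J J' x y h \<omega>) \<noteq> 0"
      by (rule sampled_neq_0[OF prob_space_axioms sh[OF True] past_space Collect_pair_sets[OF inm Jpair] fd cnt']) simp
    then show ?thesis by eventually_elim simp
  qed simp
  ultimately have "AE \<omega> in M. (\<forall>x y. initial_prob q s (?\<rho> y) (?\<rho>' x) (field_input \<eta> x y \<omega>) (J x y 0 \<omega>, J' x y 0 \<omega>) \<noteq> 0) \<and>
     (\<forall>x y h. 1 \<le> h \<longrightarrow> step_prob (C (?\<rho> y) (?\<rho>' x)) h (field_input \<eta> x y \<omega>, (J x y (h - 1) \<omega>, J' x y (h - 1) \<omega>))
       (field_data \<eta> J J' x y h \<omega>) \<noteq> 0)"
    by (simp add: AE_all_countable)
  then have ok: "AE \<omega> in M. \<forall>x y. row_ok (?\<rho> y) (if y = 0 then {#} else \<eta> x (y - 1) \<omega>) (\<eta> x y \<omega>) (\<lambda>h. J x y h \<omega>) \<and>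
    col_ok (?\<rho>' x) (if x = 0 then {#} else \<eta> (x - 1) y \<omega>) (\<eta> x y \<omega>) (\<lambda>h. J' x y h \<omega>)"
    using ev
  proof eventually_elim
    case (elim \<omega>)
    have sgr: "sg_r (?\<rho> y) \<Longrightarrow> y = 0" for y by (cases "y = 0") (simp_all add: sHL_rows_def)
    have sgc: "sg_c (?\<rho>' x) \<Longrightarrow> x = 0" for x by (cases "x = 0") (simp_all add: sqW_cols_def)
    show ?case
      by (intro allI field_ok[where C = C and J = J and J' = J', OF good_sHL_rows good_sqW_cols C sgr sgc]) (use elim in auto)
  qed
  define S where "S x y \<omega> = size (\<eta> x y \<omega>)" for x y \<omega>
  \<comment> \<open>The almost sure facts about lengths that survive the elimination of the
    diagrams; the nonvanishing b-weights are the hypotheses of the kernel lemmas at the neighbouring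
    vertices.\<close>
  define OK where "OK \<omega> \<longleftrightarrow> (\<forall>x y. S x y \<omega> = (if y = 0 then 0 else S x (y - 1) \<omega>) + J x y 0 \<omega> \<and>
      S x y \<omega> = (if x = 0 then 0 else S (x - 1) y \<omega>) + J' x y 0 \<omega> \<and>
      b_row q (?\<rho> y) (J x y 0 \<omega>) \<noteq> 0 \<and> b_col q s (?\<rho>' x) (J' x y 0 \<omega>) \<noteq> 0 \<and> (1 \<le> y \<longrightarrow> J x y 0 \<omega> \<le> 1))" for \<omega>
  have tail_S: "tail (\<eta> x y \<omega>) 0 = S x y \<omega>" if "\<omega> \<in> space M" for x y \<omega>
    using tail_0[OF \<eta>0[OF that]] by (simp add: S_def)
  have OK: "AE \<omega> in M. OK \<omega>"
    using ok AE_space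
  proof eventually_elim
    case (elim \<omega>)
    show ?case unfolding OK_def
    proof (intro allI)
      fix x y
      have r: "row_ok (?\<rho> y) (if y = 0 then {#} else \<eta> x (y - 1) \<omega>) (\<eta> x y \<omega>) (\<lambda>h. J x y h \<omega>)"
        and c: "col_ok (?\<rho>' x) (if x = 0 then {#} else \<eta> (x - 1) y \<omega>) (\<eta> x y \<omega>) (\<lambda>h. J' x y h \<omega>)"
        using elim(1) by blast+
      have "tail (\<eta> x y \<omega>) 0 = tail (if y = 0 then {#} else \<eta> x (y - 1) \<omega>) 0 + J x y 0 \<omega>"
        "J x y 0 \<omega> \<in> row_occ (?\<rho> y)" "b_row q (?\<rho> y) (J x y 0 \<omega>) \<noteq> 0"
        using r unfolding row_ok_def by blast+
      moreover have "tail (\<eta> x y \<omega>) 0 = tail (if x = 0 then {#} else \<eta> (x - 1) y \<omega>) 0 + J' x y 0 \<omega>"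
        "b_col q s (?\<rho>' x) (J' x y 0 \<omega>) \<noteq> 0"
        using c unfolding col_ok_def by blast+
      ultimately show "S x y \<omega> = (if y = 0 then 0 else S x (y - 1) \<omega>) + J x y 0 \<omega> \<and>
          S x y \<omega> = (if x = 0 then 0 else S (x - 1) y \<omega>) + J' x y 0 \<omega> \<and>
          b_row q (?\<rho> y) (J x y 0 \<omega>) \<noteq> 0 \<and> b_col q s (?\<rho>' x) (J' x y 0 \<omega>) \<noteq> 0 \<and> (1 \<le> y \<longrightarrow> J x y 0 \<omega> \<le> 1)"
        using elim(2) by (auto simp: tail_S sHL_rows_def split: if_splits)
    qed
  qed
  have Zm: "Z p \<in> M \<rightarrow>\<^sub>M count_space UNIV" for p
  proof -
    have "Z p = (\<lambda>(j, j'). zcell p (0, j, j')) \<circ> (\<lambda>\<omega>. (J (fst p) (snd p) 0 \<omega>, J' (fst p) (snd p) 0 \<omega>))"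
      by (auto simp: Z_def field_data_def zcell_def fun_eq_iff split: prod.split)
    moreover have "(\<lambda>\<omega>. (J (fst p) (snd p) 0 \<omega>, J' (fst p) (snd p) 0 \<omega>)) \<in> M \<rightarrow>\<^sub>M count_space UNIV"
      using measurable_Pair[OF Jm(1)[of "fst p" "snd p" 0] Jm(2)[of "fst p" "snd p" 0]]
      by (simp add: pair_measure_countable)
    ultimately show ?thesis by (auto intro: measurable_comp)
  qed
  have Zs: "{\<omega> \<in> space M. Z p \<omega> = v} \<in> sets M" for p v by (rule Collect_in_sets[OF Zm])
  have law: "measure M {\<omega> \<in> space M. \<forall>i\<in>{..<n}. Z (prod_decode i) \<omega> = z (prod_decode i)} = (\<Prod>i<n. kern z (prod_decode i))" for n z
  proof (induction n)
    case 0
    then show ?case by (simp add: prob_space)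
  next
    case (Suc n)
    obtain x y where xy: "prod_decode n = (x, y)" by (metis surj_pair)
    then have n: "n = prod_encode (x, y)" by (metis prod_decode_inverse)
    define A where "A = {\<omega> \<in> space M. \<forall>i\<in>{..<n}. Z (prod_decode i) \<omega> = z (prod_decode i)}"
    define v h where "v = fst (z (x, y))" and "h = snd (z (x, y))"
    have zxy: "z (x, y) = (v, h)" by (simp add: v_def h_def)
    have AZ: "Z p \<omega> = z p" if "\<omega> \<in> A" "prod_encode p < n" for p \<omega>
      using that prod_encode_inverse[of p] unfolding A_def by (metis (mono_tags, lifting) lessThan_iff mem_Collect_eq)
    have A_past: "A \<in> field_past M (field_data \<eta> J J') x y 0"
      unfolding A_def field_past_def
    proof (rule gen_by_Ball)
      fix i assume "i \<in> {..<n}"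
      obtain x' y' where i: "prod_decode i = (x', y')" by (metis surj_pair)
      then have "i = prod_encode (x', y')" by (metis prod_decode_inverse)
      with \<open>i \<in> _\<close> have "x' + y' \<le> x + y" "(x', y') \<noteq> (x, y)" using prod_encode_less[of x' y' x y] n by auto
      then show "{\<omega> \<in> space M. Z (prod_decode i) \<omega> = z (prod_decode i)} \<in> gen_by M
         ({field_data \<eta> J J' x' y' g |x' y' g. x' + y' \<le> x + y \<and> (x', y') \<noteq> (x, y)} \<union> {field_data \<eta> J J' x y g |g. g < 0})"
        unfolding Z_def i by (intro gen_by_Collect[of _ _ M "\<lambda>t. zcell (x', y') t = _", simplified]) auto
    qed simp
    have A_sets: "A \<in> sets M"
      unfolding A_def by (intro sets.sets_Collect_finite_All Zs) auto
    have step: "measure M (A \<inter> {\<omega> \<in> space M. Z (x, y) \<omega> = z (x, y)}) = measure M A * kern z (x, y)"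
    proof (cases "(y = 0 \<longrightarrow> h = 0) \<and> (1 \<le> y \<longrightarrow> h \<le> 1) \<and> (x = 0 \<and> 1 \<le> y \<longrightarrow> v = 0)")
      case False
      have hs0: "hs_weight q s a b (i, j) (v, h) = 0" if "1 < h" for a b i j
        using that by (simp add: hs_weight_def)
      consider "y = 0" "h \<noteq> 0" | "1 \<le> y" "x = 0" "v \<noteq> 0 \<or> 1 < h" | "1 \<le> y" "1 \<le> x" "1 < h"
        using False by linarith
      \<comment> \<open>These are values that \<open>zcell\<close> never takes, so both sides are
        0.\<close>
      then have "kern z (x, y) = 0"
        unfolding kern_cell[of z x y v h, OF zxy] by cases (auto simp: hs0)
      moreover have "Z (x, y) \<omega> \<noteq> z (x, y)" for \<omega>
        unfolding zxy using False by (auto simp: Z_def zcell_def field_data_def split: if_splits)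
      ultimately show ?thesis by simp
    next
      case valid: True
      \<comment> \<open>The pair (j, j') that produces the cell value (v, h). On the axes the cell
        shows only one of the two numbers; the other follows from i' + j' = j + i with i = 0 or i' =
        0.\<close>
      define r where "r = (\<lambda>(\<kappa>, \<mu>, \<Lambda>). let i = tail \<mu> 0 - tail \<kappa> 0; i' = tail \<Lambda> 0 - tail \<kappa> 0 in
        if x = 0 \<and> y = 0 then (v, v) else if y = 0 then (i' + v, v) else if x = 0 then (1 - h, i + (1 - h)) else (1 - h, v))"
      show ?thesis
      proof (rule sampled_kernel[OF prob_space_axioms s0 A_past A_sets inm Jpair Zs cnt _ kern_nonneg, where r = r])
        show "AE \<omega> in M. \<omega> \<in> A \<longrightarrow> (Z (x, y) \<omega> = z (x, y) \<longleftrightarrow> (J x y 0 \<omega>, J' x y 0 \<omega>) = r (field_input \<eta> x y \<omega>)) \<and>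
           initial_prob q s (?\<rho> y) (?\<rho>' x) (field_input \<eta> x y \<omega>) (r (field_input \<eta> x y \<omega>)) = kern z (x, y)"
          using OK AE_space
        proof (eventually_elim, intro impI)
          fix \<omega> assume ok: "OK \<omega>" and \<omega>: "\<omega> \<in> space M" and \<omega>A: "\<omega> \<in> A"
          define i where "i = (if y = 0 then 0 else J' x (y - 1) 0 \<omega>)"
          define i' where "i' = (if x = 0 then 0 else J (x - 1) y 0 \<omega>)"
          define \<kappa> where "\<kappa> = (if x = 0 \<or> y = 0 then {#} else \<eta> (x - 1) (y - 1) \<omega>)"
          define \<mu> where "\<mu> = (if y = 0 then {#} else \<eta> x (y - 1) \<omega>)"
          define \<Lambda> where "\<Lambda> = (if x = 0 then {#} else \<eta> (x - 1) y \<omega>)"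
          have inp: "field_input \<eta> x y \<omega> = (\<kappa>, \<mu>, \<Lambda>)" by (simp add: field_input_def \<kappa>_def \<mu>_def \<Lambda>_def)
          have SJ: "S x y \<omega> = (if y = 0 then 0 else S x (y - 1) \<omega>) + J x y 0 \<omega>"
            "S x y \<omega> = (if x = 0 then 0 else S (x - 1) y \<omega>) + J' x y 0 \<omega>"
            "1 \<le> y \<Longrightarrow> J x y 0 \<omega> \<le> 1" "b_row q (?\<rho> y) (J x y 0 \<omega>) \<noteq> 0" "b_col q s (?\<rho>' x) (J' x y 0 \<omega>) \<noteq> 0" for x y
            using ok unfolding OK_def by blast+
          have ti: "tail \<mu> 0 = tail \<kappa> 0 + i" "tail \<Lambda> 0 = tail \<kappa> 0 + i'"
            using SJ(2)[of x "y - 1"] SJ(1)[of "x - 1" y] tail_S[OF \<omega>]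
            by (auto simp: i_def i'_def \<kappa>_def \<mu>_def \<Lambda>_def)
          have cons: "i' + J' x y 0 \<omega> = J x y 0 \<omega> + i"
          proof -
            have "tail \<mu> 0 + J x y 0 \<omega> = tail \<Lambda> 0 + J' x y 0 \<omega>"
              using SJ(1,2)[of x y] tail_S[OF \<omega>] by (auto simp: \<mu>_def \<Lambda>_def)
            then show ?thesis using ti by simp
          qed
          have r: "r (\<kappa>, \<mu>, \<Lambda>) = (if x = 0 \<and> y = 0 then (v, v) else if y = 0 then (i' + v, v) else if x = 0 then (1 - h, i + (1 - h)) else (1 - h, v))"
            by (simp add: r_def Let_def ti)
          have ip: "initial_prob q s (?\<rho> y) (?\<rho>' x) (\<kappa>, \<mu>, \<Lambda>) (j, j') =
            b_col q s (?\<rho>' x) j' * b_row q (?\<rho> y) j * R_spec q s (?\<rho> y) (?\<rho>' x) j j' i' i /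
            (Pi_spec q s (?\<rho> y) (?\<rho>' x) * b_col q s (?\<rho>' x) i * b_row q (?\<rho> y) i')" for j j'
            by (simp add: initial_prob_def Let_def ti)
          have Zxy: "Z (x, y) \<omega> = (if x = 0 \<and> y = 0 then (J x y 0 \<omega>, 0) else if y = 0 then (J' x y 0 \<omega>, 0)
            else if x = 0 then (0, 1 - J x y 0 \<omega>) else (J' x y 0 \<omega>, 1 - J x y 0 \<omega>))" for x y
            by (simp add: Z_def zcell_def field_data_def)
          have \<rho>0: "?\<rho> 0 = sg_row \<alpha>" "?\<rho>' 0 = sg_col \<beta>" and \<rho>1: "1 \<le> y \<Longrightarrow> ?\<rho> y = sHL (u y)" "1 \<le> x \<Longrightarrow> ?\<rho>' x = sqW (\<theta> x)"
            by (auto simp: sHL_rows_def sqW_cols_def)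
          consider "x = 0" "y = 0" | "1 \<le> x" "y = 0" | "x = 0" "1 \<le> y" | "1 \<le> x" "1 \<le> y" by linarith
          then show "(Z (x, y) \<omega> = z (x, y) \<longleftrightarrow> (J x y 0 \<omega>, J' x y 0 \<omega>) = r (field_input \<eta> x y \<omega>)) \<and>
             initial_prob q s (?\<rho> y) (?\<rho>' x) (field_input \<eta> x y \<omega>) (r (field_input \<eta> x y \<omega>)) = kern z (x, y)"
          proof cases
            case 1
            have ii: "i = 0" "i' = 0" using 1 by (simp_all add: i_def i'_def)
            have "Z (x, y) \<omega> = z (x, y) \<longleftrightarrow> (J x y 0 \<omega>, J' x y 0 \<omega>) = r (\<kappa>, \<mu>, \<Lambda>)"
              using 1 valid cons ii unfolding Zxy zxy r by auto
            moreover have "initial_prob q s (?\<rho> y) (?\<rho>' x) (\<kappa>, \<mu>, \<Lambda>) (v, v) = kern z (x, y)"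
              unfolding ip ii unfolding kern_cell[of z x y v h, OF zxy] using 1 valid kernel_origin[OF \<alpha>\<beta>] by (simp add: \<rho>0)
            moreover have "r (\<kappa>, \<mu>, \<Lambda>) = (v, v)" using 1 unfolding r by simp
            ultimately show ?thesis unfolding inp by metis
          next
            case 2
            have ii: "i = 0" using 2 by (simp add: i_def)
            have "Z (x, y) \<omega> = z (x, y) \<longleftrightarrow> (J x y 0 \<omega>, J' x y 0 \<omega>) = r (\<kappa>, \<mu>, \<Lambda>)"
              using 2 valid cons ii unfolding Zxy zxy r by auto
            moreover have "b_row q (sg_row \<alpha>) i' \<noteq> 0" using SJ(4)[of y "x - 1"] 2 by (simp add: i'_def \<rho>0)
            then have "initial_prob q s (?\<rho> y) (?\<rho>' x) (\<kappa>, \<mu>, \<Lambda>) (i' + v, v) = kern z (x, y)"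
              unfolding ip ii unfolding kern_cell[of z x y v h, OF zxy] \<rho>1(2)[OF 2(1)]
              using 2 valid kernel_bottom[of "\<theta> x" \<alpha> i' v] \<theta>[OF 2(1)] \<alpha>\<theta>[OF 2(1)] by (simp add: \<rho>0)
            moreover have "r (\<kappa>, \<mu>, \<Lambda>) = (i' + v, v)" using 2 unfolding r by simp
            ultimately show ?thesis unfolding inp by metis
          next
            case 3
            have ii: "i' = 0" using 3 by (simp add: i'_def)
            have J1: "J x y 0 \<omega> = 0 \<or> J x y 0 \<omega> = 1" using SJ(3)[of y x] 3 by linarith
            have h1: "h = 0 \<or> h = 1" using valid 3 by linarith
            have "Z (x, y) \<omega> = z (x, y) \<longleftrightarrow> (J x y 0 \<omega>, J' x y 0 \<omega>) = r (\<kappa>, \<mu>, \<Lambda>)"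
              using 3 valid cons ii J1 h1 unfolding Zxy zxy r by auto
            moreover have "b_col q s (sg_col \<beta>) i \<noteq> 0" using SJ(5)[of x "y - 1"] 3 by (simp add: i_def \<rho>0)
            then have "initial_prob q s (?\<rho> y) (?\<rho>' x) (\<kappa>, \<mu>, \<Lambda>) (1 - h, i + (1 - h)) = kern z (x, y)"
              unfolding ip ii unfolding kern_cell[of z x y v h, OF zxy] \<rho>1(1)[OF 3(2)]
              using 3 valid h1 kernel_left[of "u y" \<beta> i "1 - h"] u[OF 3(2)] \<beta> by (auto simp: \<rho>0)
            moreover have "r (\<kappa>, \<mu>, \<Lambda>) = (1 - h, i + (1 - h))" using 3 unfolding r by simp
            ultimately show ?thesis unfolding inp by metis
          next
            case 4
            have J1: "J x y 0 \<omega> = 0 \<or> J x y 0 \<omega> = 1" using SJ(3)[of y x] 4 by linarith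
            have i1: "i' = 0 \<or> i' = 1" using SJ(3)[of y "x - 1"] 4 by (auto simp: i'_def)
            have h1: "h = 0 \<or> h = 1" using valid 4 by linarith
            \<comment> \<open>On the event A the lower and the left cell have the values prescribed
              by z, and these encode i and i'.\<close>
            have zi: "fst (z (x, y - 1)) = i" "snd (z (x - 1, y)) = 1 - i'"
              using AZ[OF \<omega>A, of "(x, y - 1)"] AZ[OF \<omega>A, of "(x - 1, y)"] prod_encode_pred[of y x] prod_encode_pred(2)[of x y] 4 n Zxy[of x "y - 1"] Zxy[of "x - 1" y]
              by (auto simp: i_def i'_def split: if_splits)
            have "Z (x, y) \<omega> = z (x, y) \<longleftrightarrow> (J x y 0 \<omega>, J' x y 0 \<omega>) = r (\<kappa>, \<mu>, \<Lambda>)"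
              using 4 J1 h1 unfolding Zxy zxy r by auto
            moreover have "b_col q s (sqW (\<theta> x)) i \<noteq> 0" using SJ(5)[of x "y - 1"] 4 \<rho>1 by (simp add: i_def)
            moreover have "b_row q (sHL (u y)) i' \<noteq> 0" using SJ(4)[of y "x - 1"] 4 \<rho>1 by (simp add: i'_def)
            ultimately have "initial_prob q s (?\<rho> y) (?\<rho>' x) (\<kappa>, \<mu>, \<Lambda>) (1 - h, v) = hs_weight q s (u y) (\<theta> x) (i, 1 - i') (v, 1 - (1 - h))"
              unfolding ip unfolding \<rho>1(1)[OF 4(2)] \<rho>1(2)[OF 4(1)]
              using h1 i1 u[OF 4(2)] \<theta>[OF 4(1)] by (intro kernel_bulk) auto
            also have "1 - (1 - h) = h" using h1 by auto
            also have "hs_weight q s (u y) (\<theta> x) (i, 1 - i') (v, h) = kern z (x, y)"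
              unfolding kern_cell[of z x y v h, OF zxy] zi using 4 by simp
            finally have "initial_prob q s (?\<rho> y) (?\<rho>' x) (\<kappa>, \<mu>, \<Lambda>) (1 - h, v) = kern z (x, y)" .
            moreover have "r (\<kappa>, \<mu>, \<Lambda>) = (1 - h, v)" using 4 unfolding r by simp
            moreover note \<open>Z (x, y) \<omega> = z (x, y) \<longleftrightarrow> _\<close>
            ultimately show ?thesis unfolding inp by metis
          qed
        qed
      qed
    qed
    have "{\<omega> \<in> space M. \<forall>i\<in>{..<Suc n}. Z (prod_decode i) \<omega> = z (prod_decode i)} = A \<inter> {\<omega> \<in> space M. Z (x, y) \<omega> = z (x, y)}"
      by (auto simp: A_def lessThan_Suc xy)
    then show ?case by (simp only: step Suc[folded A_def] prod.lessThan_Suc xy)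
  qed
  have "AE \<omega> in M. \<forall>x y. int y - int (size (\<eta> x y \<omega>)) = height (\<lambda>p. Z p \<omega>) x y"
    using OK
  proof (eventually_elim, intro allI)
    fix \<omega> x y assume ok: "OK \<omega>"
    have SJ: "S x y \<omega> = (if y = 0 then 0 else S x (y - 1) \<omega>) + J x y 0 \<omega>"
      "S x y \<omega> = (if x = 0 then 0 else S (x - 1) y \<omega>) + J' x y 0 \<omega>"
      "1 \<le> y \<Longrightarrow> J x y 0 \<omega> \<le> 1" for x y
      using ok unfolding OK_def by blast+
    have Z0: "fst (Z (0, 0) \<omega>) = J 0 0 0 \<omega>" by (simp add: Z_def zcell_def field_data_def)
    have Zx: "1 \<le> k \<Longrightarrow> fst (Z (k, 0) \<omega>) = J' k 0 0 \<omega>" for k by (simp add: Z_def zcell_def field_data_def)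
    have Zy: "1 \<le> k \<Longrightarrow> snd (Z (x, k) \<omega>) = 1 - J x k 0 \<omega>" for k by (simp add: Z_def zcell_def field_data_def)
    have Sx: "S x 0 \<omega> = J 0 0 0 \<omega> + (\<Sum>k=1..x. fst (Z (k, 0) \<omega>))" for x
    proof (induction x)
      case 0
      then show ?case using SJ(1)[of 0 0] by simp
    next
      case (Suc x)
      then show ?case using SJ(2)[of "Suc x" 0] Zx[of "Suc x"] by simp
    qed
    \<comment> \<open>Going up a column, each level adds one part exactly when its horizontal edge
      is empty.\<close>
    have "int (S x y \<omega>) = int (S x 0 \<omega>) + int y - int (card {k \<in> {1..y}. snd (Z (x, k) \<omega>) = 1})" for y
    proof (induction y)
      case (Suc y)
      have zs: "snd (Z (x, Suc y) \<omega>) = 1 - J x (Suc y) 0 \<omega>" by (rule Zy) simp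
      have js: "J x (Suc y) 0 \<omega> \<le> 1" by (rule SJ(3)) simp
      have "{k \<in> {1..Suc y}. snd (Z (x, k) \<omega>) = 1} = (if J x (Suc y) 0 \<omega> = 0 then insert (Suc y) {k \<in> {1..y}. snd (Z (x, k) \<omega>) = 1} else {k \<in> {1..y}. snd (Z (x, k) \<omega>) = 1})"
        using zs js by (auto simp: le_Suc_eq)
      then show ?case using Suc SJ(1)[of x "Suc y"] js by auto
    qed simp
    then show "int y - int (size (\<eta> x y \<omega>)) = height (\<lambda>p. Z p \<omega>) x y"
      using Sx[of x] by (simp add: height_def Z0 S_def)
  qed
  then show ?thesis using Zm law by blast
qed

end

section \<open>The law of the vertex model\<close>

definition wcell :: "(nat \<Rightarrow> nat \<Rightarrow> 'b \<Rightarrow> nat) \<Rightarrow> (nat \<Rightarrow> nat \<Rightarrow> 'b \<Rightarrow> nat) \<Rightarrow> ('b \<Rightarrow> nat) \<Rightarrow> nat \<times> nat \<Rightarrow> 'b \<Rightarrow> nat \<times> nat" where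
  "wcell V H P = (\<lambda>(x, y) \<omega>. if x = 0 \<and> y = 0 then (P \<omega>, 0) else if y = 0 then (V x 0 \<omega>, 0)
     else if x = 0 then (0, H 0 y \<omega>) else (V x y \<omega>, H x y \<omega>))"

fun bcell :: "nat + nat \<Rightarrow> nat \<times> nat" where
  "bcell (Inl x) = (x, 0)"
| "bcell (Inr y) = (0, y)"

fun bval :: "(nat \<times> nat \<Rightarrow> nat \<times> nat) \<Rightarrow> nat + nat \<Rightarrow> nat" where
  "bval z (Inl x) = fst (z (x, 0))"
| "bval z (Inr y) = snd (z (0, y))"

context hs_setup
begin

text \<open>The boundary variables are given jointly and not one after the other, so the event is
  split in three: the boundary by independence, the interior cells by the chain rule in the order of
  their codes, and finally P, which is independent of the model.\<close>

lemma hs_law: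
  assumes model: "hs_model N q s u \<theta> \<alpha> \<beta> V H" and P: "q_poisson N q (\<alpha> * \<beta>) P" and ind: "indep_of_model N P V H"
  shows "wcell V H P p \<in> N \<rightarrow>\<^sub>M count_space UNIV"
    and "measure N {\<omega> \<in> space N. \<forall>i\<in>{..<n}. wcell V H P (prod_decode i) \<omega> = z (prod_decode i)} = (\<Prod>i<n. kern z (prod_decode i))"
    and "hs_height V H x y \<omega> - int (P \<omega>) = height (\<lambda>p. wcell V H P p \<omega>) x y"
proof -
  let ?W = "wcell V H P"
  interpret prob_space N using model by (simp add: hs_model_def)
  have Vm: "1 \<le> x \<Longrightarrow> V x y \<in> N \<rightarrow>\<^sub>M count_space UNIV" and Hm: "1 \<le> y \<Longrightarrow> H x y \<in> N \<rightarrow>\<^sub>M count_space UNIV" for x y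
    using model unfolding hs_model_def by blast+
  have H01: "1 \<le> y \<Longrightarrow> \<omega> \<in> space N \<Longrightarrow> H x y \<omega> \<in> {0, 1}" for x y \<omega>
    using model unfolding hs_model_def by blast
  have bind: "indep_vars (\<lambda>_. count_space UNIV) (\<lambda>e. case e of Inl x \<Rightarrow> V x 0 | Inr y \<Rightarrow> H 0 y) (Inl ` {1..} \<union> Inr ` {1..})"
    using model unfolding hs_model_def by blast
  have Vlaw: "1 \<le> x \<Longrightarrow> measure N {\<omega> \<in> space N. V x 0 \<omega> = k} =
        (\<alpha> * \<theta> x) ^ k * qpoch q (- s / \<theta> x) (int k) / qpoch q q (int k) *
        (qpoch_inf q (\<alpha> * \<theta> x) / qpoch_inf q (- s * \<alpha>))" for x k
    using model unfolding hs_model_def by blast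
  have Hlaw: "1 \<le> y \<Longrightarrow> measure N {\<omega> \<in> space N. H 0 y \<omega> = 1} = 1 / (1 + u y * \<beta>)" for y
    using model unfolding hs_model_def by blast
  have smp: "1 \<le> x \<Longrightarrow> 1 \<le> y \<Longrightarrow> sampled N (hs_past N V H x y)
        (\<lambda>\<omega>. (V x (y - 1) \<omega>, H (x - 1) y \<omega>)) (\<lambda>\<omega>. (V x y \<omega>, H x y \<omega>))
        (hs_weight q s (u y) (\<theta> x))" for x y
    using model unfolding hs_model_def by blast
  have Pm: "P \<in> N \<rightarrow>\<^sub>M count_space UNIV"
    and Plaw: "measure N {\<omega> \<in> space N. P \<omega> = k} = (\<alpha> * \<beta>) ^ k / qpoch q q (int k) * qpoch_inf q (\<alpha> * \<beta>)" for k
    using P unfolding q_poisson_def by blast+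
  have pairm: "(\<lambda>\<omega>. (f \<omega>, g \<omega>)) \<in> N \<rightarrow>\<^sub>M count_space UNIV"
    if "f \<in> N \<rightarrow>\<^sub>M count_space UNIV" "g \<in> N \<rightarrow>\<^sub>M count_space UNIV" for f g :: "'a \<Rightarrow> nat"
    using measurable_Pair[OF that] by (simp add: pair_measure_countable)
  show Wm: "?W p \<in> N \<rightarrow>\<^sub>M count_space UNIV" for p
  proof -
    obtain x y where p: "p = (x, y)" by (cases p)
    consider "x = 0" "y = 0" | "1 \<le> x" "y = 0" | "x = 0" "1 \<le> y" | "1 \<le> x" "1 \<le> y" by linarith
    then show ?thesis
    proof cases
      case 1
      then have "?W p = (\<lambda>\<omega>. (P \<omega>, 0))" by (simp add: p wcell_def fun_eq_iff)
      then show ?thesis using pairm[OF Pm measurable_const[of 0]] by simp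
    next
      case 2
      then have "?W p = (\<lambda>\<omega>. (V x 0 \<omega>, 0))" by (simp add: p wcell_def fun_eq_iff)
      then show ?thesis using pairm[OF Vm[OF 2(1)] measurable_const[of 0]] by simp
    next
      case 3
      then have "?W p = (\<lambda>\<omega>. (0, H 0 y \<omega>))" by (simp add: p wcell_def fun_eq_iff)
      then show ?thesis using pairm[OF measurable_const[of 0] Hm[OF 3(2)]] by simp
    next
      case 4
      then have "?W p = (\<lambda>\<omega>. (V x y \<omega>, H x y \<omega>))" by (simp add: p wcell_def fun_eq_iff)
      then show ?thesis using pairm[OF Vm[OF 4(1)] Hm[OF 4(2)]] by simp
    qed
  qed
  show "hs_height V H x y \<omega> - int (P \<omega>) = height (\<lambda>p. ?W p \<omega>) x y"
  proof -
    have "{k \<in> {1..y}. snd (?W (x, k) \<omega>) = 1} = {k \<in> {1..y}. H x k \<omega> = 1}" by (auto simp: wcell_def)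
    moreover have "(\<Sum>k=1..x. fst (?W (k, 0) \<omega>)) = (\<Sum>k=1..x. V k 0 \<omega>)" by (rule sum.cong) (auto simp: wcell_def)
    ultimately show ?thesis by (simp add: height_def hs_height_def wcell_def)
  qed
  define X where "X e = (case e of Inl x \<Rightarrow> V x 0 | Inr y \<Rightarrow> H 0 y)" for e
  \<comment> \<open>The boundary edges whose cells have codes below n; the origin is left out
    because it carries P.\<close>
  define B where "B = {e \<in> Inl ` {1..} \<union> Inr ` {1..}. prod_encode (bcell e) < n}"
  define interior where "interior p \<longleftrightarrow> 1 \<le> fst p \<and> 1 \<le> snd p" for p :: "nat \<times> nat"
  have B_cases: "(\<exists>x\<ge>1. e = Inl x) \<or> (\<exists>y\<ge>1. e = Inr y)" if "e \<in> B" for e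
    using that by (auto simp: B_def)
  have inj_b: "inj_on (\<lambda>e. prod_encode (bcell e)) B"
  proof (rule inj_onI)
    fix e e' assume "e \<in> B" "e' \<in> B" "prod_encode (bcell e) = prod_encode (bcell e')"
    then have "bcell e = bcell e'" by (metis prod_encode_inverse)
    then show "e = e'" using B_cases[OF \<open>e \<in> B\<close>] B_cases[OF \<open>e' \<in> B\<close>] by auto
  qed
  have finB: "finite B"
    by (rule inj_on_finite[OF inj_b, of "{..<n}"]) (auto simp: B_def)
  have bd: "{i \<in> {..<n}. \<not> interior (prod_decode i)} = (if n = 0 then {} else insert 0 ((\<lambda>e. prod_encode (bcell e)) ` B))"
  proof -
    have "i = 0 \<or> i \<in> (\<lambda>e. prod_encode (bcell e)) ` B" if i: "i < n" "\<not> interior (prod_decode i)" for i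
    proof -
      obtain x y where xy: "prod_decode i = (x, y)" by (metis surj_pair)
      then have ie: "i = prod_encode (x, y)" by (metis prod_decode_inverse)
      have "x = 0 \<or> y = 0" using i(2) unfolding xy interior_def by auto
      then consider "x = 0" "y = 0" | "1 \<le> x" "y = 0" | "x = 0" "1 \<le> y" by linarith
      then show ?thesis
      proof cases
        case 1
        then show ?thesis using ie by (simp add: prod_encode_def)
      next
        case 2
        then have "Inl x \<in> B" "i = prod_encode (bcell (Inl x))" using i ie by (auto simp: B_def)
        then show ?thesis by blast
      next
        case 3
        then have "Inr y \<in> B" "i = prod_encode (bcell (Inr y))" using i ie by (auto simp: B_def)
        then show ?thesis by blast
      qed
    qed
    moreover have "prod_decode 0 = (0, 0)" using prod_encode_inverse[of "(0, 0)"] by (simp add: prod_encode_def)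
    moreover have "\<not> interior (bcell e)" for e by (cases e) (simp_all add: interior_def)
    ultimately show ?thesis by (auto simp: B_def interior_def)
  qed
  have pd0: "prod_decode 0 = (0, 0)" using prod_encode_inverse[of "(0, 0)"] by (simp add: prod_encode_def)
  have zero_notin: "0 \<notin> (\<lambda>e. prod_encode (bcell e)) ` B"
  proof
    assume "0 \<in> (\<lambda>e. prod_encode (bcell e)) ` B"
    then obtain e where e: "e \<in> B" "prod_encode (bcell e) = 0" by auto
    then have "bcell e = (0, 0)" using prod_encode_inverse[of "bcell e"] pd0 by simp
    then show False using B_cases[OF e(1)] by auto
  qed
  show "measure N {\<omega> \<in> space N. \<forall>i\<in>{..<n}. ?W (prod_decode i) \<omega> = z (prod_decode i)} = (\<Prod>i<n. kern z (prod_decode i))"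
  proof (cases "\<forall>i<n. (snd (prod_decode i) = 0 \<longrightarrow> snd (z (prod_decode i)) = 0) \<and>
      (fst (prod_decode i) = 0 \<and> 1 \<le> snd (prod_decode i) \<longrightarrow> fst (z (prod_decode i)) = 0)")
    case False
    then obtain i where i: "i < n" "(snd (prod_decode i) = 0 \<and> snd (z (prod_decode i)) \<noteq> 0) \<or>
      (fst (prod_decode i) = 0 \<and> 1 \<le> snd (prod_decode i) \<and> fst (z (prod_decode i)) \<noteq> 0)" by blast
    obtain x y where xy: "prod_decode i = (x, y)" by (metis surj_pair)
    obtain v h where z: "z (x, y) = (v, h)" by (metis surj_pair)
    have inv: "(y = 0 \<and> h \<noteq> 0) \<or> (x = 0 \<and> 1 \<le> y \<and> v \<noteq> 0)" using i(2) unfolding xy z by simp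
    have "kern z (prod_decode i) = 0"
      unfolding xy kern_cell[of z x y v h, OF z] using inv by auto
    then have "(\<Prod>i<n. kern z (prod_decode i)) = 0" using i(1) by auto
    moreover have "?W (prod_decode i) \<omega> \<noteq> z (prod_decode i)" for \<omega>
      unfolding xy z using inv by (auto simp: wcell_def)
    then have "{\<omega> \<in> space N. \<forall>i\<in>{..<n}. ?W (prod_decode i) \<omega> = z (prod_decode i)} = {}" using i(1) by blast
    ultimately show ?thesis by (simp only: measure_empty)
  next
    case True
    have val0: "snd (z (x, 0)) = 0" if "prod_encode (x, 0) < n" for x
      using True[rule_format, OF that] by simp
    have val1: "fst (z (0, y)) = 0" if "prod_encode (0, y) < n" "1 \<le> y" for y
      using True[rule_format, OF that(1)] that(2) by simp
    \<comment> \<open>The whole boundary up to code n is imposed before any interior cell; this is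
      compatible with \<open>hs_past\<close>, which contains all boundary variables.\<close>
    define Bn where "Bn = {\<omega> \<in> space N. \<forall>e\<in>B. X e \<omega> = bval z e}"
    define In where "In m = {\<omega> \<in> space N. \<forall>i\<in>{..<m}. interior (prod_decode i) \<longrightarrow> ?W (prod_decode i) \<omega> = z (prod_decode i)}" for m
    have BW: "X e \<omega> = bval z e \<longleftrightarrow> ?W (bcell e) \<omega> = z (bcell e)" if e: "e \<in> B" for e \<omega>
    proof -
      have lt: "prod_encode (bcell e) < n" using e by (simp add: B_def)
      from B_cases[OF e] show ?thesis
      proof (elim disjE exE conjE)
        fix x assume x: "1 \<le> x" "e = Inl x"
        then show ?thesis using val0[of x] lt by (cases "z (x, 0)") (auto simp: X_def wcell_def)
      next
        fix y assume y: "1 \<le> y" "e = Inr y"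
        then show ?thesis using val1[of y] lt by (cases "z (0, y)") (auto simp: X_def wcell_def)
      qed
    qed
    have Xlaw: "measure N (X e -` {bval z e} \<inter> space N) = kern z (bcell e)" if e: "e \<in> B" for e
    proof -
      have lt: "prod_encode (bcell e) < n" using e by (simp add: B_def)
      from B_cases[OF e] show ?thesis
      proof (elim disjE exE conjE)
        fix x assume x: "1 \<le> x" "e = Inl x"
        have zx: "z (x, 0) = (fst (z (x, 0)), 0)" using val0[of x] lt x by (metis bcell.simps(1) prod.collapse)
        have "X e -` {bval z e} \<inter> space N = {\<omega> \<in> space N. V x 0 \<omega> = fst (z (x, 0))}" by (auto simp: X_def x)
        then show ?thesis using x Vlaw[OF x(1), of "fst (z (x, 0))"] kern_cell[of z x 0 "fst (z (x, 0))" 0, OF zx]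
          by (simp add: qpoch_nat)
      next
        fix y assume y: "1 \<le> y" "e = Inr y"
        have zy: "z (0, y) = (0, snd (z (0, y)))" using val1[of y] lt y by (metis bcell.simps(2) prod.collapse)
        define h where "h = snd (z (0, y))"
        have ev: "X e -` {bval z e} \<inter> space N = {\<omega> \<in> space N. H 0 y \<omega> = h}" by (auto simp: X_def y h_def)
        have k: "kern z (bcell e) = (if h \<le> 1 then (if h = 1 then 1 else u y * \<beta>) / (1 + u y * \<beta>) else 0)"
          using y kern_cell[of z 0 y 0 h, OF zy[folded h_def]] by simp
        have pos: "0 < 1 + u y * \<beta>" using u[OF y(1)] \<beta> by (simp add: add_pos_nonneg)
        have m1: "{\<omega> \<in> space N. H 0 y \<omega> = 1} \<in> sets N" by (rule Collect_in_sets[OF Hm[OF y(1)]])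
        consider "h = 1" | "h = 0" | "1 < h" by linarith
        then show ?thesis
        proof cases
          case 1
          then show ?thesis unfolding ev k using Hlaw[OF y(1)] by simp
        next
          case 2
          have "{\<omega> \<in> space N. H 0 y \<omega> = 0} = space N - {\<omega> \<in> space N. H 0 y \<omega> = 1}" using H01[OF y(1)] by auto
          then have "measure N {\<omega> \<in> space N. H 0 y \<omega> = 0} = 1 - 1 / (1 + u y * \<beta>)"
            using prob_compl[OF m1] Hlaw[OF y(1)] by simp
          also have "\<dots> = u y * \<beta> / (1 + u y * \<beta>)" using pos by (simp add: divide_simps)
          finally show ?thesis unfolding ev k using 2 by simp
        next
          case 3
          have "H 0 y \<omega> \<noteq> h" if "\<omega> \<in> space N" for \<omega> using H01[OF y(1) that, of 0] 3 by auto
          then have e: "{\<omega> \<in> space N. H 0 y \<omega> = h} = {}" by blast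
          show ?thesis unfolding ev k e using 3 by simp
        qed
      qed
    qed
    have Bn_law: "measure N Bn = (\<Prod>e\<in>B. kern z (bcell e))"
    proof (cases "B = {}")
      case True
      then show ?thesis by (simp add: Bn_def prob_space)
    next
      case False
      have "Bn = (\<Inter>e\<in>B. X e -` {bval z e} \<inter> space N)" using False by (auto simp: Bn_def)
      moreover have "prob (\<Inter>e\<in>B. X e -` {bval z e} \<inter> space N) = (\<Prod>e\<in>B. prob (X e -` {bval z e} \<inter> space N))"
        unfolding X_def by (rule indep_varsD[OF bind False finB]) (auto simp: B_def)
      ultimately show ?thesis using Xlaw by simp
    qed
    let ?model = "{V x y | x y. 1 \<le> x} \<union> {H x y | x y. 1 \<le> y}"
    have Bn_gen: "Bn \<in> gen_by N Xs" if "\<And>x. 1 \<le> x \<Longrightarrow> V x 0 \<in> Xs" "\<And>y. 1 \<le> y \<Longrightarrow> H 0 y \<in> Xs" for Xs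
      unfolding Bn_def
    proof (rule gen_by_Ball[OF finB])
      fix e assume "e \<in> B"
      then have "X e \<in> Xs" using B_cases[of e] that by (auto simp: X_def)
      then show "{\<omega> \<in> space N. X e \<omega> = bval z e} \<in> gen_by N Xs" by (rule gen_by_Collect)
    qed
    have In_gen: "In m \<in> gen_by N Xs"
      if Xs: "\<And>x y. 1 \<le> x \<Longrightarrow> 1 \<le> y \<Longrightarrow> prod_encode (x, y) < m \<Longrightarrow> V x y \<in> Xs \<and> H x y \<in> Xs" for Xs m
      unfolding In_def
    proof (rule gen_by_Ball)
      fix i assume i: "i \<in> {..<m}"
      obtain x y where xy: "prod_decode i = (x, y)" by (metis surj_pair)
      then have ie: "i = prod_encode (x, y)" by (metis prod_decode_inverse)
      show "{\<omega> \<in> space N. interior (prod_decode i) \<longrightarrow> ?W (prod_decode i) \<omega> = z (prod_decode i)} \<in> gen_by N Xs"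
      proof (cases "interior (x, y)")
        case False
        then show ?thesis using gen_by_space[of N Xs] by (simp add: xy)
      next
        case int: True
        then have "V x y \<in> Xs" "H x y \<in> Xs" using Xs[of x y] i ie by (auto simp: interior_def)
        then have "{\<omega> \<in> space N. V x y \<omega> = fst (z (x, y))} \<inter> {\<omega> \<in> space N. H x y \<omega> = snd (z (x, y))} \<in> gen_by N Xs"
          by (intro gen_by_Int gen_by_Collect)
        moreover have "{\<omega> \<in> space N. interior (prod_decode i) \<longrightarrow> ?W (prod_decode i) \<omega> = z (prod_decode i)} =
          {\<omega> \<in> space N. V x y \<omega> = fst (z (x, y))} \<inter> {\<omega> \<in> space N. H x y \<omega> = snd (z (x, y))}"
          using int unfolding xy by (cases "z (x, y)") (auto simp: wcell_def interior_def)
        ultimately show ?thesis by simp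
      qed
    qed simp
    have model_sets: "gen_by N ?model \<subseteq> sets N" by (rule gen_by_sets) (use Vm Hm in blast)
    have BI_gen: "Bn \<inter> In m \<in> gen_by N ?model" for m
      by (intro gen_by_Int Bn_gen In_gen) blast+
    \<comment> \<open>The restriction to m at most n guarantees that the boundary inputs of the
      cells treated here are already fixed by \<open>Bn\<close>.\<close>
    have law: "measure N (Bn \<inter> In m) = (\<Prod>e\<in>B. kern z (bcell e)) * (\<Prod>i<m. if interior (prod_decode i) then kern z (prod_decode i) else 1)"
      if "m \<le> n" for m
      using that
    proof (induction m)
      case 0
      have "Bn \<inter> In 0 = Bn" by (auto simp: Bn_def In_def)
      then show ?case using Bn_law by simp
    next
      case (Suc m)
      then have IH: "measure N (Bn \<inter> In m) = (\<Prod>e\<in>B. kern z (bcell e)) * (\<Prod>i<m. if interior (prod_decode i) then kern z (prod_decode i) else 1)"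
        and mn: "m < n" by simp_all
      obtain x y where xy: "prod_decode m = (x, y)" by (metis surj_pair)
      then have me: "m = prod_encode (x, y)" by (metis prod_decode_inverse)
      show ?case
      proof (cases "interior (x, y)")
        case False
        then have "In (Suc m) = In m" by (auto simp: In_def lessThan_Suc xy)
        then show ?thesis using IH False by (simp add: xy)
      next
        case True
        then have x: "1 \<le> x" and y: "1 \<le> y" by (simp_all add: interior_def)
        have less: "x' + y' \<le> x + y \<and> (x', y') \<noteq> (x, y)" if "prod_encode (x', y') < m" for x' y'
          using prod_encode_less[of x' y' x y] that me by simp
        have past: "Bn \<inter> In m \<in> hs_past N V H x y"
          unfolding hs_past_def
        proof (intro gen_by_Int Bn_gen In_gen)
          fix x' y' assume a: "1 \<le> x'" "1 \<le> y'" "prod_encode (x', y') < m"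
          then have "(x', y') \<in> {(x', y'). 1 \<le> x' \<and> 1 \<le> y' \<and> x' + y' \<le> x + y \<and> (x', y') \<noteq> (x, y)}" using less by simp
          then show "V x' y' \<in> {V x' 0 |x'. 1 \<le> x'} \<union> {H 0 y' |y'. 1 \<le> y'} \<union>
            (\<Union>(x', y')\<in>{(x', y'). 1 \<le> x' \<and> 1 \<le> y' \<and> x' + y' \<le> x + y \<and> (x', y') \<noteq> (x, y)}. {V x' y', H x' y'}) \<and>
            H x' y' \<in> {V x' 0 |x'. 1 \<le> x'} \<union> {H 0 y' |y'. 1 \<le> y'} \<union>
            (\<Union>(x', y')\<in>{(x', y'). 1 \<le> x' \<and> 1 \<le> y' \<and> x' + y' \<le> x + y \<and> (x', y') \<noteq> (x, y)}. {V x' y', H x' y'})"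
            by blast
        qed blast+
        \<comment> \<open>The origin is excluded since neither \<open>Bn\<close> nor
          \<open>In m\<close> restricts P. No vertex with x, y at least 1 takes its input from
          there.\<close>
        have Wz: "?W p \<omega> = z p" if \<omega>: "\<omega> \<in> Bn \<inter> In m" and p: "prod_encode p < m" "p \<noteq> (0, 0)" for p \<omega>
        proof -
          obtain x' y' where p': "p = (x', y')" by (cases p)
          show ?thesis
          proof (cases "interior p")
            case True
            then show ?thesis using \<omega> p(1) prod_encode_inverse[of p] unfolding In_def by (metis (mono_tags, lifting) Int_iff lessThan_iff mem_Collect_eq)
          next
            case False
            then obtain e where e: "e \<in> B" "p = bcell e"
            proof (cases "y' = 0")
              case True
              then have "Inl x' \<in> B" using p p' mn by (auto simp: B_def)
              then show ?thesis using that True p' by auto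
            next
              case False': False
              then have "x' = 0" using False p' by (simp add: interior_def)
              then have "Inr y' \<in> B" using p p' mn False' by (auto simp: B_def)
              then show ?thesis using that \<open>x' = 0\<close> p' by auto
            qed
            then show ?thesis using \<omega> BW[OF e(1)] by (auto simp: Bn_def)
          qed
        qed
        have pair: "{\<omega> \<in> space N. (V x' y' \<omega>, H x'' y'' \<omega>) = a} \<in> sets N" if "1 \<le> x'" "1 \<le> y''" for x' y' x'' y'' a
          using that by (intro Collect_pair_sets Collect_in_sets[OF Vm] Collect_in_sets[OF Hm])
        have kz: "hs_weight q s (u y) (\<theta> x) (fst (z (x, y - 1)), snd (z (x - 1, y))) (z (x, y)) = kern z (x, y)"
        proof -
          obtain v h where vh: "z (x, y) = (v, h)" by (metis surj_pair)
          show ?thesis unfolding kern_cell[of z x y v h, OF vh] vh using x y by simp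
        qed
        have "measure N ((Bn \<inter> In m) \<inter> {\<omega> \<in> space N. ?W (x, y) \<omega> = z (x, y)}) = measure N (Bn \<inter> In m) * kern z (x, y)"
        proof (rule sampled_kernel[OF prob_space_axioms smp[OF x y] past _ pair[OF x y] pair[OF x y] Collect_in_sets[OF Wm] _ _ kern_nonneg, where r = "\<lambda>_. z (x, y)"])
          show "Bn \<inter> In m \<in> sets N" using BI_gen model_sets by blast
          show "AE \<omega> in N. \<omega> \<in> Bn \<inter> In m \<longrightarrow> (?W (x, y) \<omega> = z (x, y) \<longleftrightarrow> (V x y \<omega>, H x y \<omega>) = z (x, y)) \<and>
             hs_weight q s (u y) (\<theta> x) (V x (y - 1) \<omega>, H (x - 1) y \<omega>) (z (x, y)) = kern z (x, y)"
          proof (intro AE_I2 impI conjI)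
            fix \<omega> assume \<omega>: "\<omega> \<in> Bn \<inter> In m"
            show "?W (x, y) \<omega> = z (x, y) \<longleftrightarrow> (V x y \<omega>, H x y \<omega>) = z (x, y)"
              using x y by (simp add: wcell_def)
            have "?W (x, y - 1) \<omega> = z (x, y - 1)" "?W (x - 1, y) \<omega> = z (x - 1, y)"
              using Wz[OF \<omega>] prod_encode_pred(1)[OF y, of x] prod_encode_pred(2)[OF x, of y] me x y by auto
            moreover have "fst (?W (x, y - 1) \<omega>) = V x (y - 1) \<omega>" "snd (?W (x - 1, y) \<omega>) = H (x - 1) y \<omega>"
              using x y by (auto simp: wcell_def)
            ultimately show "hs_weight q s (u y) (\<theta> x) (V x (y - 1) \<omega>, H (x - 1) y \<omega>) (z (x, y)) = kern z (x, y)"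
              using kz by simp
          qed
        qed simp
        moreover have "Bn \<inter> In (Suc m) = (Bn \<inter> In m) \<inter> {\<omega> \<in> space N. ?W (x, y) \<omega> = z (x, y)}"
          using True by (auto simp: In_def lessThan_Suc xy)
        ultimately show ?thesis using IH True by (simp add: xy)
      qed
    qed
    show ?thesis
    proof (cases "n = 0")
      case True
      then show ?thesis by (simp add: prob_space)
    next
      case False
      have z0: "z (0, 0) = (fst (z (0, 0)), 0)" using val0[of 0] False by (metis prod.collapse pd0 prod_decode_inverse gr0I)
      have k0: "measure N {\<omega> \<in> space N. P \<omega> = fst (z (0, 0))} = kern z (0, 0)"
        unfolding kern_cell[of z 0 0 "fst (z (0, 0))" 0, OF z0] using Plaw[of "fst (z (0, 0))"] by (simp add: qpoch_nat)
      have "{\<omega> \<in> space N. \<forall>i\<in>{..<n}. ?W (prod_decode i) \<omega> = z (prod_decode i)} =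
        {\<omega> \<in> space N. P \<omega> = fst (z (0, 0))} \<inter> (Bn \<inter> In n)"
      proof -
        have W0: "?W (0, 0) \<omega> = z (0, 0) \<longleftrightarrow> P \<omega> = fst (z (0, 0))" for \<omega>
          using z0 by (cases "z (0, 0)") (auto simp: wcell_def)
        have "(\<forall>i\<in>{..<n}. ?W (prod_decode i) \<omega> = z (prod_decode i)) \<longleftrightarrow>
          (\<forall>i\<in>{i \<in> {..<n}. \<not> interior (prod_decode i)}. ?W (prod_decode i) \<omega> = z (prod_decode i)) \<and>
          (\<forall>i\<in>{..<n}. interior (prod_decode i) \<longrightarrow> ?W (prod_decode i) \<omega> = z (prod_decode i))" for \<omega>
          by blast
        moreover have "(\<forall>i\<in>{i \<in> {..<n}. \<not> interior (prod_decode i)}. ?W (prod_decode i) \<omega> = z (prod_decode i)) \<longleftrightarrow>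
          P \<omega> = fst (z (0, 0)) \<and> (\<forall>e\<in>B. X e \<omega> = bval z e)" for \<omega>
          unfolding bd using False BW W0 by (simp add: pd0)
        ultimately show ?thesis unfolding Bn_def In_def by blast
      qed
      moreover have "measure N ({\<omega> \<in> space N. P \<omega> = fst (z (0, 0))} \<inter> (Bn \<inter> In n)) =
        measure N {\<omega> \<in> space N. P \<omega> = fst (z (0, 0))} * measure N (Bn \<inter> In n)"
        by (rule indep_setD[OF ind[unfolded indep_of_model_def] gen_by_Collect BI_gen]) simp
      moreover have "(\<Prod>i<n. kern z (prod_decode i)) =
        (\<Prod>i<n. if interior (prod_decode i) then 1 else kern z (prod_decode i)) * (\<Prod>i<n. if interior (prod_decode i) then kern z (prod_decode i) else 1)"
        unfolding prod.distrib[symmetric] by (rule prod.cong) auto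
      moreover have "(\<Prod>i<n. if interior (prod_decode i) then 1 else kern z (prod_decode i)) =
        kern z (0, 0) * (\<Prod>e\<in>B. kern z (bcell e))"
      proof -
        have "(\<Prod>i<n. if interior (prod_decode i) then 1 else kern z (prod_decode i)) =
          (\<Prod>i\<in>{i \<in> {..<n}. \<not> interior (prod_decode i)}. kern z (prod_decode i))"
          by (rule prod.mono_neutral_cong_right) auto
        also have "\<dots> = kern z (0, 0) * (\<Prod>i\<in>(\<lambda>e. prod_encode (bcell e)) ` B. kern z (prod_decode i))"
          unfolding bd using False zero_notin finB by (simp add: pd0)
        also have "(\<Prod>i\<in>(\<lambda>e. prod_encode (bcell e)) ` B. kern z (prod_decode i)) = (\<Prod>e\<in>B. kern z (bcell e))"
          by (subst prod.reindex[OF inj_b]) simp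
        finally show ?thesis .
      qed
      ultimately show ?thesis using k0 law[of n] by (simp add: mult_ac)
    qed
  qed
qed

end

section \<open>From the law of the cells to the law of the height field\<close>

definition cell_list :: "nat \<Rightarrow> (nat \<times> nat \<Rightarrow> nat \<times> nat) \<Rightarrow> (nat \<times> nat) list" where
  "cell_list n f = map (\<lambda>i. f (prod_decode i)) [0..<n]"

lemma cell_list_eq_iff:
  "cell_list n f = xs \<longleftrightarrow> length xs = n \<and> (\<forall>i\<in>{..<n}. f (prod_decode i) = xs ! prod_encode (prod_decode i))"
  unfolding cell_list_def list_eq_iff_nth_eq by auto

lemma measurable_cell_list:
  assumes Y: "\<And>p. Y p \<in> R \<rightarrow>\<^sub>M count_space UNIV"
  shows "(\<lambda>\<omega>. cell_list n (\<lambda>p. Y p \<omega>)) \<in> R \<rightarrow>\<^sub>M count_space UNIV"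
proof (subst measurable_count_space_eq2_countable, intro conjI ballI)
  fix xs :: "(nat \<times> nat) list"
  have "{\<omega> \<in> space R. \<forall>i\<in>{..<n}. Y (prod_decode i) \<omega> = xs ! prod_encode (prod_decode i)} \<in> sets R"
    by (intro sets.sets_Collect_finite_All Collect_in_sets[OF Y]) auto
  then have "{\<omega> \<in> space R. cell_list n (\<lambda>p. Y p \<omega>) = xs} \<in> sets R"
    unfolding cell_list_eq_iff by (cases "length xs = n") simp_all
  then show "(\<lambda>\<omega>. cell_list n (\<lambda>p. Y p \<omega>)) -` {xs} \<inter> space R \<in> sets R"
    by (simp add: vimage_def Int_def conj_commute)
qed auto

text \<open>The height at one point involves finitely many cells, so it factors through a list of
  initial cells. Such lists form a countable type, where point masses determine the law.\<close>

lemma height_cell_list: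
  assumes n: "\<And>x' y'. x' \<le> x \<Longrightarrow> y' \<le> y \<Longrightarrow> prod_encode (x', y') < n"
  shows "height f x y = height (\<lambda>p. cell_list n f ! prod_encode p) x y"
proof -
  have nth: "cell_list n f ! prod_encode p = f p" if "prod_encode p < n" for p
    using that by (simp add: cell_list_def)
  have "{k \<in> {1..y}. snd (cell_list n f ! prod_encode (x, k)) = 1} = {k \<in> {1..y}. snd (f (x, k)) = 1}"
    using nth n by auto
  moreover have "(\<Sum>k=1..x. fst (cell_list n f ! prod_encode (k, 0))) = (\<Sum>k=1..x. fst (f (k, 0)))"
    by (rule sum.cong) (use nth n in auto)
  moreover have "cell_list n f ! prod_encode (0, 0) = f (0, 0)" by (rule nth) (rule n, auto)
  ultimately show ?thesis by (simp add: height_def)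
qed

lemma prod_encode_bounded: "\<exists>n. \<forall>x\<le>m. \<forall>y\<le>m. prod_encode (x, y) < n"
proof -
  have "finite (prod_encode ` ({..m} \<times> {..m}))" by simp
  then obtain n where "\<And>k. k \<in> prod_encode ` ({..m} \<times> {..m}) \<Longrightarrow> k < n"
    by (meson finite_nat_set_iff_bounded)
  then show ?thesis by (intro exI[of _ n]) force
qed

lemma measurable_height:
  assumes "\<And>p. Y p \<in> R \<rightarrow>\<^sub>M count_space UNIV"
  shows "(\<lambda>\<omega>. height (\<lambda>p. Y p \<omega>) x y) \<in> R \<rightarrow>\<^sub>M count_space UNIV"
proof -
  obtain n where n: "\<forall>x'\<le>max x y. \<forall>y'\<le>max x y. prod_encode (x', y') < n" using prod_encode_bounded by blast
  have "(\<lambda>xs. height (\<lambda>p. xs ! prod_encode p) x y) \<circ> (\<lambda>\<omega>. cell_list n (\<lambda>p. Y p \<omega>)) \<in> R \<rightarrow>\<^sub>M count_space UNIV"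
    by (rule measurable_comp[OF measurable_cell_list[OF assms]]) simp
  moreover have "(\<lambda>xs. height (\<lambda>p. xs ! prod_encode p) x y) \<circ> (\<lambda>\<omega>. cell_list n (\<lambda>p. Y p \<omega>)) = (\<lambda>\<omega>. height (\<lambda>p. Y p \<omega>) x y)"
    using n by (intro ext) (simp add: o_def, rule height_cell_list[symmetric], auto)
  ultimately show ?thesis by simp
qed

text \<open>Equal point probabilities of the initial lists of cells give equal laws of the lists.
  Each finite-dimensional cylinder event of the height field is, up to a null set, an event about
  one sufficiently long list, and cylinders determine a finite measure on the product space.\<close>

lemma height_law_eqI:
  fixes F :: "'a \<Rightarrow> nat \<times> nat \<Rightarrow> int" and G :: "'b \<Rightarrow> nat \<times> nat \<Rightarrow> int"
  assumes M: "prob_space M" and N: "prob_space N"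
    and Z: "\<And>p. Z p \<in> M \<rightarrow>\<^sub>M count_space UNIV" and W: "\<And>p. W p \<in> N \<rightarrow>\<^sub>M count_space UNIV"
    and eq: "\<And>n z. measure M {\<omega> \<in> space M. \<forall>i\<in>{..<n}. Z (prod_decode i) \<omega> = z (prod_decode i)} =
       measure N {\<omega> \<in> space N. \<forall>i\<in>{..<n}. W (prod_decode i) \<omega> = z (prod_decode i)}"
    and F: "\<And>p. (\<lambda>\<omega>. F \<omega> p) \<in> M \<rightarrow>\<^sub>M count_space UNIV" and G: "\<And>p. (\<lambda>\<omega>. G \<omega> p) \<in> N \<rightarrow>\<^sub>M count_space UNIV"
    and FZ: "AE \<omega> in M. \<forall>x y. F \<omega> (x, y) = height (\<lambda>p. Z p \<omega>) x y"
    and GW: "AE \<omega> in N. \<forall>x y. G \<omega> (x, y) = height (\<lambda>p. W p \<omega>) x y"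
  shows "distr M (\<Pi>\<^sub>M p\<in>UNIV. count_space UNIV) F = distr N (\<Pi>\<^sub>M p\<in>UNIV. count_space UNIV) G"
proof -
  interpret M: prob_space M by (rule M)
  interpret N: prob_space N by (rule N)
  have Fm: "F \<in> M \<rightarrow>\<^sub>M (\<Pi>\<^sub>M p\<in>UNIV. count_space UNIV)"
    using measurable_PiM_single'[of UNIV "\<lambda>p \<omega>. F \<omega> p" M "\<lambda>_. count_space UNIV"] F by (simp add: PiE_UNIV_domain)
  have Gm: "G \<in> N \<rightarrow>\<^sub>M (\<Pi>\<^sub>M p\<in>UNIV. count_space UNIV)"
    using measurable_PiM_single'[of UNIV "\<lambda>p \<omega>. G \<omega> p" N "\<lambda>_. count_space UNIV"] G by (simp add: PiE_UNIV_domain)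
  have Ldistr: "distr M (count_space UNIV) (\<lambda>\<omega>. cell_list n (\<lambda>p. Z p \<omega>)) = distr N (count_space UNIV) (\<lambda>\<omega>. cell_list n (\<lambda>p. W p \<omega>))" for n
  proof (rule measure_eqI_countable[of _ UNIV])
    fix xs :: "(nat \<times> nat) list"
    have "measure M {\<omega> \<in> space M. cell_list n (\<lambda>p. Z p \<omega>) = xs} = measure N {\<omega> \<in> space N. cell_list n (\<lambda>p. W p \<omega>) = xs}"
      unfolding cell_list_eq_iff using eq[of n "\<lambda>p. xs ! prod_encode p"] by (cases "length xs = n") simp_all
    moreover have "(\<lambda>\<omega>. cell_list n (\<lambda>p. Z p \<omega>)) -` {xs} \<inter> space M = {\<omega> \<in> space M. cell_list n (\<lambda>p. Z p \<omega>) = xs}"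
      "(\<lambda>\<omega>. cell_list n (\<lambda>p. W p \<omega>)) -` {xs} \<inter> space N = {\<omega> \<in> space N. cell_list n (\<lambda>p. W p \<omega>) = xs}" by auto
    ultimately show "emeasure (distr M (count_space UNIV) (\<lambda>\<omega>. cell_list n (\<lambda>p. Z p \<omega>))) {xs} = emeasure (distr N (count_space UNIV) (\<lambda>\<omega>. cell_list n (\<lambda>p. W p \<omega>))) {xs}"
      by (simp add: emeasure_distr measurable_cell_list[OF Z] measurable_cell_list[OF W] M.emeasure_eq_measure N.emeasure_eq_measure)
  qed auto
  show ?thesis
  proof (rule measure_eqI_PiM_infinite)
    show "finite_measure (distr M (\<Pi>\<^sub>M p\<in>UNIV. count_space UNIV) F)"
      using M.prob_space_distr[OF Fm] by (simp add: prob_space.finite_measure)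
    fix A :: "nat \<times> nat \<Rightarrow> int set" and I :: "(nat \<times> nat) set"
    assume I: "finite I" and A: "\<And>i. i \<in> I \<Longrightarrow> A i \<in> sets (count_space UNIV)"
    obtain m where m: "\<And>x y. (x, y) \<in> I \<Longrightarrow> x \<le> m \<and> y \<le> m"
    proof -
      have "finite (fst ` I \<union> snd ` I)" using I by simp
      then obtain m where "\<And>k. k \<in> fst ` I \<union> snd ` I \<Longrightarrow> k \<le> m" by (meson finite_nat_set_iff_bounded_le)
      then show ?thesis using that[of m] by force
    qed
    obtain n where n: "\<forall>x\<le>m. \<forall>y\<le>m. prod_encode (x, y) < n" using prod_encode_bounded by blast
    \<comment> \<open>The lists whose heights satisfy the constraints of the cylinder; every subset
      of a count space is measurable, so T needs no further argument.\<close>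
    define T where "T = {xs. \<forall>(x, y)\<in>I. height (\<lambda>p. xs ! prod_encode p) x y \<in> A (x, y)}"
    have hL: "height f x y = height (\<lambda>p. cell_list n f ! prod_encode p) x y" if "(x, y) \<in> I" for f x y
      by (rule height_cell_list) (use m[OF that] n in auto)
    define U where "U = prod_emb UNIV (\<lambda>p. count_space UNIV) I (Pi\<^sub>E I A)"
    have Us: "U \<in> sets (\<Pi>\<^sub>M p\<in>UNIV. count_space UNIV)"
      unfolding U_def using I A by (intro sets_PiM_I) auto
    have U: "f \<in> U \<longleftrightarrow> (\<forall>p\<in>I. f p \<in> A p)" for f
      by (auto simp: U_def prod_emb_def PiE_iff restrict_def extensional_def)
    \<comment> \<open>Stated for an arbitrary measure R because it is applied to both
      models.\<close>
    have FU: "emeasure (distr R (\<Pi>\<^sub>M p\<in>UNIV. count_space UNIV) K) U = emeasure (distr R (count_space UNIV) (\<lambda>\<omega>. cell_list n (\<lambda>p. Y p \<omega>))) T"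
      if Km: "K \<in> R \<rightarrow>\<^sub>M (\<Pi>\<^sub>M p\<in>UNIV. count_space UNIV)" and Y: "\<And>p. Y p \<in> R \<rightarrow>\<^sub>M count_space UNIV"
        and KY: "AE \<omega> in R. \<forall>x y. K \<omega> (x, y) = height (\<lambda>p. Y p \<omega>) x y" for R :: "'c measure" and K Y
    proof -
      have "emeasure R (K -` U \<inter> space R) = emeasure R ((\<lambda>\<omega>. cell_list n (\<lambda>p. Y p \<omega>)) -` T \<inter> space R)"
      proof (rule emeasure_eq_AE)
        show "AE \<omega> in R. \<omega> \<in> K -` U \<inter> space R \<longleftrightarrow> \<omega> \<in> (\<lambda>\<omega>. cell_list n (\<lambda>p. Y p \<omega>)) -` T \<inter> space R"
          using KY
        proof eventually_elim
          case (elim \<omega>)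
          have "K \<omega> \<in> U \<longleftrightarrow> cell_list n (\<lambda>p. Y p \<omega>) \<in> T"
            unfolding U T_def using elim hL[of _ _ "\<lambda>p. Y p \<omega>"] by (auto split: prod.splits)
          then show ?case by simp
        qed
      qed (use measurable_sets[OF Km Us] measurable_sets[OF measurable_cell_list[OF Y], of T] in simp_all)
      then show ?thesis by (simp add: emeasure_distr Km Us measurable_cell_list[OF Y])
    qed
    show "emeasure (distr M (\<Pi>\<^sub>M p\<in>UNIV. count_space UNIV) F) (prod_emb UNIV (\<lambda>p. count_space UNIV) I (Pi\<^sub>E I A)) =
       emeasure (distr N (\<Pi>\<^sub>M p\<in>UNIV. count_space UNIV) G) (prod_emb UNIV (\<lambda>p. count_space UNIV) I (Pi\<^sub>E I A))"
      unfolding U_def[symmetric] FU[OF Fm Z FZ] FU[OF Gm W GW] Ldistr ..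
  qed simp_all
qed

theorem theorem7p18:
  fixes q s \<alpha> \<beta> :: real and u \<theta> :: "nat \<Rightarrow> real"
    and M :: "'a measure" and \<eta> :: "nat \<Rightarrow> nat \<Rightarrow> 'a \<Rightarrow> nat multiset"
    and C :: "row_spec \<Rightarrow> col_spec \<Rightarrow> ybdata \<Rightarrow> (triple \<times> triple) pmf"
    and N :: "'b measure" and V H :: "nat \<Rightarrow> nat \<Rightarrow> 'b \<Rightarrow> nat" and P :: "'b \<Rightarrow> nat"
  assumes "0 < q" and "q < 1" and "-1 < s" and "s < 0"
    and "\<And>y. 1 \<le> y \<Longrightarrow> 0 \<le> u y \<and> u y < 1"
    and "\<And>x. 1 \<le> x \<Longrightarrow> - s \<le> \<theta> x \<and> \<theta> x \<le> - inverse s"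
    and "0 \<le> \<alpha>" and "\<alpha> \<le> - inverse s" and "0 \<le> \<beta>" and "\<beta> \<le> - inverse s"
    and "\<alpha> * \<beta> < 1" and "\<And>x. 1 \<le> x \<Longrightarrow> \<alpha> * \<theta> x < 1"
    and "yang_baxter_field M q s (sHL_rows \<alpha> u) (sqW_cols \<beta> \<theta>) C \<eta>"
    and "hs_model N q s u \<theta> \<alpha> \<beta> V H"
    and "q_poisson N q (\<alpha> * \<beta>) P" and "indep_of_model N P V H"
  shows "distr M (\<Pi>\<^sub>M p\<in>(UNIV :: (nat \<times> nat) set). count_space (UNIV :: int set))
           (\<lambda>\<omega> (x, y). int y - int (size (\<eta> x y \<omega>))) =
         distr N (\<Pi>\<^sub>M p\<in>(UNIV :: (nat \<times> nat) set). count_space (UNIV :: int set))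
           (\<lambda>\<omega> (x, y). hs_height V H x y \<omega> - int (P \<omega>))"
proof -
  interpret hs_setup q s \<alpha> \<beta> u \<theta> by unfold_locales (use assms in blast)+
  note hs = hs_law[OF assms(14-16)]
  obtain Z where Z: "\<And>p. Z p \<in> M \<rightarrow>\<^sub>M count_space UNIV"
    and Zlaw: "\<And>n z. measure M {\<omega> \<in> space M. \<forall>i\<in>{..<n}. Z (prod_decode i) \<omega> = z (prod_decode i)} = (\<Prod>i<n. kern z (prod_decode i))"
    and Zh: "AE \<omega> in M. \<forall>x y. int y - int (size (\<eta> x y \<omega>)) = height (\<lambda>p. Z p \<omega>) x y"
    using field_law[OF assms(13)] by blast
  have \<eta>m: "\<eta> x y \<in> M \<rightarrow>\<^sub>M count_space UNIV" for x y using assms(13) by (simp add: yang_baxter_field_def)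
  have M: "prob_space M" using assms(13) by (simp add: yang_baxter_field_def)
  have N: "prob_space N" using assms(14) by (simp add: hs_model_def)
  show ?thesis
  proof (rule height_law_eqI[OF M N Z hs(1)])
    show "measure M {\<omega> \<in> space M. \<forall>i\<in>{..<n}. Z (prod_decode i) \<omega> = z (prod_decode i)} =
       measure N {\<omega> \<in> space N. \<forall>i\<in>{..<n}. wcell V H P (prod_decode i) \<omega> = z (prod_decode i)}" for n z
      unfolding Zlaw hs(2) ..
    show "(\<lambda>\<omega>. (case p of (x, y) \<Rightarrow> int y - int (size (\<eta> x y \<omega>)))) \<in> M \<rightarrow>\<^sub>M count_space UNIV" for p
    proof -
      obtain x y where p: "p = (x, y)" by (cases p)
      have "(\<lambda>t. int y - int (size t)) \<circ> \<eta> x y \<in> M \<rightarrow>\<^sub>M count_space UNIV" using \<eta>m by (rule measurable_comp) simp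
      then show ?thesis by (simp add: p o_def)
    qed
    show "(\<lambda>\<omega>. (case p of (x, y) \<Rightarrow> hs_height V H x y \<omega> - int (P \<omega>))) \<in> N \<rightarrow>\<^sub>M count_space UNIV" for p
    proof -
      obtain x y where p: "p = (x, y)" by (cases p)
      show ?thesis unfolding p prod.case hs(3) by (rule measurable_height[OF hs(1)])
    qed
  qed (use Zh hs(3) in auto)
qed

end
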